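(* In $\mathbf{2Hilb}$, a general projective measurement corresponds to a decomposition of a Hilbert space into a set of orthogonal subspaces.
   Context: $\mathbf{2Hilb}$ is the symmetric monoidal 2-category of finite-dimensional 2-Hilbert spaces, linear functors and natural transformations. It is used here in matrix form (up to equivalence). Objects are $\mathbf{Hilb}^n$ for natural numbers $n$, where $\mathbf{Hilb}$ is the category of finite-dimensional Hilbert spaces; the monoidal unit object is $I=\mathbf{Hilb}$. A 1-cell $\mathbf{Hilb}^n\to\mathbf{Hilb}^m$ is an $m\times n$ matrix of finite-dimensional Hilbert spaces, and 1-cells compose by matrix multiplication with $\oplus$ and $\otimes$ in place of sum and product. A 2-cell $F\Rightarrow G$ is a matrix of linear maps $F_{i,j}\to G_{i,j}$, and vertical composition is entrywise. The operation $\dagger$ sends a 2-cell to the matrix of adjoint linear maps, and a 2-cell $\mu$ is unitary if $\mu^\dagger\cdot\mu=\mathrm{id}$ and $\mu\cdot\mu^\dagger=\mathrm{id}$. A Hilbert space $H$ is regarded as a 1-cell $\mathbf{Hilb}\to\mathbf{Hilb}$. A witness for an object $A$ is a pair of 1-cells $W_L:I\to A$ and $W_R:A\to I$ with 2-cells "create" $\mathrm{id}_I\Rightarrow W_R\circ W_L$ and "copy" $\mathrm{id}_A\Rightarrow W_L\circ W_R$, together with their $\dagger$-adjoints "delete" $W_R\circ W_L\Rightarrow\mathrm{id}_I$ and "compare" $W_L\circ W_R\Rightarrow\mathrm{id}_A$, such that: create and compare, and copy and delete, satisfy the zigzag equations making $W_L$ and $W_R$ ambidextrous duals; copy followed by compare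 is the identity; and the multiplication on $W_R\circ W_L$ induced by compare is commutative with respect to the symmetry. For $A=\mathbf{Hilb}^n$ the witness is unique up to unitary isomorphism, with $W_L$ the column matrix and $W_R$ the row matrix each having $n$ entries $\mathbb{C}$. A general projective measurement is a unitary 2-cell whose source is a Hilbert space $H:\mathbf{Hilb}\to\mathbf{Hilb}$ and whose target is a composite $\mathbf{Hilb}\xrightarrow{F}\mathbf{Hilb}^n\xrightarrow{W_R}\mathbf{Hilb}$, where $F$ is an arbitrary 1-cell and $W_R$ is the 1-cell $\mathbf{Hilb}^n\to\mathbf{Hilb}$ of a witness for $\mathbf{Hilb}^n$. *)

theory Defs
  imports Complex_Main "HOL-Library.Function_Algebras"
begin

section \<open>Finite-dimensional Hilbert spaces\<close>

class complex_vector = ab_group_add +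
  fixes scaleC :: "complex \<Rightarrow> 'a \<Rightarrow> 'a"  (infixr "*\<^sub>C" 75)
  assumes scaleC_add_right: "a *\<^sub>C (x + y) = a *\<^sub>C x + a *\<^sub>C y"
    and scaleC_add_left: "(a + b) *\<^sub>C x = a *\<^sub>C x + b *\<^sub>C x"
    and scaleC_scaleC: "a *\<^sub>C b *\<^sub>C x = (a * b) *\<^sub>C x"
    and scaleC_one: "1 *\<^sub>C x = x"

global_interpretation cvec: vector_space "scaleC :: complex \<Rightarrow> 'a \<Rightarrow> 'a::complex_vector"
  by unfold_locales (simp_all add: scaleC_add_right scaleC_add_left scaleC_scaleC scaleC_one)

instantiation complex :: complex_vector
begin
definition "scaleC a z = a * z" for a z :: complex
instance by standard (simp_all add: scaleC_complex_def algebra_simps)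
end

instantiation "fun" :: (type, complex_vector) complex_vector
begin
definition "scaleC a f = (\<lambda>x. a *\<^sub>C f x)" for f :: "'a \<Rightarrow> 'b"
instance
  by standard
    (simp_all add: scaleC_fun_def fun_eq_iff scaleC_add_right scaleC_add_left scaleC_scaleC scaleC_one)
end

text \<open>
  A Hilbert space is carried by a subspace of an ambient complex vector space; nothing is assumed
  about the form outside the carrier. Finite dimension makes completeness automatic.
  Inner products are linear in the second argument.
\<close>

record 'a hilb =
  hcarrier :: "'a set"
  hinner :: "'a \<Rightarrow> 'a \<Rightarrow> complex"

definition hilbert_space :: "'a::complex_vector hilb \<Rightarrow> bool" where
  "hilbert_space H \<longleftrightarrow>
     cvec.subspace (hcarrier H) \<and>
     (\<exists>B. finite B \<and> hcarrier H = cvec.span B) \<and>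
     (\<forall>x\<in>hcarrier H. \<forall>y\<in>hcarrier H. \<forall>z\<in>hcarrier H.
        hinner H x (y + z) = hinner H x y + hinner H x z) \<and>
     (\<forall>a. \<forall>x\<in>hcarrier H. \<forall>y\<in>hcarrier H. hinner H x (a *\<^sub>C y) = a * hinner H x y) \<and>
     (\<forall>x\<in>hcarrier H. \<forall>y\<in>hcarrier H. hinner H y x = cnj (hinner H x y)) \<and>
     (\<forall>x\<in>hcarrier H. x \<noteq> 0 \<longrightarrow> Re (hinner H x x) > 0)"

definition orthonormal_basis :: "'a::complex_vector hilb \<Rightarrow> 'a set \<Rightarrow> bool" where
  "orthonormal_basis H B \<longleftrightarrow>
     finite B \<and> cvec.span B = hcarrier H \<and>
     (\<forall>b\<in>B. \<forall>c\<in>B. hinner H b c = (if b = c then 1 else 0))"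

text \<open>
  An arbitrary choice; it is used only to write down tensor inner products and the linear extension
  of bilinear maps, which do not depend on it.
\<close>

definition onb :: "'a::complex_vector hilb \<Rightarrow> 'a set" where
  "onb H = (SOME B. orthonormal_basis H B)"

definition linear_map :: "'a::complex_vector hilb \<Rightarrow> 'b::complex_vector hilb \<Rightarrow> ('a \<Rightarrow> 'b) \<Rightarrow> bool" where
  "linear_map H K f \<longleftrightarrow>
     (\<forall>x\<in>hcarrier H. f x \<in> hcarrier K) \<and>
     (\<forall>x\<in>hcarrier H. \<forall>y\<in>hcarrier H. f (x + y) = f x + f y) \<and>
     (\<forall>a. \<forall>x\<in>hcarrier H. f (a *\<^sub>C x) = a *\<^sub>C f x)"

definition adjoint_map :: "'a hilb \<Rightarrow> 'b hilb \<Rightarrow> ('a \<Rightarrow> 'b) \<Rightarrow> 'b \<Rightarrow> 'a" where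
  "adjoint_map H K f y =
     (THE x. x \<in> hcarrier H \<and> (\<forall>h\<in>hcarrier H. hinner H h x = hinner K (f h) y))"

definition hcomplex :: "complex hilb" where
  "hcomplex = \<lparr>hcarrier = UNIV, hinner = (\<lambda>z w. cnj z * w)\<rparr>"

definition hzero :: "complex hilb" where
  "hzero = \<lparr>hcarrier = {0}, hinner = (\<lambda>z w. cnj z * w)\<rparr>"

definition dsum :: "nat \<Rightarrow> (nat \<Rightarrow> 'a::zero hilb) \<Rightarrow> (nat \<Rightarrow> 'a) hilb" where
  "dsum n H =
     \<lparr>hcarrier = {u. (\<forall>k<n. u k \<in> hcarrier (H k)) \<and> (\<forall>k\<ge>n. u k = 0)},
      hinner = (\<lambda>u v. \<Sum>k<n. hinner (H k) (u k) (v k))\<rparr>"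

definition dinj :: "nat \<Rightarrow> 'a::zero \<Rightarrow> nat \<Rightarrow> 'a" where
  "dinj k x = (\<lambda>l. if l = k then x else 0)"

text \<open>
  The elementary tensor of \<open>h\<close> and \<open>k\<close> is represented by the form
  \<open>(x, y) \<mapsto> \<langle>x, h\<rangle> \<langle>y, k\<rangle>\<close>, which is conjugate-linear in \<open>x\<close> and \<open>y\<close> and set to 0 off the
  carriers. The coefficient of a tensor \<open>t\<close> at a pair \<open>(b, c)\<close> of basis vectors is then \<open>t b c\<close>.
\<close>

definition elem :: "'a hilb \<Rightarrow> 'b hilb \<Rightarrow> 'a \<Rightarrow> 'b \<Rightarrow> 'a \<Rightarrow> 'b \<Rightarrow> complex" where
  "elem H K h k =
     (\<lambda>x y. if x \<in> hcarrier H \<and> y \<in> hcarrier K then hinner H x h * hinner K y k else 0)"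

definition tensor ::
    "'a::complex_vector hilb \<Rightarrow> 'b::complex_vector hilb \<Rightarrow> ('a \<Rightarrow> 'b \<Rightarrow> complex) hilb" where
  "tensor H K =
     \<lparr>hcarrier = cvec.span {elem H K h k | h k. h \<in> hcarrier H \<and> k \<in> hcarrier K},
      hinner = (\<lambda>s t. \<Sum>b\<in>onb H. \<Sum>c\<in>onb K. cnj (s b c) * t b c)\<rparr>"

text \<open>For bilinear \<open>\<beta>\<close>, the linear map on the tensor product that takes \<open>elem H K h k\<close> to \<open>\<beta> h k\<close>.\<close>

definition lift ::
    "'a::complex_vector hilb \<Rightarrow> 'b::complex_vector hilb \<Rightarrow> ('a \<Rightarrow> 'b \<Rightarrow> 'c::complex_vector) \<Rightarrow>
     ('a \<Rightarrow> 'b \<Rightarrow> complex) \<Rightarrow> 'c" where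
  "lift H K \<beta> t = (\<Sum>b\<in>onb H. \<Sum>c\<in>onb K. t b c *\<^sub>C \<beta> b c)"


section \<open>The 2-category 2Hilb in matrix form\<close>

text \<open>
  The object \<open>Hilb\<^sup>n\<close> is represented by \<open>n\<close>, and matrix indices start at 0. Only the entries
  in range are meaningful.
\<close>

record 'a onecell =
  tgt :: nat
  src :: nat
  ent :: "nat \<Rightarrow> nat \<Rightarrow> 'a hilb"

definition one_cell :: "nat \<Rightarrow> nat \<Rightarrow> 'a::complex_vector onecell \<Rightarrow> bool" where
  "one_cell n m F \<longleftrightarrow>
     src F = n \<and> tgt F = m \<and> (\<forall>i<m. \<forall>j<n. hilbert_space (ent F i j))"

definition id_one :: "nat \<Rightarrow> complex onecell" where
  "id_one n = \<lparr>tgt = n, src = n, ent = (\<lambda>i j. if i = j then hcomplex else hzero)\<rparr>"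

definition one_comp ::
    "'a::complex_vector onecell \<Rightarrow> 'b::complex_vector onecell \<Rightarrow>
     (nat \<Rightarrow> 'a \<Rightarrow> 'b \<Rightarrow> complex) onecell"  (infixr "\<odot>" 70) where
  "G \<odot> F =
     \<lparr>tgt = tgt G, src = src F,
      ent = (\<lambda>i j. dsum (src G) (\<lambda>k. tensor (ent G i k) (ent F k j)))\<rparr>"

definition scalar :: "'a hilb \<Rightarrow> 'a onecell" where
  "scalar H = \<lparr>tgt = 1, src = 1, ent = (\<lambda>_ _. H)\<rparr>"

record ('a, 'b) twocell =
  dom2 :: "'a onecell"
  cod2 :: "'b onecell"
  app2 :: "nat \<Rightarrow> nat \<Rightarrow> 'a \<Rightarrow> 'b"

definition two_cell ::
    "'a::complex_vector onecell \<Rightarrow> 'b::complex_vector onecell \<Rightarrow> ('a, 'b) twocell \<Rightarrow> bool" where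
  "two_cell F G \<mu> \<longleftrightarrow>
     dom2 \<mu> = F \<and> cod2 \<mu> = G \<and> src F = src G \<and> tgt F = tgt G \<and>
     (\<forall>i<tgt F. \<forall>j<src F. linear_map (ent F i j) (ent G i j) (app2 \<mu> i j))"

definition cell_eq :: "('a, 'b) twocell \<Rightarrow> ('a, 'b) twocell \<Rightarrow> bool"  (infix "\<approx>" 50) where
  "\<mu> \<approx> \<nu> \<longleftrightarrow>
     dom2 \<mu> = dom2 \<nu> \<and> cod2 \<mu> = cod2 \<nu> \<and>
     (\<forall>i<tgt (dom2 \<mu>). \<forall>j<src (dom2 \<mu>). \<forall>x\<in>hcarrier (ent (dom2 \<mu>) i j).
        app2 \<mu> i j x = app2 \<nu> i j x)"

definition id_two :: "'a onecell \<Rightarrow> ('a, 'a) twocell" where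
  "id_two F = \<lparr>dom2 = F, cod2 = F, app2 = (\<lambda>i j x. x)\<rparr>"

definition vcomp :: "('b, 'c) twocell \<Rightarrow> ('a, 'b) twocell \<Rightarrow> ('a, 'c) twocell"  (infixr "\<cdot>" 60) where
  "\<nu> \<cdot> \<mu> =
     \<lparr>dom2 = dom2 \<mu>, cod2 = cod2 \<nu>, app2 = (\<lambda>i j x. app2 \<nu> i j (app2 \<mu> i j x))\<rparr>"

definition dagger :: "('a, 'b) twocell \<Rightarrow> ('b, 'a) twocell" where
  "dagger \<mu> =
     \<lparr>dom2 = cod2 \<mu>, cod2 = dom2 \<mu>,
      app2 = (\<lambda>i j. adjoint_map (ent (dom2 \<mu>) i j) (ent (cod2 \<mu>) i j) (app2 \<mu> i j))\<rparr>"

definition unitary_cell :: "('a, 'b) twocell \<Rightarrow> bool" where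
  "unitary_cell \<mu> \<longleftrightarrow>
     dagger \<mu> \<cdot> \<mu> \<approx> id_two (dom2 \<mu>) \<and> \<mu> \<cdot> dagger \<mu> \<approx> id_two (cod2 \<mu>)"

text \<open>
  Horizontal composition; its entries are direct sums of tensor products of linear maps. Whiskering
  is horizontal composition with an identity 2-cell.
\<close>

definition hcomp ::
    "('c::complex_vector, 'd) twocell \<Rightarrow> ('a::complex_vector, 'b) twocell \<Rightarrow>
     (nat \<Rightarrow> 'c \<Rightarrow> 'a \<Rightarrow> complex,
      nat \<Rightarrow> 'd::complex_vector \<Rightarrow> 'b::complex_vector \<Rightarrow> complex) twocell"  (infixr "\<star>" 65) where
  "\<beta> \<star> \<alpha> =
     \<lparr>dom2 = dom2 \<beta> \<odot> dom2 \<alpha>, cod2 = cod2 \<beta> \<odot> cod2 \<alpha>,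
      app2 = (\<lambda>i j u k.
        if k < src (dom2 \<beta>)
        then lift (ent (dom2 \<beta>) i k) (ent (dom2 \<alpha>) k j)
               (\<lambda>x y. elem (ent (cod2 \<beta>) i k) (ent (cod2 \<alpha>) k j) (app2 \<beta> i k x) (app2 \<alpha> k j y))
               (u k)
        else 0)\<rparr>"

text \<open>
  The coherence isomorphisms: \<open>1 \<odot> F \<cong> F \<cong> F \<odot> 1\<close> and \<open>H \<odot> (G \<odot> F) \<cong> (H \<odot> G) \<odot> F\<close>. In the
  unitors all summands but one are zero spaces. The associator takes \<open>h \<otimes> (g \<otimes> f)\<close>, with
  \<open>g \<otimes> f\<close> in summand \<open>k\<close> and the whole in summand \<open>j\<close>, to \<open>(h \<otimes> g) \<otimes> f\<close>, with \<open>h \<otimes> g\<close> in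
  summand \<open>j\<close> and the whole in summand \<open>k\<close>.
\<close>

definition lunit :: "'a::complex_vector onecell \<Rightarrow> (nat \<Rightarrow> complex \<Rightarrow> 'a \<Rightarrow> complex, 'a) twocell" where
  "lunit F =
     \<lparr>dom2 = id_one (tgt F) \<odot> F, cod2 = F,
      app2 = (\<lambda>i j u. lift hcomplex (ent F i j) (\<lambda>z x. z *\<^sub>C x) (u i))\<rparr>"

definition lunit_inv :: "'a::complex_vector onecell \<Rightarrow> ('a, nat \<Rightarrow> complex \<Rightarrow> 'a \<Rightarrow> complex) twocell" where
  "lunit_inv F =
     \<lparr>dom2 = F, cod2 = id_one (tgt F) \<odot> F,
      app2 = (\<lambda>i j x. dinj i (elem hcomplex (ent F i j) 1 x))\<rparr>"

definition runit :: "'a::complex_vector onecell \<Rightarrow> (nat \<Rightarrow> 'a \<Rightarrow> complex \<Rightarrow> complex, 'a) twocell" where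
  "runit F =
     \<lparr>dom2 = F \<odot> id_one (src F), cod2 = F,
      app2 = (\<lambda>i j u. lift (ent F i j) hcomplex (\<lambda>x z. z *\<^sub>C x) (u j))\<rparr>"

definition runit_inv :: "'a::complex_vector onecell \<Rightarrow> ('a, nat \<Rightarrow> 'a \<Rightarrow> complex \<Rightarrow> complex) twocell" where
  "runit_inv F =
     \<lparr>dom2 = F, cod2 = F \<odot> id_one (src F),
      app2 = (\<lambda>i j x. dinj j (elem (ent F i j) hcomplex x 1))\<rparr>"

definition assoc ::
    "'c::complex_vector onecell \<Rightarrow> 'b::complex_vector onecell \<Rightarrow> 'a::complex_vector onecell \<Rightarrow>
     (nat \<Rightarrow> 'c \<Rightarrow> (nat \<Rightarrow> 'b \<Rightarrow> 'a \<Rightarrow> complex) \<Rightarrow> complex,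
      nat \<Rightarrow> (nat \<Rightarrow> 'c \<Rightarrow> 'b \<Rightarrow> complex) \<Rightarrow> 'a \<Rightarrow> complex) twocell" where
  "assoc H G F =
     \<lparr>dom2 = H \<odot> (G \<odot> F), cod2 = (H \<odot> G) \<odot> F,
      app2 = (\<lambda>i l u.
        \<Sum>j<src H. lift (ent H i j) (ent (G \<odot> F) j l)
          (\<lambda>h v. \<Sum>k<src G. lift (ent G j k) (ent F k l)
             (\<lambda>g f. dinj k (elem (ent (H \<odot> G) i k) (ent F k l)
                              (dinj j (elem (ent H i j) (ent G j k) h g)) f))
             (v k))
          (u j))\<rparr>"

definition assoc_inv ::
    "'c::complex_vector onecell \<Rightarrow> 'b::complex_vector onecell \<Rightarrow> 'a::complex_vector onecell \<Rightarrow>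
     (nat \<Rightarrow> (nat \<Rightarrow> 'c \<Rightarrow> 'b \<Rightarrow> complex) \<Rightarrow> 'a \<Rightarrow> complex,
      nat \<Rightarrow> 'c \<Rightarrow> (nat \<Rightarrow> 'b \<Rightarrow> 'a \<Rightarrow> complex) \<Rightarrow> complex) twocell" where
  "assoc_inv H G F =
     \<lparr>dom2 = (H \<odot> G) \<odot> F, cod2 = H \<odot> (G \<odot> F),
      app2 = (\<lambda>i l u.
        \<Sum>k<src G. lift (ent (H \<odot> G) i k) (ent F k l)
          (\<lambda>v f. \<Sum>j<src H. lift (ent H i j) (ent G j k)
             (\<lambda>h g. dinj j (elem (ent H i j) (ent (G \<odot> F) j l)
                              h (dinj k (elem (ent G j k) (ent F k l) g f))))
             (v j))
          (u k))\<rparr>"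

text \<open>The symmetry on the scalars, that is, on 1-cells from \<open>Hilb\<close> to itself.\<close>

definition swap_scalars ::
    "'a::complex_vector onecell \<Rightarrow> 'b::complex_vector onecell \<Rightarrow>
     (nat \<Rightarrow> 'a \<Rightarrow> 'b \<Rightarrow> complex, nat \<Rightarrow> 'b \<Rightarrow> 'a \<Rightarrow> complex) twocell" where
  "swap_scalars M N =
     \<lparr>dom2 = M \<odot> N, cod2 = N \<odot> M,
      app2 = (\<lambda>i j u. dinj 0 (lift (ent M 0 0) (ent N 0 0)
                (\<lambda>x y. elem (ent N 0 0) (ent M 0 0) y x) (u 0)))\<rparr>"


section \<open>Witnesses\<close>

record ('l, 'r) witness =
  wl :: "'l onecell"
  wr :: "'r onecell"
  create :: "(complex, nat \<Rightarrow> 'r \<Rightarrow> 'l \<Rightarrow> complex) twocell"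
  copy :: "(complex, nat \<Rightarrow> 'l \<Rightarrow> 'r \<Rightarrow> complex) twocell"

definition delete ::
    "('l, 'r) witness \<Rightarrow> (nat \<Rightarrow> 'r \<Rightarrow> 'l \<Rightarrow> complex, complex) twocell" where
  "delete W = dagger (create W)"

definition compare ::
    "('l, 'r) witness \<Rightarrow> (nat \<Rightarrow> 'l \<Rightarrow> 'r \<Rightarrow> complex, complex) twocell" where
  "compare W = dagger (copy W)"

text \<open>
  The multiplication on \<open>wr W \<odot> wl W\<close>, applying compare to the two inner factors.
\<close>

definition wmult where
  "wmult W =
     (runit (wr W) \<star> id_two (wl W))
     \<cdot> ((id_two (wr W) \<star> compare W) \<star> id_two (wl W))
     \<cdot> (assoc_inv (wr W) (wl W) (wr W) \<star> id_two (wl W))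
     \<cdot> assoc (wr W \<odot> wl W) (wr W) (wl W)"

text \<open>
  Of the four zigzag equations below, the first two make create and compare the unit and counit of a
  duality between \<open>wl W\<close> and \<open>wr W\<close>, the last two do the same for copy and delete with the
  roles of \<open>wl W\<close> and \<open>wr W\<close> exchanged.
\<close>

definition is_witness ::
    "nat \<Rightarrow> ('l::complex_vector, 'r::complex_vector) witness \<Rightarrow> bool" where
  "is_witness n W \<longleftrightarrow>
     one_cell 1 n (wl W) \<and> one_cell n 1 (wr W) \<and>
     two_cell (id_one 1) (wr W \<odot> wl W) (create W) \<and>
     two_cell (id_one n) (wl W \<odot> wr W) (copy W) \<and>
     lunit (wl W) \<cdot> (compare W \<star> id_two (wl W)) \<cdot> assoc (wl W) (wr W) (wl W)
       \<cdot> (id_two (wl W) \<star> create W) \<cdot> runit_inv (wl W) \<approx> id_two (wl W) \<and>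
     runit (wr W) \<cdot> (id_two (wr W) \<star> compare W) \<cdot> assoc_inv (wr W) (wl W) (wr W)
       \<cdot> (create W \<star> id_two (wr W)) \<cdot> lunit_inv (wr W) \<approx> id_two (wr W) \<and>
     lunit (wr W) \<cdot> (delete W \<star> id_two (wr W)) \<cdot> assoc (wr W) (wl W) (wr W)
       \<cdot> (id_two (wr W) \<star> copy W) \<cdot> runit_inv (wr W) \<approx> id_two (wr W) \<and>
     runit (wl W) \<cdot> (id_two (wl W) \<star> delete W) \<cdot> assoc_inv (wl W) (wr W) (wl W)
       \<cdot> (copy W \<star> id_two (wl W)) \<cdot> lunit_inv (wl W) \<approx> id_two (wl W) \<and>
     compare W \<cdot> copy W \<approx> id_two (id_one n) \<and>
     wmult W \<cdot> swap_scalars (wr W \<odot> wl W) (wr W \<odot> wl W) \<approx> wmult W"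

text \<open>Compatibility with delete and compare follows by taking daggers.\<close>

definition witness_iso ::
    "('l::complex_vector, 'r::complex_vector) witness \<Rightarrow>
     ('k::complex_vector, 's::complex_vector) witness \<Rightarrow>
     ('l, 'k) twocell \<Rightarrow> ('r, 's) twocell \<Rightarrow> bool" where
  "witness_iso W W' \<theta>\<^sub>L \<theta>\<^sub>R \<longleftrightarrow>
     two_cell (wl W) (wl W') \<theta>\<^sub>L \<and> unitary_cell \<theta>\<^sub>L \<and>
     two_cell (wr W) (wr W') \<theta>\<^sub>R \<and> unitary_cell \<theta>\<^sub>R \<and>
     (\<theta>\<^sub>R \<star> \<theta>\<^sub>L) \<cdot> create W \<approx> create W' \<and>
     (\<theta>\<^sub>L \<star> \<theta>\<^sub>R) \<cdot> copy W \<approx> copy W'"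


section \<open>Measurements and decompositions\<close>

definition proj_measurement ::
    "'h::complex_vector hilb \<Rightarrow> nat \<Rightarrow> ('l::complex_vector, 'r::complex_vector) witness \<Rightarrow>
     'f::complex_vector onecell \<Rightarrow> ('h, nat \<Rightarrow> 'r \<Rightarrow> 'f \<Rightarrow> complex) twocell \<Rightarrow> bool" where
  "proj_measurement H n W F \<mu> \<longleftrightarrow>
     hilbert_space H \<and> is_witness n W \<and> one_cell 1 n F \<and>
     two_cell (scalar H) (wr W \<odot> F) \<mu> \<and> unitary_cell \<mu>"

definition measurement_equiv ::
    "('l::complex_vector, 'r::complex_vector) witness \<Rightarrow> 'f::complex_vector onecell \<Rightarrow>
     ('h::complex_vector, nat \<Rightarrow> 'r \<Rightarrow> 'f \<Rightarrow> complex) twocell \<Rightarrow>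
     ('k::complex_vector, 's::complex_vector) witness \<Rightarrow> 'g::complex_vector onecell \<Rightarrow>
     ('h, nat \<Rightarrow> 's \<Rightarrow> 'g \<Rightarrow> complex) twocell \<Rightarrow> bool" where
  "measurement_equiv W F \<mu> W' F' \<mu>' \<longleftrightarrow>
     (\<exists>\<theta>\<^sub>L \<theta>\<^sub>R \<alpha>. witness_iso W W' \<theta>\<^sub>L \<theta>\<^sub>R \<and> two_cell F F' \<alpha> \<and> unitary_cell \<alpha> \<and>
        (\<theta>\<^sub>R \<star> \<alpha>) \<cdot> \<mu> \<approx> \<mu>')"

text \<open>
  The target of a measurement \<open>\<mu>\<close> is the direct sum over \<open>k < n\<close> of the spaces
  \<open>tensor (ent (wr W) 0 k) (ent F k 0)\<close>. The subspace belonging to outcome \<open>k\<close> is the image of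
  the \<open>k\<close>-th summand under the adjoint, which is the inverse, of \<open>\<mu>\<close>.
\<close>

definition outcome_space ::
    "('l, 'r::complex_vector) witness \<Rightarrow> 'f::complex_vector onecell \<Rightarrow>
     ('h, nat \<Rightarrow> 'r \<Rightarrow> 'f \<Rightarrow> complex) twocell \<Rightarrow> nat \<Rightarrow> 'h set" where
  "outcome_space W F \<mu> k =
     (\<lambda>t. app2 (dagger \<mu>) 0 0 (dinj k t)) ` hcarrier (tensor (ent (wr W) 0 k) (ent F k 0))"

text \<open>Individual subspaces may be zero, as the entries of the 1-cell \<open>F\<close> may be.\<close>

definition orthogonal_decomposition ::
    "'h::complex_vector hilb \<Rightarrow> nat \<Rightarrow> (nat \<Rightarrow> 'h set) \<Rightarrow> bool" where
  "orthogonal_decomposition H n V \<longleftrightarrow>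
     (\<forall>k<n. V k \<subseteq> hcarrier H \<and> cvec.subspace (V k)) \<and>
     (\<forall>k<n. \<forall>l<n. k \<noteq> l \<longrightarrow> (\<forall>x\<in>V k. \<forall>y\<in>V l. hinner H x y = 0)) \<and>
     hcarrier H = {\<Sum>k<n. v k | v. \<forall>k<n. v k \<in> V k}"

end

theory Submission
  imports Defs
begin

text \<open>
  A measurement is a unitary from \<open>H\<close> onto the direct sum of the spaces \<open>R\<^sub>k \<otimes> F\<^sub>k\<close>, where \<open>R\<^sub>k\<close>
  and \<open>L\<^sub>k\<close> are the entries of the two 1-cells of the witness. Its adjoint carries the summands,
  which are orthogonal and span, to orthogonal subspaces that span \<open>H\<close>
  (\<open>outcome_spaces_decompose\<close>). For the other direction a family of subspaces \<open>V\<^sub>k\<close> must be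
  written in the form \<open>R\<^sub>k \<otimes> F\<^sub>k\<close>, so the content of the theorem lies in the structure of
  witnesses: every \<open>R\<^sub>k\<close> and every \<open>L\<^sub>k\<close> is one-dimensional.

  On elementary tensors the multiplication of a witness is
  \<open>(r \<otimes> l) (r' \<otimes> l') = \<langle>l, r'\<rangle> (r \<otimes> l')\<close>, where \<open>\<langle>_, _\<rangle>\<close> is the pairing of \<open>L\<^sub>k\<close> with \<open>R\<^sub>k\<close>
  induced by compare, and products of different summands vanish (\<open>mult_elem\<close>). This is a sum of
  matrix algebras, and commutativity forces each of them to have size one
  (\<open>lines_of_witness\<close>). The size is not zero, because compare is a left inverse of copy. The same
  equation and one zigzag equation then fix the scalars that remain, and one obtains unit vectors
  \<open>r\<^sub>k\<close> and \<open>l\<^sub>k\<close> with \<open>create 1 = \<Sum>\<^sub>k r\<^sub>k \<otimes> l\<^sub>k\<close> and \<open>copy 1 = l\<^sub>k \<otimes> r\<^sub>k\<close> in each diagonal entry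
  (\<open>witness_basis_exists\<close>). Conversely such vectors always give a witness
  (\<open>witness_basis.is_witness\<close>), which yields existence for every \<open>n\<close>, and matching the vectors
  of two witnesses gives a unitary isomorphism between them.

  With the vectors \<open>r\<^sub>k\<close> at hand, \<open>y \<mapsto> r\<^sub>k \<otimes> y\<close> is a unitary from \<open>F\<^sub>k\<close> to \<open>R\<^sub>k \<otimes> F\<^sub>k\<close>. A
  decomposition \<open>V\<close> is therefore measured by \<open>x \<mapsto> \<Sum>\<^sub>k r\<^sub>k \<otimes> P\<^sub>k x\<close>, with \<open>P\<^sub>k\<close> the projection to
  \<open>V\<^sub>k\<close> (locale \<open>decomposition\<close>). For any measurement, \<open>F\<^sub>k\<close> is identified with the \<open>k\<close>-th
  outcome space; two measurements with the same outcome spaces are thus related by the unitary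
  that passes through this common space, while an equivalence preserves the summands and hence
  the outcome spaces (locale \<open>measurement_pair\<close>).
\<close>

section \<open>Linear algebra in function spaces\<close>

lemma scaleC_fun_apply [simp]: "(a *\<^sub>C f) x = a *\<^sub>C f x"
  for f :: "'a \<Rightarrow> 'b::complex_vector"
  by (simp add: scaleC_fun_def)

lemma scaleC_complex [simp]: "a *\<^sub>C z = a * z" for z :: complex
  by (simp add: scaleC_complex_def)

lemma sum_fun_apply [simp]: "(\<Sum>i\<in>A. f i) x = (\<Sum>i\<in>A. f i x)"
  for f :: "'i \<Rightarrow> 'a \<Rightarrow> 'b::comm_monoid_add"
  by (induction A rule: infinite_finite_induct) auto

text \<open>
  Linearity is kept apart from the condition on targets, and is relative to a set. The structural
  2-cells below are linear on their whole ambient function type, so their values on sums can be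
  computed without membership conditions.
\<close>

definition lin :: "'a::complex_vector set \<Rightarrow> ('a \<Rightarrow> 'b::complex_vector) \<Rightarrow> bool" where
  "lin S f \<longleftrightarrow>
     (\<forall>x\<in>S. \<forall>y\<in>S. f (x + y) = f x + f y) \<and> (\<forall>a. \<forall>x\<in>S. f (a *\<^sub>C x) = a *\<^sub>C f x)"

lemma linI:
  assumes "\<And>x y. x \<in> S \<Longrightarrow> y \<in> S \<Longrightarrow> f (x + y) = f x + f y"
    and "\<And>a x. x \<in> S \<Longrightarrow> f (a *\<^sub>C x) = a *\<^sub>C f x"
  shows "lin S f"
  using assms by (simp add: lin_def)

lemma linear_map_lin:
  "linear_map H K f \<longleftrightarrow> (\<forall>x\<in>hcarrier H. f x \<in> hcarrier K) \<and> lin (hcarrier H) f"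
  by (auto simp: linear_map_def lin_def)

lemma lin_add: "lin S f \<Longrightarrow> x \<in> S \<Longrightarrow> y \<in> S \<Longrightarrow> f (x + y) = f x + f y"
  and lin_scale: "lin S f \<Longrightarrow> x \<in> S \<Longrightarrow> f (a *\<^sub>C x) = a *\<^sub>C f x"
  by (auto simp: lin_def)

lemma lin_zero: "lin S f \<Longrightarrow> cvec.subspace S \<Longrightarrow> f 0 = 0"
  using lin_scale[of S f 0 0] by (simp add: cvec.subspace_0)

lemma lin_sum:
  assumes "lin S f" "cvec.subspace S" "\<And>i. i \<in> A \<Longrightarrow> g i \<in> S"
  shows "f (\<Sum>i\<in>A. g i) = (\<Sum>i\<in>A. f (g i))"
  using assms(3)
proof (induction A rule: infinite_finite_induct)
  case (insert i A)
  then have "(\<Sum>i\<in>A. g i) \<in> S"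
    by (intro cvec.subspace_sum[OF assms(2)]) auto
  with insert show ?case
    by (simp add: lin_add[OF assms(1)])
qed (auto intro: lin_zero assms)

lemma lin_diff: "lin S f \<Longrightarrow> cvec.subspace S \<Longrightarrow> x \<in> S \<Longrightarrow> y \<in> S \<Longrightarrow> f (x - y) = f x - f y"
  using lin_add[of S f "x - y" y] by (simp add: cvec.subspace_diff)

lemma lin_eq_on_span:
  assumes "lin (cvec.span A) f" "lin (cvec.span A) g" "\<And>x. x \<in> A \<Longrightarrow> f x = g x"
    and "x \<in> cvec.span A"
  shows "f x = g x"
proof -
  have "x \<in> cvec.span A \<and> f x = g x"
    using assms(4)
  proof (induction rule: cvec.span_induct_alt)
    case base
    then show ?case
      using lin_zero[OF assms(1)] lin_zero[OF assms(2)] by (simp add: cvec.span_zero)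
  next
    case (step c x y)
    then have "x \<in> cvec.span A" "f x = g x" using assms(3) by (auto simp: cvec.span_base)
    with step show ?case
      using assms(1,2) by (simp add: lin_add lin_scale cvec.span_add cvec.span_scale)
  qed
  then show ?thesis by simp
qed

lemma lin_image_span:
  assumes "lin (cvec.span A) f" "cvec.subspace T" "f ` A \<subseteq> T" "x \<in> cvec.span A"
  shows "f x \<in> T"
proof -
  have "x \<in> cvec.span A \<and> f x \<in> T"
    using assms(4)
  proof (induction rule: cvec.span_induct_alt)
    case base
    then show ?case
      using lin_zero[OF assms(1)] assms(2) by (simp add: cvec.span_zero cvec.subspace_0)
  next
    case (step c x y)
    then have "x \<in> cvec.span A" "f x \<in> T" using assms(3) by (auto simp: cvec.span_base)
    with step show ?case
      using assms(1,2)
      by (simp add: lin_add lin_scale cvec.span_add cvec.span_scale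
        cvec.subspace_add cvec.subspace_scale)
  qed
  then show ?thesis by simp
qed

lemma subspace_lin_image:
  assumes "lin S f" "cvec.subspace S"
  shows "cvec.subspace (f ` S)"
proof (rule cvec.subspaceI)
  show "0 \<in> f ` S"
    using lin_zero[OF assms] assms(2) by (metis cvec.subspace_0 imageI)
next
  fix x y assume "x \<in> f ` S" "y \<in> f ` S"
  then obtain x' y' where "x' \<in> S" "y' \<in> S" "x = f x'" "y = f y'" by auto
  then show "x + y \<in> f ` S"
    using lin_add[OF assms(1), of x' y'] assms(2)
    by (intro image_eqI[of _ _ "x' + y'"]) (simp_all add: cvec.subspace_add)
next
  fix c x assume "x \<in> f ` S"
  then obtain x' where "x' \<in> S" "x = f x'" by auto
  then show "c *\<^sub>C x \<in> f ` S"
    using lin_scale[OF assms(1), of x'] assms(2)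
    by (intro image_eqI[of _ _ "c *\<^sub>C x'"]) (simp_all add: cvec.subspace_scale)
qed


section \<open>Inner products and orthonormal bases\<close>

lemma hilbert_subspace: "hilbert_space H \<Longrightarrow> cvec.subspace (hcarrier H)"
  by (simp add: hilbert_space_def)

lemma carrier_zero: "hilbert_space H \<Longrightarrow> 0 \<in> hcarrier H"
  by (rule cvec.subspace_0[OF hilbert_subspace])

lemma carrier_add:
  "hilbert_space H \<Longrightarrow> x \<in> hcarrier H \<Longrightarrow> y \<in> hcarrier H \<Longrightarrow> x + y \<in> hcarrier H"
  by (rule cvec.subspace_add[OF hilbert_subspace])

lemma carrier_diff:
  "hilbert_space H \<Longrightarrow> x \<in> hcarrier H \<Longrightarrow> y \<in> hcarrier H \<Longrightarrow> x - y \<in> hcarrier H"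
  by (rule cvec.subspace_diff[OF hilbert_subspace])

lemma carrier_scale: "hilbert_space H \<Longrightarrow> x \<in> hcarrier H \<Longrightarrow> a *\<^sub>C x \<in> hcarrier H"
  by (rule cvec.subspace_scale[OF hilbert_subspace])

lemma carrier_sum:
  "hilbert_space H \<Longrightarrow> (\<And>i. i \<in> A \<Longrightarrow> g i \<in> hcarrier H) \<Longrightarrow> (\<Sum>i\<in>A. g i) \<in> hcarrier H"
  by (rule cvec.subspace_sum[OF hilbert_subspace])

lemma inner_sym:
  "hilbert_space H \<Longrightarrow> x \<in> hcarrier H \<Longrightarrow> y \<in> hcarrier H \<Longrightarrow> cnj (hinner H x y) = hinner H y x"
  unfolding hilbert_space_def by metis

lemma inner_add_right:
  "hilbert_space H \<Longrightarrow> x \<in> hcarrier H \<Longrightarrow> y \<in> hcarrier H \<Longrightarrow> z \<in> hcarrier H \<Longrightarrow>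
    hinner H x (y + z) = hinner H x y + hinner H x z"
  unfolding hilbert_space_def by blast

lemma inner_scale_right:
  "hilbert_space H \<Longrightarrow> x \<in> hcarrier H \<Longrightarrow> y \<in> hcarrier H \<Longrightarrow>
    hinner H x (a *\<^sub>C y) = a * hinner H x y"
  unfolding hilbert_space_def by blast

lemma inner_self_pos: "hilbert_space H \<Longrightarrow> x \<in> hcarrier H \<Longrightarrow> x \<noteq> 0 \<Longrightarrow> Re (hinner H x x) > 0"
  unfolding hilbert_space_def by blast

lemma lin_inner: "hilbert_space H \<Longrightarrow> x \<in> hcarrier H \<Longrightarrow> lin (hcarrier H) (hinner H x)"
  by (simp add: lin_def inner_add_right inner_scale_right)

lemma inner_diff_right:
  "hilbert_space H \<Longrightarrow> x \<in> hcarrier H \<Longrightarrow> y \<in> hcarrier H \<Longrightarrow> z \<in> hcarrier H \<Longrightarrow>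
    hinner H x (y - z) = hinner H x y - hinner H x z"
  by (simp add: lin_diff[OF lin_inner hilbert_subspace])

lemma inner_zero_right: "hilbert_space H \<Longrightarrow> x \<in> hcarrier H \<Longrightarrow> hinner H x 0 = 0"
  by (simp add: lin_zero[OF lin_inner hilbert_subspace])

lemma inner_sum_right:
  assumes "hilbert_space H" "x \<in> hcarrier H" "\<And>i. i \<in> A \<Longrightarrow> g i \<in> hcarrier H"
  shows "hinner H x (\<Sum>i\<in>A. g i) = (\<Sum>i\<in>A. hinner H x (g i))"
  by (rule lin_sum[OF lin_inner hilbert_subspace]) (use assms in auto)

lemma inner_zero_left: "hilbert_space H \<Longrightarrow> x \<in> hcarrier H \<Longrightarrow> hinner H 0 x = 0"
  using inner_sym[of H x 0] by (simp add: inner_zero_right carrier_zero)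

lemma inner_scale_left:
  "hilbert_space H \<Longrightarrow> x \<in> hcarrier H \<Longrightarrow> y \<in> hcarrier H \<Longrightarrow>
    hinner H (a *\<^sub>C y) x = cnj a * hinner H y x"
  using inner_sym[of H x "a *\<^sub>C y"] inner_sym[of H x y]
  by (simp add: inner_scale_right carrier_scale)

lemma inner_sum_left:
  assumes "hilbert_space H" "x \<in> hcarrier H" "\<And>i. i \<in> A \<Longrightarrow> g i \<in> hcarrier H"
  shows "hinner H (\<Sum>i\<in>A. g i) x = (\<Sum>i\<in>A. hinner H (g i) x)"
proof -
  have "hinner H (\<Sum>i\<in>A. g i) x = cnj (hinner H x (\<Sum>i\<in>A. g i))"
    using assms by (simp add: inner_sym carrier_sum)
  also have "\<dots> = (\<Sum>i\<in>A. cnj (hinner H x (g i)))"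
    using assms by (simp add: inner_sum_right)
  also have "\<dots> = (\<Sum>i\<in>A. hinner H (g i) x)"
    by (intro sum.cong) (use assms in \<open>auto simp: inner_sym\<close>)
  finally show ?thesis .
qed

lemma inner_self_eq_zero: "hilbert_space H \<Longrightarrow> x \<in> hcarrier H \<Longrightarrow> hinner H x x = 0 \<Longrightarrow> x = 0"
  using inner_self_pos[of H x] by fastforce

lemma inner_ext:
  assumes "hilbert_space H" "x \<in> hcarrier H" "y \<in> hcarrier H"
    and "\<And>h. h \<in> hcarrier H \<Longrightarrow> hinner H h x = hinner H h y"
  shows "x = y"
proof -
  have "hinner H (x - y) (x - y) = 0"
    using assms by (simp add: inner_diff_right carrier_diff)
  then show ?thesis
    using inner_self_eq_zero[OF assms(1), of "x - y"] assms by (simp add: carrier_diff)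
qed

lemma inner_self_normalize:
  assumes "hilbert_space H" "x \<in> hcarrier H" "x \<noteq> 0"
  obtains a where "a \<noteq> 0" "hinner H (a *\<^sub>C x) (a *\<^sub>C x) = 1"
proof -
  define s where "s = Re (hinner H x x)"
  have "s > 0" using inner_self_pos[OF assms] by (simp add: s_def)
  have "hinner H x x = of_real s"
    using inner_sym[OF assms(1,2,2)] by (simp add: s_def complex_eq_iff)
  moreover define c where "c = complex_of_real (1 / sqrt s)"
  ultimately have "hinner H (c *\<^sub>C x) (c *\<^sub>C x) = cnj c * (c * of_real s)"
    using assms by (simp add: inner_scale_left inner_scale_right carrier_scale)
  also have "\<dots> = of_real (1 / sqrt s * (1 / sqrt s) * s)"
    by (simp only: c_def of_real_mult complex_cnj_complex_of_real ac_simps)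
  also have "1 / sqrt s * (1 / sqrt s) * s = 1"
    using \<open>s > 0\<close> by (simp add: field_simps)
  finally show ?thesis
    using \<open>s > 0\<close> by (intro that[of c]) (auto simp: c_def)
qed

lemma orthonormal_expansion:
  assumes H: "hilbert_space H" and B: "orthonormal_basis H B" and x: "x \<in> hcarrier H"
  shows "x = (\<Sum>b\<in>B. hinner H b x *\<^sub>C b)"
proof -
  have fin: "finite B" and sp: "cvec.span B = hcarrier H"
    and on: "\<And>b c. b \<in> B \<Longrightarrow> c \<in> B \<Longrightarrow> hinner H b c = (if b = c then 1 else 0)"
    using B by (auto simp: orthonormal_basis_def)
  have BH: "b \<in> hcarrier H" if "b \<in> B" for b
    using that sp cvec.span_base by blast
  obtain u where u: "x = (\<Sum>c\<in>B. u c *\<^sub>C c)"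
    using x fin unfolding sp[symmetric] by (auto simp: cvec.span_finite)
  have "hinner H b x = u b" if "b \<in> B" for b
  proof -
    have "hinner H b x = (\<Sum>c\<in>B. u c * hinner H b c)"
      using H BH that by (simp add: u inner_sum_right carrier_scale inner_scale_right)
    also have "\<dots> = (\<Sum>c\<in>B. if b = c then u c else 0)"
      by (intro sum.cong) (use on that in auto)
    also have "\<dots> = u b" using fin that by simp
    finally show ?thesis .
  qed
  then show ?thesis using u by simp
qed

text \<open>
  Gram-Schmidt: the component of a new vector orthogonal to the basis found so far is either zero
  or can be normalized.
\<close>

lemma orthonormal_basis_subset_exists:
  assumes H: "hilbert_space H" and "finite A" "A \<subseteq> hcarrier H"
  shows "\<exists>B. finite B \<and> cvec.span B = cvec.span A \<and> B \<subseteq> hcarrier H \<and>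
    (\<forall>b\<in>B. \<forall>c\<in>B. hinner H b c = (if b = c then 1 else 0))"
  using assms(2,3)
proof (induction A rule: finite_induct)
  case empty
  then show ?case by (intro exI[of _ "{}"]) auto
next
  case (insert a A)
  then obtain B where B: "finite B" "cvec.span B = cvec.span A" "B \<subseteq> hcarrier H"
    and on: "\<And>b c. b \<in> B \<Longrightarrow> c \<in> B \<Longrightarrow> hinner H b c = (if b = c then 1 else 0)"
    by auto
  have BH: "b \<in> hcarrier H" if "b \<in> B" for b using that B by auto
  have aH: "a \<in> hcarrier H" using insert by auto
  have sp: "cvec.span (insert a B) = cvec.span (insert a A)"
    using B(2) by (simp add: cvec.span_insert)
  define p where "p = (\<Sum>b\<in>B. hinner H b a *\<^sub>C b)"
  define r where "r = a - p"
  have pB: "p \<in> cvec.span B"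
    unfolding p_def by (intro cvec.span_sum cvec.span_scale cvec.span_base)
  have pH: "p \<in> hcarrier H"
    using H BH by (auto simp: p_def intro!: carrier_sum carrier_scale)
  have rH: "r \<in> hcarrier H" using H aH pH by (simp add: r_def carrier_diff)
  have orth: "hinner H b r = 0" if "b \<in> B" for b
  proof -
    have "hinner H b p = (\<Sum>c\<in>B. hinner H c a * hinner H b c)"
      using H BH that by (simp add: p_def inner_sum_right carrier_scale inner_scale_right)
    also have "\<dots> = (\<Sum>c\<in>B. if b = c then hinner H c a else 0)"
      by (intro sum.cong) (use on that in auto)
    also have "\<dots> = hinner H b a" using B(1) that by simp
    finally show ?thesis using H BH that aH pH by (simp add: r_def inner_diff_right)
  qed
  show ?case
  proof (cases "r = 0")
    case True
    then have "a \<in> cvec.span B" using pB by (simp add: r_def)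
    then have "cvec.span B = cvec.span (insert a A)"
      using sp cvec.span_redundant by metis
    then show ?thesis using B on by (intro exI[of _ B]) auto
  next
    case False
    obtain s where s: "s \<noteq> 0" "hinner H (s *\<^sub>C r) (s *\<^sub>C r) = 1"
      using inner_self_normalize[OF H rH False] .
    let ?e = "s *\<^sub>C r"
    have eH: "?e \<in> hcarrier H" using H rH by (simp add: carrier_scale)
    have e1: "hinner H b ?e = 0" "hinner H ?e b = 0" if "b \<in> B" for b
      using orth[OF that] inner_sym[OF H BH[OF that] rH] H BH[OF that] rH
      by (auto simp: inner_scale_right inner_scale_left carrier_scale)
    have eB: "?e \<notin> B" using e1 s by force
    have "cvec.span (insert ?e B) = cvec.span (insert a B)"
    proof (rule cvec.span_eq[THEN iffD2], intro conjI subsetI)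
      fix x assume "x \<in> insert ?e B"
      moreover have "?e \<in> cvec.span (insert a B)"
        unfolding r_def
        using pB cvec.span_mono[of B "insert a B"]
        by (intro cvec.span_scale cvec.span_diff) (auto intro: cvec.span_base)
      ultimately show "x \<in> cvec.span (insert a B)" by (auto intro: cvec.span_base)
    next
      fix x assume "x \<in> insert a B"
      moreover have "a \<in> cvec.span (insert ?e B)"
      proof -
        have "a = (1/s) *\<^sub>C ?e + p" using s by (simp add: r_def scaleC_scaleC scaleC_one)
        moreover have "(1/s) *\<^sub>C ?e + p \<in> cvec.span (insert ?e B)"
          using pB cvec.span_mono[of B "insert ?e B"]
          by (intro cvec.span_add[OF cvec.span_scale]) (auto intro: cvec.span_base)
        ultimately show ?thesis by simp
      qed
      ultimately show "x \<in> cvec.span (insert ?e B)" by (auto intro: cvec.span_base)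
    qed
    then show ?thesis
      using B on e1 s eH eB sp by (intro exI[of _ "insert ?e B"]) auto
  qed
qed

lemma onb_orthonormal_basis: "hilbert_space H \<Longrightarrow> orthonormal_basis H (onb H)"
proof -
  assume H: "hilbert_space H"
  obtain A where A: "finite A" "hcarrier H = cvec.span A"
    using H unfolding hilbert_space_def by blast
  have "A \<subseteq> hcarrier H" unfolding A(2) by (rule cvec.span_superset)
  then obtain B where "finite B" "cvec.span B = cvec.span A"
    "\<forall>b\<in>B. \<forall>c\<in>B. hinner H b c = (if b = c then 1 else 0)"
    using orthonormal_basis_subset_exists[OF H A(1)] by blast
  then have "\<exists>B. orthonormal_basis H B"
    unfolding orthonormal_basis_def A(2) by blast
  then show ?thesis unfolding onb_def by (rule someI_ex)
qed

lemma finite_onb: "hilbert_space H \<Longrightarrow> finite (onb H)"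
  and onb_span: "hilbert_space H \<Longrightarrow> cvec.span (onb H) = hcarrier H"
  using onb_orthonormal_basis[of H] by (simp_all add: orthonormal_basis_def)

lemma onb_carrier: "hilbert_space H \<Longrightarrow> b \<in> onb H \<Longrightarrow> b \<in> hcarrier H"
  using cvec.span_base[of b "onb H"] onb_span[of H] by simp

lemma onb_expansion:
  "hilbert_space H \<Longrightarrow> x \<in> hcarrier H \<Longrightarrow> (\<Sum>b\<in>onb H. hinner H b x *\<^sub>C b) = x"
  by (rule orthonormal_expansion[OF _ onb_orthonormal_basis, symmetric])

text \<open>
  Finite dimension passes to subspaces because an independent subset of the span of a finite set
  is finite.
\<close>

lemma hilbert_subspace_hilbert:
  assumes H: "hilbert_space H" and V: "V \<subseteq> hcarrier H" "cvec.subspace V"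
  shows "hilbert_space \<lparr>hcarrier = V, hinner = hinner H\<rparr>"
proof -
  obtain B where B: "finite B" "hcarrier H = cvec.span B"
    using H unfolding hilbert_space_def by blast
  obtain C where C: "C \<subseteq> V" "cvec.independent C" "V \<subseteq> cvec.span C"
    using cvec.maximal_independent_subset by blast
  have "finite C"
    using cvec.independent_span_bound[OF B(1) C(2)] C(1) V(1) B(2) by auto
  moreover have "V = cvec.span C"
    using C V(2) by (simp add: cvec.span_subspace)
  ultimately have "\<exists>B. finite B \<and> V = cvec.span B" by blast
  moreover have "\<forall>x\<in>V. \<forall>y\<in>V. hinner H y x = cnj (hinner H x y)"
    using inner_sym[OF H] V(1) by (metis subsetD)
  moreover have "\<forall>x\<in>V. \<forall>y\<in>V. \<forall>z\<in>V. hinner H x (y + z) = hinner H x y + hinner H x z"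
    using inner_add_right[OF H] V(1) by (meson subsetD)
  moreover have "\<forall>a. \<forall>x\<in>V. \<forall>y\<in>V. hinner H x (a *\<^sub>C y) = a * hinner H x y"
    using inner_scale_right[OF H] V(1) by (meson subsetD)
  moreover have "\<forall>x\<in>V. x \<noteq> 0 \<longrightarrow> Re (hinner H x x) > 0"
    using inner_self_pos[OF H] V(1) by (meson subsetD)
  ultimately show ?thesis
    using V(2) unfolding hilbert_space_def hilb.simps by (intro conjI)
qed


section \<open>Adjoints and unitary maps\<close>

lemma adjoint_map_eqI:
  assumes "hilbert_space H" "x \<in> hcarrier H"
    and "\<And>h. h \<in> hcarrier H \<Longrightarrow> hinner H h x = hinner K (f h) y"
  shows "adjoint_map H K f y = x"
  unfolding adjoint_map_def
proof (rule the_equality)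
  show "x \<in> hcarrier H \<and> (\<forall>h\<in>hcarrier H. hinner H h x = hinner K (f h) y)" using assms by auto
next
  fix z assume "z \<in> hcarrier H \<and> (\<forall>h\<in>hcarrier H. hinner H h z = hinner K (f h) y)"
  then show "z = x" by (intro inner_ext[OF assms(1)]) (use assms in auto)
qed

text \<open>
  The vector representing \<open>h \<mapsto> \<langle>f h, y\<rangle>\<close> has the coordinates \<open>\<langle>f b, y\<rangle>\<close> in an orthonormal basis.
\<close>

lemma
  assumes H: "hilbert_space H" and K: "hilbert_space K" and f: "linear_map H K f"
    and y: "y \<in> hcarrier K"
  shows adjoint_map_carrier: "adjoint_map H K f y \<in> hcarrier H"
    and inner_adjoint_map:
      "\<And>h. h \<in> hcarrier H \<Longrightarrow> hinner H h (adjoint_map H K f y) = hinner K (f h) y"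
proof -
  have fK: "\<And>x. x \<in> hcarrier H \<Longrightarrow> f x \<in> hcarrier K" and fl: "lin (hcarrier H) f"
    using f by (auto simp: linear_map_lin)
  let ?x = "\<Sum>b\<in>onb H. hinner K (f b) y *\<^sub>C b"
  have xH: "?x \<in> hcarrier H"
    using H by (intro carrier_sum carrier_scale) (auto simp: onb_carrier)
  have inner: "hinner H h ?x = hinner K (f h) y" if h: "h \<in> hcarrier H" for h
  proof -
    have "f h = f (\<Sum>b\<in>onb H. hinner H b h *\<^sub>C b)"
      using onb_expansion[OF H h] by simp
    also have "\<dots> = (\<Sum>b\<in>onb H. hinner H b h *\<^sub>C f b)"
      using H by (simp add: lin_sum[OF fl hilbert_subspace] lin_scale[OF fl] onb_carrier carrier_scale)
    finally have "hinner K (f h) y = (\<Sum>b\<in>onb H. hinner H h b * hinner K (f b) y)"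
      using H K fK y h
      by (simp add: inner_sum_left inner_scale_left carrier_scale onb_carrier inner_sym)
    moreover have "hinner H h ?x = (\<Sum>b\<in>onb H. hinner H h b * hinner K (f b) y)"
      using H h
      by (simp add: inner_sum_right inner_scale_right onb_carrier carrier_scale mult.commute)
    ultimately show ?thesis by simp
  qed
  have "adjoint_map H K f y = ?x"
    by (rule adjoint_map_eqI[where K=K]) (use H xH inner in auto)
  then show "adjoint_map H K f y \<in> hcarrier H"
    and "\<And>h. h \<in> hcarrier H \<Longrightarrow> hinner H h (adjoint_map H K f y) = hinner K (f h) y"
    using xH inner by simp_all
qed

lemma linear_map_adjoint:
  assumes H: "hilbert_space H" and K: "hilbert_space K" and f: "linear_map H K f"
  shows "linear_map K H (adjoint_map H K f)"
proof -
  note adj = adjoint_map_carrier[OF H K f] inner_adjoint_map[OF H K f]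
  have fK: "\<And>x. x \<in> hcarrier H \<Longrightarrow> f x \<in> hcarrier K"
    using f by (auto simp: linear_map_lin)
  have "lin (hcarrier K) (adjoint_map H K f)"
  proof (rule linI)
    fix x y assume "x \<in> hcarrier K" "y \<in> hcarrier K"
    then show "adjoint_map H K f (x + y) = adjoint_map H K f x + adjoint_map H K f y"
      by (intro adjoint_map_eqI[OF H])
        (use H K adj fK in \<open>auto simp: carrier_add inner_add_right\<close>)
  next
    fix a x assume "x \<in> hcarrier K"
    then show "adjoint_map H K f (a *\<^sub>C x) = a *\<^sub>C adjoint_map H K f x"
      by (intro adjoint_map_eqI[OF H])
        (use H K adj fK in \<open>auto simp: carrier_scale inner_scale_right\<close>)
  qed
  then show ?thesis using adj by (simp add: linear_map_lin)
qed

text \<open>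
  Equivalent to the two equations with the adjoint, but stated without it: an isometry onto its
  target is what one can check on concrete maps.
\<close>

definition unitary_map ::
    "'a::complex_vector hilb \<Rightarrow> 'b::complex_vector hilb \<Rightarrow> ('a \<Rightarrow> 'b) \<Rightarrow> bool" where
  "unitary_map H K f \<longleftrightarrow>
     linear_map H K f \<and>
     (\<forall>x\<in>hcarrier H. \<forall>y\<in>hcarrier H. hinner K (f x) (f y) = hinner H x y) \<and>
     hcarrier K \<subseteq> f ` hcarrier H"

lemma unitary_map_adjoint_left:
  assumes "hilbert_space H" "unitary_map H K f" "x \<in> hcarrier H"
  shows "adjoint_map H K f (f x) = x"
  using assms by (intro adjoint_map_eqI) (auto simp: unitary_map_def)

lemma unitary_map_adjoint_right:
  assumes "hilbert_space H" "unitary_map H K f" "y \<in> hcarrier K"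
  shows "f (adjoint_map H K f y) = y"
proof -
  obtain x where "x \<in> hcarrier H" "y = f x" using assms by (auto simp: unitary_map_def)
  then show ?thesis using unitary_map_adjoint_left[OF assms(1,2)] by simp
qed

lemma unitary_map_iff_adjoint:
  assumes H: "hilbert_space H" and K: "hilbert_space K" and f: "linear_map H K f"
  shows "unitary_map H K f \<longleftrightarrow>
    (\<forall>x\<in>hcarrier H. adjoint_map H K f (f x) = x) \<and> (\<forall>y\<in>hcarrier K. f (adjoint_map H K f y) = y)"
    (is "_ \<longleftrightarrow> ?R")
proof
  assume "unitary_map H K f"
  then show ?R
    using H by (simp add: unitary_map_adjoint_left unitary_map_adjoint_right)
next
  assume R: ?R
  note adj = adjoint_map_carrier[OF H K f] inner_adjoint_map[OF H K f]
  have fK: "\<And>x. x \<in> hcarrier H \<Longrightarrow> f x \<in> hcarrier K"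
    using f by (auto simp: linear_map_lin)
  have "hinner K (f x) (f y) = hinner H x y" if "x \<in> hcarrier H" "y \<in> hcarrier H" for x y
    using adj(2)[of "f y" x] fK that R by simp
  moreover have "y \<in> f ` hcarrier H" if "y \<in> hcarrier K" for y
    using R adj(1)[OF that] that by (metis imageI)
  ultimately show "unitary_map H K f" using f by (auto simp: unitary_map_def)
qed

lemma unitary_map_lin:
  "unitary_map H K f \<Longrightarrow> lin (hcarrier H) f"
  and unitary_map_carrier: "unitary_map H K f \<Longrightarrow> x \<in> hcarrier H \<Longrightarrow> f x \<in> hcarrier K"
  and unitary_map_inner: "unitary_map H K f \<Longrightarrow> x \<in> hcarrier H \<Longrightarrow> y \<in> hcarrier H \<Longrightarrow>
    hinner K (f x) (f y) = hinner H x y"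
  by (auto simp: unitary_map_def linear_map_lin)


section \<open>Bilinear maps, tensor products and direct sums\<close>

lemma lin_id: "lin S (\<lambda>x. x)"
  by (rule linI) auto

lemma lin_fun: "(\<And>k. lin S (\<lambda>x. g x k)) \<Longrightarrow> lin S (\<lambda>x k. g x k)"
  by (auto simp: lin_def fun_eq_iff)

lemma lin_proj: "lin S (\<lambda>u. u k)"
  by (auto simp: lin_def)

lemma lin_const_zero: "lin S (\<lambda>x. 0)"
  by (rule linI) auto

lemma lin_if: "(c \<Longrightarrow> lin S f) \<Longrightarrow> (\<not> c \<Longrightarrow> lin S g) \<Longrightarrow> lin S (\<lambda>x. if c then f x else g x)"
  by (cases c) simp_all

lemma lin_sum_fun: "(\<And>i. i \<in> A \<Longrightarrow> lin S (f i)) \<Longrightarrow> lin S (\<lambda>x. \<Sum>i\<in>A. f i x)"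
  by (simp add: lin_def sum.distrib cvec.scale_sum_right)

lemma lin_scale_left: "lin S f \<Longrightarrow> lin S (\<lambda>x. f x *\<^sub>C v)"
  by (intro linI) (simp_all add: lin_add lin_scale scaleC_add_left scaleC_scaleC)

lemma lin_scale_right: "lin S f \<Longrightarrow> lin S (\<lambda>x. z *\<^sub>C f x)"
  by (intro linI) (simp_all add: lin_add lin_scale scaleC_add_right scaleC_scaleC mult.commute)

lemma lin_dinj: "lin S f \<Longrightarrow> lin S (\<lambda>x. dinj k (f x))"
  by (intro linI) (auto simp: lin_add lin_scale dinj_def fun_eq_iff)

lemma lin_compose:
  "lin T g \<Longrightarrow> lin S f \<Longrightarrow> (\<And>x. x \<in> S \<Longrightarrow> f x \<in> T) \<Longrightarrow> lin S (\<lambda>x. g (f x))"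
  by (intro linI) (simp_all add: lin_add lin_scale)

lemma lin_lift_arg: "lin S f \<Longrightarrow> lin S (\<lambda>x. lift H K \<beta> (f x))"
  by (intro linI)
    (simp_all add: lift_def lin_add lin_scale scaleC_add_left sum.distrib cvec.scale_sum_right
      scaleC_scaleC)

lemma lin_lift_fun:
  assumes "hilbert_space H" "hilbert_space K"
    and "\<And>h k. h \<in> hcarrier H \<Longrightarrow> k \<in> hcarrier K \<Longrightarrow> lin S (\<lambda>x. \<beta> x h k)"
  shows "lin S (\<lambda>x. lift H K (\<beta> x) t)"
  unfolding lift_def
  using assms by (intro lin_sum_fun lin_scale_right) (simp_all add: onb_carrier)

lemma lift_carrier:
  assumes "hilbert_space H" "hilbert_space K" "cvec.subspace T"
    and "\<And>h k. h \<in> hcarrier H \<Longrightarrow> k \<in> hcarrier K \<Longrightarrow> \<beta> h k \<in> T"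
  shows "lift H K \<beta> t \<in> T"
  unfolding lift_def
  using assms by (intro cvec.subspace_sum cvec.subspace_scale) (simp_all add: onb_carrier)

lemma lin_elem_left:
  assumes "hilbert_space H" "lin S f" "\<And>x. x \<in> S \<Longrightarrow> f x \<in> hcarrier H"
  shows "lin S (\<lambda>x. elem H K (f x) y)"
  using assms
  by (intro linI) (auto simp: elem_def fun_eq_iff lin_add lin_scale inner_add_right
      inner_scale_right distrib_right)

lemma lin_elem_right:
  assumes "hilbert_space K" "lin S f" "\<And>x. x \<in> S \<Longrightarrow> f x \<in> hcarrier K"
  shows "lin S (\<lambda>x. elem H K y (f x))"
  using assms
  by (intro linI) (auto simp: elem_def fun_eq_iff lin_add lin_scale inner_add_right
      inner_scale_right distrib_left)

definition bilin ::
    "'a::complex_vector hilb \<Rightarrow> 'b::complex_vector hilb \<Rightarrow> ('a \<Rightarrow> 'b \<Rightarrow> 'c::complex_vector) \<Rightarrow> bool" where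
  "bilin H K \<beta> \<longleftrightarrow>
     (\<forall>k\<in>hcarrier K. lin (hcarrier H) (\<lambda>h. \<beta> h k)) \<and> (\<forall>h\<in>hcarrier H. lin (hcarrier K) (\<beta> h))"

lemma bilinI:
  assumes "\<And>k. k \<in> hcarrier K \<Longrightarrow> lin (hcarrier H) (\<lambda>h. \<beta> h k)"
    and "\<And>h. h \<in> hcarrier H \<Longrightarrow> lin (hcarrier K) (\<lambda>k. \<beta> h k)"
  shows "bilin H K \<beta>"
  using assms by (simp add: bilin_def)

lemma bilin_elem:
  assumes "hilbert_space H'" "hilbert_space K'" "linear_map H H' f" "linear_map K K' g"
  shows "bilin H K (\<lambda>x y. elem H' K' (f x) (g y))"
  using assms by (intro bilinI lin_elem_left lin_elem_right) (auto simp: linear_map_lin)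

lemma elem_zero_left: "hilbert_space H \<Longrightarrow> elem H K 0 k = 0"
  and elem_zero_right: "hilbert_space K \<Longrightarrow> elem H K h 0 = 0"
  by (auto simp: elem_def fun_eq_iff inner_zero_right)

lemma elem_scale_left:
  "hilbert_space H \<Longrightarrow> h \<in> hcarrier H \<Longrightarrow> elem H K (a *\<^sub>C h) k = a *\<^sub>C elem H K h k"
  by (auto simp: elem_def fun_eq_iff inner_scale_right)

lemma elem_scale_right:
  "hilbert_space K \<Longrightarrow> k \<in> hcarrier K \<Longrightarrow> elem H K h (a *\<^sub>C k) = a *\<^sub>C elem H K h k"
  by (auto simp: elem_def fun_eq_iff inner_scale_right)

text \<open>
  This is the universal property of the tensor product: since a vector is the sum of its
  components along the chosen orthonormal basis, bilinearity makes the choice irrelevant.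
\<close>

lemma lift_elem:
  assumes H: "hilbert_space H" and K: "hilbert_space K" and \<beta>: "bilin H K \<beta>"
    and h: "h \<in> hcarrier H" and k: "k \<in> hcarrier K"
  shows "lift H K \<beta> (elem H K h k) = \<beta> h k"
proof -
  have l: "\<And>k. k \<in> hcarrier K \<Longrightarrow> lin (hcarrier H) (\<lambda>h. \<beta> h k)" "lin (hcarrier K) (\<beta> h)"
    using \<beta> h by (auto simp: bilin_def)
  have "\<beta> h k = \<beta> h (\<Sum>c\<in>onb K. hinner K c k *\<^sub>C c)"
    using onb_expansion[OF K k] by simp
  also have "\<dots> = (\<Sum>c\<in>onb K. hinner K c k *\<^sub>C \<beta> h c)"
    using K by (simp add: lin_sum[OF l(2) hilbert_subspace] lin_scale[OF l(2)] onb_carrier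
        carrier_scale)
  also have "\<dots> = (\<Sum>c\<in>onb K. hinner K c k *\<^sub>C (\<Sum>b\<in>onb H. hinner H b h *\<^sub>C \<beta> b c))"
  proof (intro sum.cong refl)
    fix c assume "c \<in> onb K"
    then have c: "c \<in> hcarrier K" using K by (simp add: onb_carrier)
    have "\<beta> h c = \<beta> (\<Sum>b\<in>onb H. hinner H b h *\<^sub>C b) c"
      using onb_expansion[OF H h] by simp
    also have "\<dots> = (\<Sum>b\<in>onb H. hinner H b h *\<^sub>C \<beta> b c)"
      using H by (simp add: lin_sum[OF l(1)[OF c] hilbert_subspace] lin_scale[OF l(1)[OF c]]
          onb_carrier carrier_scale)
    finally show "hinner K c k *\<^sub>C \<beta> h c = hinner K c k *\<^sub>C (\<Sum>b\<in>onb H. hinner H b h *\<^sub>C \<beta> b c)"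
      by simp
  qed
  also have "\<dots> = (\<Sum>b\<in>onb H. \<Sum>c\<in>onb K. (hinner H b h * hinner K c k) *\<^sub>C \<beta> b c)"
    by (subst sum.swap) (simp add: cvec.scale_sum_right scaleC_scaleC mult.commute)
  also have "\<dots> = lift H K \<beta> (elem H K h k)"
    unfolding lift_def elem_def using H K by (intro sum.cong) (simp_all add: onb_carrier)
  finally show ?thesis by simp
qed

lemma elem_carrier: "h \<in> hcarrier H \<Longrightarrow> k \<in> hcarrier K \<Longrightarrow> elem H K h k \<in> hcarrier (tensor H K)"
  unfolding tensor_def by (auto intro!: cvec.span_base)

lemma subspace_tensor: "cvec.subspace (hcarrier (tensor H K))"
  by (simp add: tensor_def)

lemma lift_elem_self:
  assumes H: "hilbert_space H" and K: "hilbert_space K" and t: "t \<in> hcarrier (tensor H K)"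
  shows "lift H K (elem H K) t = t"
proof (rule lin_eq_on_span[where f="lift H K (elem H K)" and g="\<lambda>x. x"])
  show "t \<in> cvec.span {elem H K h k | h k. h \<in> hcarrier H \<and> k \<in> hcarrier K}"
    using t by (simp add: tensor_def)
  have "bilin H K (elem H K)"
    using bilin_elem[OF H K, of H "\<lambda>x. x" K "\<lambda>x. x"] by (simp add: linear_map_lin lin_id)
  then show "lift H K (elem H K) x = x"
    if "x \<in> {elem H K h k | h k. h \<in> hcarrier H \<and> k \<in> hcarrier K}" for x
    using that by (auto simp: lift_elem[OF H K])
qed (intro lin_lift_arg lin_id)+

text \<open>
  A tensor, being a conjugate-linear form, is evaluated at \<open>(h, k)\<close> by pairing it with the
  elementary tensor of \<open>h\<close> and \<open>k\<close>; the chosen bases thereby disappear from the inner product.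
\<close>

lemma inner_elem:
  assumes H: "hilbert_space H" and K: "hilbert_space K" and t: "t \<in> hcarrier (tensor H K)"
    and h: "h \<in> hcarrier H" and k: "k \<in> hcarrier K"
  shows "hinner (tensor H K) (elem H K h k) t = t h k"
proof -
  have "t h k = lift H K (elem H K) t h k"
    by (simp add: lift_elem_self[OF H K t])
  also have "\<dots> = (\<Sum>b\<in>onb H. \<Sum>c\<in>onb K. t b c * (hinner H h b * hinner K k c))"
    using h k by (simp add: lift_def elem_def)
  also have "\<dots> = hinner (tensor H K) (elem H K h k) t"
    unfolding tensor_def hilb.simps elem_def
    using H K h k by (intro sum.cong) (auto simp: onb_carrier inner_sym)
  finally show ?thesis by simp
qed

lemma inner_elem_elem:
  assumes "hilbert_space H" "hilbert_space K" "h \<in> hcarrier H" "k \<in> hcarrier K"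
    "h' \<in> hcarrier H" "k' \<in> hcarrier K"
  shows "hinner (tensor H K) (elem H K h k) (elem H K h' k') = hinner H h h' * hinner K k k'"
  using assms by (simp add: inner_elem elem_carrier) (simp add: elem_def)

text \<open>
  The inner product is a sum of absolute squares of coordinates. It is definite because a tensor
  is the combination of the elementary basis tensors with these coordinates.
\<close>

lemma hilbert_space_tensor:
  assumes H: "hilbert_space H" and K: "hilbert_space K"
  shows "hilbert_space (tensor H K)"
  unfolding hilbert_space_def
proof (intro conjI ballI allI impI)
  let ?B = "(\<lambda>(b, c). elem H K b c) ` (onb H \<times> onb K)"
  have "hcarrier (tensor H K) = cvec.span ?B"
  proof
    show "cvec.span ?B \<subseteq> hcarrier (tensor H K)"
      using H K by (intro cvec.span_minimal subspace_tensor) (auto simp: elem_carrier onb_carrier)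
    show "hcarrier (tensor H K) \<subseteq> cvec.span ?B"
    proof
      fix t assume t: "t \<in> hcarrier (tensor H K)"
      have "lift H K (elem H K) t \<in> cvec.span ?B"
        unfolding lift_def
        by (intro cvec.span_sum cvec.span_scale cvec.span_base) auto
      then show "t \<in> cvec.span ?B" by (simp add: lift_elem_self[OF H K t])
    qed
  qed
  moreover have "finite ?B" using H K by (simp add: finite_onb)
  ultimately show "\<exists>B. finite B \<and> hcarrier (tensor H K) = cvec.span B" by blast
next
  fix t assume t: "t \<in> hcarrier (tensor H K)" "t \<noteq> 0"
  let ?s = "\<Sum>b\<in>onb H. \<Sum>c\<in>onb K. (cmod (t b c))\<^sup>2"
  have "?s \<noteq> 0"
  proof
    assume "?s = 0"
    then have "t b c = 0" if "b \<in> onb H" "c \<in> onb K" for b c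
      using that H K by (auto simp: sum_nonneg_eq_0_iff sum_nonneg finite_onb)
    then have "lift H K (elem H K) t = 0" by (simp add: lift_def)
    then show False using t by (simp add: lift_elem_self[OF H K])
  qed
  moreover have "?s \<ge> 0" by (intro sum_nonneg) auto
  moreover have "cnj z * z = of_real ((cmod z)\<^sup>2)" for z
    using complex_norm_square[of z] by (simp add: mult.commute)
  then have "Re (hinner (tensor H K) t t) = ?s" by (simp add: tensor_def)
  ultimately show "0 < Re (hinner (tensor H K) t t)" by simp
qed (simp_all add: subspace_tensor, simp_all add: tensor_def distrib_left sum.distrib
    sum_distrib_left mult.left_commute mult.commute)

text \<open>
  Spanning sets of the factors give a spanning set of the tensor product; with its analogue for
  direct sums this allows one to check equations of linear maps on few generators.
\<close>

lemma tensor_span: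
  assumes H: "hilbert_space H" and K: "hilbert_space K"
    and A: "hcarrier H = cvec.span A" and B: "hcarrier K = cvec.span B"
  shows "hcarrier (tensor H K) = cvec.span {elem H K a b | a b. a \<in> A \<and> b \<in> B}" (is "_ = ?T")
proof
  have AB: "A \<subseteq> hcarrier H" "B \<subseteq> hcarrier K"
    unfolding A B by (rule cvec.span_superset)+
  show "?T \<subseteq> hcarrier (tensor H K)"
    using AB by (intro cvec.span_minimal subspace_tensor) (auto intro!: elem_carrier)
  have 1: "elem H K a k \<in> ?T" if "a \<in> A" "k \<in> hcarrier K" for a k
  proof (rule lin_image_span[where A=B and f="elem H K a"])
    show "lin (cvec.span B) (elem H K a)"
      unfolding B[symmetric] by (rule lin_elem_right[OF K lin_id])
    show "elem H K a ` B \<subseteq> ?T" using that by (blast intro: cvec.span_base)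
    show "k \<in> cvec.span B" using that unfolding B by blast
  qed simp
  have 2: "elem H K h k \<in> ?T" if "h \<in> hcarrier H" "k \<in> hcarrier K" for h k
  proof (rule lin_image_span[where A=A and f="\<lambda>h. elem H K h k"])
    show "lin (cvec.span A) (\<lambda>h. elem H K h k)"
      unfolding A[symmetric] by (rule lin_elem_left[OF H lin_id])
    show "(\<lambda>h. elem H K h k) ` A \<subseteq> ?T" using 1 that AB by blast
    show "h \<in> cvec.span A" using that unfolding A by blast
  qed simp
  then have "{elem H K h k | h k. h \<in> hcarrier H \<and> k \<in> hcarrier K} \<subseteq> ?T" by blast
  then show "hcarrier (tensor H K) \<subseteq> ?T"
    unfolding tensor_def hilb.simps by (rule cvec.span_minimal) simp
qed

lemma dsum_carrier:
  "u \<in> hcarrier (dsum n H) \<longleftrightarrow> (\<forall>k<n. u k \<in> hcarrier (H k)) \<and> (\<forall>k\<ge>n. u k = 0)"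
  by (simp add: dsum_def)

lemma dsum_sum_dinj: "u \<in> hcarrier (dsum n H) \<Longrightarrow> (\<Sum>k<n. dinj k (u k)) = u"
  by (auto simp: fun_eq_iff dinj_def dsum_carrier)

lemma sum_dinj_apply:
  fixes f :: "nat \<Rightarrow> 'a::comm_monoid_add"
  shows "k < n \<Longrightarrow> (\<Sum>m<n. dinj m (f m)) k = f k"
  by (simp add: dinj_def)

lemma dinj_same [simp]: "dinj k x k = x"
  by (simp add: dinj_def)

lemma dinj_zero [simp]: "dinj k 0 = 0"
  by (auto simp: dinj_def)

lemma dinj_carrier:
  "\<forall>l<n. hilbert_space (H l) \<Longrightarrow> k < n \<Longrightarrow> x \<in> hcarrier (H k) \<Longrightarrow> dinj k x \<in> hcarrier (dsum n H)"
  by (auto simp: dsum_carrier dinj_def carrier_zero)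

lemma subspace_dsum:
  assumes "\<forall>k<n. hilbert_space (H k)"
  shows "cvec.subspace (hcarrier (dsum n H))"
  using assms by (intro cvec.subspaceI)
    (auto simp: dsum_carrier carrier_zero carrier_add carrier_scale)

lemma dsum_span:
  assumes H: "\<forall>k<n. hilbert_space (H k)" and A: "\<And>k. k < n \<Longrightarrow> hcarrier (H k) = cvec.span (A k)"
  shows "hcarrier (dsum n H) = cvec.span (\<Union>k<n. dinj k ` A k)" (is "_ = ?T")
proof
  have AH: "A k \<subseteq> hcarrier (H k)" if "k < n" for k
    unfolding A[OF that] by (rule cvec.span_superset)
  show "?T \<subseteq> hcarrier (dsum n H)"
    using AH by (intro cvec.span_minimal subspace_dsum H) (auto intro!: dinj_carrier[OF H])
  show "hcarrier (dsum n H) \<subseteq> ?T"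
  proof
    fix u assume u: "u \<in> hcarrier (dsum n H)"
    have "dinj k x \<in> ?T" if "k < n" "x \<in> hcarrier (H k)" for k x
    proof (rule lin_image_span[where A="A k" and f="dinj k"])
      show "lin (cvec.span (A k)) (dinj k)" using lin_dinj[OF lin_id] .
      show "dinj k ` A k \<subseteq> ?T" using that by (auto intro!: cvec.span_base)
    qed (use that A in auto)
    then have "(\<Sum>k<n. dinj k (u k)) \<in> ?T"
      using u by (intro cvec.span_sum) (auto simp: dsum_carrier)
    then show "u \<in> ?T" by (simp add: dsum_sum_dinj[OF u])
  qed
qed

lemma hilbert_space_dsum:
  assumes H: "\<forall>k<n. hilbert_space (H k)"
  shows "hilbert_space (dsum n H)"
  unfolding hilbert_space_def
proof (intro conjI ballI allI impI)
  show "cvec.subspace (hcarrier (dsum n H))" by (rule subspace_dsum[OF H])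
  have "hcarrier (dsum n H) = cvec.span (\<Union>k<n. dinj k ` onb (H k))"
    by (rule dsum_span[OF H]) (use H in \<open>auto simp: onb_span\<close>)
  moreover have "finite (\<Union>k<n. dinj k ` onb (H k))" using H by (auto intro!: finite_onb)
  ultimately show "\<exists>B. finite B \<and> hcarrier (dsum n H) = cvec.span B" by blast
next
  fix u v w assume "u \<in> hcarrier (dsum n H)" "v \<in> hcarrier (dsum n H)" "w \<in> hcarrier (dsum n H)"
  then show "hinner (dsum n H) u (v + w) = hinner (dsum n H) u v + hinner (dsum n H) u w"
    using H by (simp add: dsum_carrier) (simp add: dsum_def inner_add_right sum.distrib)
next
  fix a u v assume "u \<in> hcarrier (dsum n H)" "v \<in> hcarrier (dsum n H)"
  then show "hinner (dsum n H) u (a *\<^sub>C v) = a * hinner (dsum n H) u v"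
    using H by (simp add: dsum_carrier) (simp add: dsum_def inner_scale_right sum_distrib_left)
next
  fix u v assume "u \<in> hcarrier (dsum n H)" "v \<in> hcarrier (dsum n H)"
  then have "\<forall>k<n. u k \<in> hcarrier (H k)" "\<forall>k<n. v k \<in> hcarrier (H k)" by (auto simp: dsum_carrier)
  then show "hinner (dsum n H) v u = cnj (hinner (dsum n H) u v)"
    unfolding dsum_def hilb.simps cnj_sum using H by (intro sum.cong) (auto simp: inner_sym)
next
  fix u assume u: "u \<in> hcarrier (dsum n H)" "u \<noteq> 0"
  then have uk: "\<forall>k<n. u k \<in> hcarrier (H k)" by (auto simp: dsum_carrier)
  obtain k where k: "k < n" "u k \<noteq> 0"
    using u by (auto simp: dsum_carrier fun_eq_iff) (metis not_less)
  have nn: "Re (hinner (H k) (u k) (u k)) \<ge> 0" if "k < n" for k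
    using inner_self_pos[of "H k" "u k"] inner_zero_right[of "H k" 0] H uk that
    by (cases "u k = 0") (auto simp: carrier_zero less_imp_le)
  have "0 < Re (hinner (H k) (u k) (u k))"
    using inner_self_pos[of "H k" "u k"] H uk k by auto
  also have "\<dots> \<le> (\<Sum>k<n. Re (hinner (H k) (u k) (u k)))"
    by (rule member_le_sum) (use k nn in auto)
  finally show "0 < Re (hinner (dsum n H) u u)" by (simp add: dsum_def)
qed

lemma inner_dsum: "hinner (dsum n H) u v = (\<Sum>k<n. hinner (H k) (u k) (v k))"
  by (simp add: dsum_def)

lemma inner_dinj:
  assumes H: "\<forall>k<n. hilbert_space (H k)" and k: "k < n" and u: "u \<in> hcarrier (dsum n H)"
  shows "hinner (dsum n H) (dinj k x) u = hinner (H k) x (u k)"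
proof -
  have "hinner (dsum n H) (dinj k x) u = (\<Sum>l<n. if l = k then hinner (H k) x (u k) else 0)"
    unfolding inner_dsum dinj_def
    using H u by (intro sum.cong) (auto simp: dsum_carrier inner_zero_left)
  then show ?thesis using k by simp
qed

lemma inner_dinj_right:
  assumes H: "\<forall>k<n. hilbert_space (H k)" and k: "k < n" and u: "u \<in> hcarrier (dsum n H)"
  shows "hinner (dsum n H) u (dinj k x) = hinner (H k) (u k) x"
proof -
  have "hinner (dsum n H) u (dinj k x) = (\<Sum>l<n. if l = k then hinner (H k) (u k) x else 0)"
    unfolding inner_dsum dinj_def
    using H u by (intro sum.cong) (auto simp: dsum_carrier inner_zero_right)
  then show ?thesis using k by simp
qed

lemma hcarrier_hcomplex [simp]: "hcarrier hcomplex = UNIV"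
  and hinner_hcomplex [simp]: "hinner hcomplex z w = cnj z * w"
  and hcarrier_hzero [simp]: "hcarrier hzero = {0}"
  and hinner_hzero [simp]: "hinner hzero z w = cnj z * w"
  by (simp_all add: hcomplex_def hzero_def)

lemma hilbert_space_hcomplex: "hilbert_space hcomplex"
proof -
  have "cvec.span {1::complex} = UNIV"
    by (auto simp: cvec.span_singleton)
  then have "\<exists>B. finite B \<and> (UNIV::complex set) = cvec.span B" by (metis finite.simps)
  moreover have "0 < Re (cnj x * x)" if "x \<noteq> 0" for x
    using that by (simp add: complex_eq_iff sum_squares_gt_zero_iff)
  ultimately show ?thesis
    by (auto simp: hilbert_space_def algebra_simps)
qed

lemma hilbert_space_hzero: "hilbert_space hzero"
  unfolding hilbert_space_def
  by (auto simp: cvec.subspace_def intro!: exI[of _ "{}"])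


section \<open>The calculus of 2-cells\<close>

lemma one_cell_src: "one_cell n m F \<Longrightarrow> src F = n"
  and one_cell_tgt: "one_cell n m F \<Longrightarrow> tgt F = m"
  and one_cell_hilbert: "one_cell n m F \<Longrightarrow> i < m \<Longrightarrow> j < n \<Longrightarrow> hilbert_space (ent F i j)"
  by (simp_all add: one_cell_def)

lemma src_one_comp [simp]: "src (G \<odot> F) = src F"
  and tgt_one_comp [simp]: "tgt (G \<odot> F) = tgt G"
  and ent_one_comp: "ent (G \<odot> F) i j = dsum (src G) (\<lambda>k. tensor (ent G i k) (ent F k j))"
  by (simp_all add: one_comp_def)

lemma one_cell_comp: "one_cell n m F \<Longrightarrow> one_cell m p G \<Longrightarrow> one_cell n p (G \<odot> F)"
  by (auto simp: one_cell_def ent_one_comp intro!: hilbert_space_dsum hilbert_space_tensor)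

lemma one_cell_id: "one_cell n n (id_one n)"
  by (simp add: one_cell_def id_one_def hilbert_space_hcomplex hilbert_space_hzero)

lemma one_cell_scalar: "hilbert_space H \<Longrightarrow> one_cell 1 1 (scalar H)"
  by (simp add: one_cell_def scalar_def)

lemma src_id_one [simp]: "src (id_one n) = n"
  and tgt_id_one [simp]: "tgt (id_one n) = n"
  and ent_id_one [simp]: "ent (id_one n) i j = (if i = j then hcomplex else hzero)"
  and src_scalar [simp]: "src (scalar H) = 1"
  and tgt_scalar [simp]: "tgt (scalar H) = 1"
  and ent_scalar [simp]: "ent (scalar H) i j = H"
  by (simp_all add: id_one_def scalar_def)

lemma comp_elem_carrier:
  assumes "one_cell n m F" "one_cell m p G" "i < p" "j < n" "k < m"
    and "x \<in> hcarrier (ent G i k)" "y \<in> hcarrier (ent F k j)"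
  shows "dinj k (elem (ent G i k) (ent F k j) x y) \<in> hcarrier (ent (G \<odot> F) i j)"
proof -
  have "\<forall>l<m. hilbert_space (tensor (ent G i l) (ent F l j))"
    using assms by (auto intro!: hilbert_space_tensor simp: one_cell_hilbert)
  then show ?thesis
    unfolding ent_one_comp one_cell_src[OF assms(2)]
    by (rule dinj_carrier) (use assms in \<open>auto intro: elem_carrier\<close>)
qed

lemma two_cell_dom: "two_cell F G \<mu> \<Longrightarrow> dom2 \<mu> = F"
  and two_cell_cod: "two_cell F G \<mu> \<Longrightarrow> cod2 \<mu> = G"
  by (simp_all add: two_cell_def)

lemma two_cell_map:
  "two_cell F G \<mu> \<Longrightarrow> one_cell n m F \<Longrightarrow> i < m \<Longrightarrow> j < n \<Longrightarrow>
    linear_map (ent F i j) (ent G i j) (app2 \<mu> i j)"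
  by (simp add: two_cell_def one_cell_def)

lemma two_cell_carrier:
  "two_cell F G \<mu> \<Longrightarrow> one_cell n m F \<Longrightarrow> i < m \<Longrightarrow> j < n \<Longrightarrow> x \<in> hcarrier (ent F i j) \<Longrightarrow>
    app2 \<mu> i j x \<in> hcarrier (ent G i j)"
  using two_cell_map[of F G \<mu> n m i j] by (simp add: linear_map_lin)

lemma two_cell_lin:
  "two_cell F G \<mu> \<Longrightarrow> one_cell n m F \<Longrightarrow> i < m \<Longrightarrow> j < n \<Longrightarrow>
    lin (hcarrier (ent F i j)) (app2 \<mu> i j)"
  using two_cell_map[of F G \<mu> n m i j] by (simp add: linear_map_lin)

lemma two_cellI:
  assumes "one_cell n m F" "one_cell n m G" "dom2 \<mu> = F" "cod2 \<mu> = G"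
    and "\<And>i j x. i < m \<Longrightarrow> j < n \<Longrightarrow> x \<in> hcarrier (ent F i j) \<Longrightarrow>
      app2 \<mu> i j x \<in> hcarrier (ent G i j)"
    and "\<And>i j. i < m \<Longrightarrow> j < n \<Longrightarrow> lin (hcarrier (ent F i j)) (app2 \<mu> i j)"
  shows "two_cell F G \<mu>"
  using assms by (auto simp: two_cell_def linear_map_lin one_cell_def)

lemma cell_eqI:
  assumes "dom2 \<mu> = F" "dom2 \<nu> = F" "cod2 \<mu> = cod2 \<nu>" "one_cell n m F"
    and "\<And>i j x. i < m \<Longrightarrow> j < n \<Longrightarrow> x \<in> hcarrier (ent F i j) \<Longrightarrow> app2 \<mu> i j x = app2 \<nu> i j x"
  shows "\<mu> \<approx> \<nu>"
  using assms by (auto simp: cell_eq_def one_cell_def)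

lemma cell_eqD:
  assumes "\<mu> \<approx> \<nu>" "dom2 \<mu> = F" "one_cell n m F" "i < m" "j < n" "x \<in> hcarrier (ent F i j)"
  shows "app2 \<mu> i j x = app2 \<nu> i j x"
proof -
  have "i < tgt F" "j < src F" using assms by (auto simp: one_cell_src one_cell_tgt)
  then show ?thesis using assms(1,6) unfolding cell_eq_def assms(2) by blast
qed

lemma dom2_vcomp [simp]: "dom2 (\<nu> \<cdot> \<mu>) = dom2 \<mu>"
  and cod2_vcomp [simp]: "cod2 (\<nu> \<cdot> \<mu>) = cod2 \<nu>"
  and app2_vcomp [simp]: "app2 (\<nu> \<cdot> \<mu>) i j x = app2 \<nu> i j (app2 \<mu> i j x)"
  and dom2_id_two [simp]: "dom2 (id_two F) = F"
  and cod2_id_two [simp]: "cod2 (id_two F) = F"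
  and app2_id_two [simp]: "app2 (id_two F) i j x = x"
  and dom2_dagger [simp]: "dom2 (dagger \<mu>) = cod2 \<mu>"
  and cod2_dagger [simp]: "cod2 (dagger \<mu>) = dom2 \<mu>"
  and dom2_hcomp [simp]: "dom2 (\<beta> \<star> \<alpha>) = dom2 \<beta> \<odot> dom2 \<alpha>"
  and cod2_hcomp [simp]: "cod2 (\<beta> \<star> \<alpha>) = cod2 \<beta> \<odot> cod2 \<alpha>"
  by (simp_all add: vcomp_def id_two_def dagger_def hcomp_def)

lemma two_cell_id: "two_cell F F (id_two F)"
  by (auto simp: two_cell_def linear_map_lin lin_id id_two_def)

lemma app2_dagger:
  "two_cell F G \<mu> \<Longrightarrow> app2 (dagger \<mu>) i j = adjoint_map (ent F i j) (ent G i j) (app2 \<mu> i j)"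
  by (simp add: dagger_def two_cell_def)

lemma two_cell_dagger:
  assumes \<mu>: "two_cell F G \<mu>" and F: "one_cell n m F" and G: "one_cell n m G"
  shows "two_cell G F (dagger \<mu>)"
proof (rule two_cellI[OF G F])
  fix i j assume "i < m" "j < n"
  then have *: "linear_map (ent G i j) (ent F i j) (app2 (dagger \<mu>) i j)"
    unfolding app2_dagger[OF \<mu>]
    by (intro linear_map_adjoint one_cell_hilbert[OF F] one_cell_hilbert[OF G] two_cell_map[OF \<mu> F])
  show "lin (hcarrier (ent G i j)) (app2 (dagger \<mu>) i j)"
    using * unfolding linear_map_lin by blast
  show "app2 (dagger \<mu>) i j x \<in> hcarrier (ent F i j)" if "x \<in> hcarrier (ent G i j)" for x
    using * that unfolding linear_map_lin by blast
qed (use \<mu> in \<open>auto simp: two_cell_def\<close>)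

lemma inner_dagger:
  assumes \<mu>: "two_cell F G \<mu>" and F: "one_cell n m F" and G: "one_cell n m G"
    and ij: "i < m" "j < n" and xy: "x \<in> hcarrier (ent F i j)" "y \<in> hcarrier (ent G i j)"
  shows "hinner (ent F i j) x (app2 (dagger \<mu>) i j y) = hinner (ent G i j) (app2 \<mu> i j x) y"
  unfolding app2_dagger[OF \<mu>]
  by (rule inner_adjoint_map[OF one_cell_hilbert[OF F ij] one_cell_hilbert[OF G ij]
        two_cell_map[OF \<mu> F ij] xy(2,1)])

lemma unitary_cell_iff_dagger:
  assumes \<mu>: "two_cell F G \<mu>" and F: "one_cell n m F" and G: "one_cell n m G"
  shows "unitary_cell \<mu> \<longleftrightarrow>
    (\<forall>i<m. \<forall>j<n.
      (\<forall>x\<in>hcarrier (ent F i j). app2 (dagger \<mu>) i j (app2 \<mu> i j x) = x) \<and>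
      (\<forall>y\<in>hcarrier (ent G i j). app2 \<mu> i j (app2 (dagger \<mu>) i j y) = y))"
  unfolding unitary_cell_def cell_eq_def dom2_vcomp cod2_vcomp dom2_dagger cod2_dagger app2_vcomp
    dom2_id_two cod2_id_two app2_id_two two_cell_dom[OF \<mu>] two_cell_cod[OF \<mu>]
    one_cell_src[OF F] one_cell_src[OF G] one_cell_tgt[OF F] one_cell_tgt[OF G]
  by blast

lemma unitary_cell_iff:
  assumes \<mu>: "two_cell F G \<mu>" and F: "one_cell n m F" and G: "one_cell n m G"
  shows "unitary_cell \<mu> \<longleftrightarrow>
    (\<forall>i<m. \<forall>j<n. unitary_map (ent F i j) (ent G i j) (app2 \<mu> i j))"
proof -
  have "unitary_map (ent F i j) (ent G i j) (app2 \<mu> i j) \<longleftrightarrow>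
      (\<forall>x\<in>hcarrier (ent F i j). app2 (dagger \<mu>) i j (app2 \<mu> i j x) = x) \<and>
      (\<forall>y\<in>hcarrier (ent G i j). app2 \<mu> i j (app2 (dagger \<mu>) i j y) = y)"
    if ij: "i < m" "j < n" for i j
    unfolding app2_dagger[OF \<mu>]
    by (rule unitary_map_iff_adjoint[OF one_cell_hilbert[OF F ij] one_cell_hilbert[OF G ij]
          two_cell_map[OF \<mu> F ij]])
  then show ?thesis
    unfolding unitary_cell_iff_dagger[OF assms] by blast
qed

lemma unitary_cell_dagger:
  assumes "two_cell F G \<mu>" "one_cell n m F" "one_cell n m G" "unitary_cell \<mu>" "i < m" "j < n"
  shows "x \<in> hcarrier (ent F i j) \<Longrightarrow> app2 (dagger \<mu>) i j (app2 \<mu> i j x) = x"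
    and "y \<in> hcarrier (ent G i j) \<Longrightarrow> app2 \<mu> i j (app2 (dagger \<mu>) i j y) = y"
  using assms unfolding unitary_cell_iff_dagger[OF assms(1-3)] by blast+

lemma lift_zero [simp]: "lift H K \<beta> 0 = 0"
  by (simp add: lift_def)

lemma app2_hcomp:
  "app2 (\<beta> \<star> \<alpha>) i j u k =
    (if k < src (dom2 \<beta>)
     then lift (ent (dom2 \<beta>) i k) (ent (dom2 \<alpha>) k j)
       (\<lambda>x y. elem (ent (cod2 \<beta>) i k) (ent (cod2 \<alpha>) k j) (app2 \<beta> i k x) (app2 \<alpha> k j y)) (u k)
     else 0)"
  by (simp add: hcomp_def)

lemma lin_hcomp: "lin UNIV (app2 (\<beta> \<star> \<alpha>) i j)"
  unfolding hcomp_def twocell.simps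
  by (rule lin_fun, intro lin_if lin_lift_arg lin_proj lin_const_zero)

text \<open>
  All computations with 2-cells below take place on elementary tensors in a single summand. Here
  and in the evaluation of the coherence isomorphisms, bilinearity is what allows the linear
  extension \<open>lift\<close> to be removed.
\<close>

lemma hcomp_dinj:
  assumes \<beta>: "two_cell G G' \<beta>" and G: "one_cell b c G" and G': "one_cell b c G'"
    and \<alpha>: "two_cell F F' \<alpha>" and F: "one_cell a b F" and F': "one_cell a b F'"
    and ijk: "i < c" "j < a" "k < b"
    and xy: "x \<in> hcarrier (ent G i k)" "y \<in> hcarrier (ent F k j)"
  shows "app2 (\<beta> \<star> \<alpha>) i j (dinj k (elem (ent G i k) (ent F k j) x y)) =
    dinj k (elem (ent G' i k) (ent F' k j) (app2 \<beta> i k x) (app2 \<alpha> k j y))"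
proof -
  have "bilin (ent G i k) (ent F k j)
      (\<lambda>x y. elem (ent G' i k) (ent F' k j) (app2 \<beta> i k x) (app2 \<alpha> k j y))"
    using assms by (intro bilin_elem two_cell_map) (auto intro: one_cell_hilbert)
  then have "lift (ent G i k) (ent F k j)
      (\<lambda>x y. elem (ent G' i k) (ent F' k j) (app2 \<beta> i k x) (app2 \<alpha> k j y))
      (elem (ent G i k) (ent F k j) x y) =
    elem (ent G' i k) (ent F' k j) (app2 \<beta> i k x) (app2 \<alpha> k j y)"
    using ijk xy by (intro lift_elem one_cell_hilbert[OF G] one_cell_hilbert[OF F])
  then show ?thesis
    using ijk
    by (simp add: fun_eq_iff app2_hcomp two_cell_dom[OF \<beta>] two_cell_dom[OF \<alpha>]
        two_cell_cod[OF \<beta>] two_cell_cod[OF \<alpha>] one_cell_src[OF G] dinj_def)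
qed

lemma two_cell_hcomp:
  assumes \<beta>: "two_cell G G' \<beta>" and G: "one_cell b c G" and G': "one_cell b c G'"
    and \<alpha>: "two_cell F F' \<alpha>" and F: "one_cell a b F" and F': "one_cell a b F'"
  shows "two_cell (G \<odot> F) (G' \<odot> F') (\<beta> \<star> \<alpha>)"
proof (rule two_cellI[OF one_cell_comp[OF F G] one_cell_comp[OF F' G']])
  fix i j x assume ij: "i < c" "j < a"
  have "lift (ent G i k) (ent F k j)
      (\<lambda>x y. elem (ent G' i k) (ent F' k j) (app2 \<beta> i k x) (app2 \<alpha> k j y)) t
    \<in> hcarrier (tensor (ent G' i k) (ent F' k j))" if "k < b" for k t
    using ij that
    by (intro lift_carrier subspace_tensor elem_carrier two_cell_carrier[OF \<beta> G]
        two_cell_carrier[OF \<alpha> F] one_cell_hilbert[OF G] one_cell_hilbert[OF F])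
  then show "app2 (\<beta> \<star> \<alpha>) i j x \<in> hcarrier (ent (G' \<odot> F') i j)"
    by (simp add: ent_one_comp dsum_carrier app2_hcomp two_cell_dom[OF \<beta>] two_cell_dom[OF \<alpha>]
        two_cell_cod[OF \<beta>] two_cell_cod[OF \<alpha>] one_cell_src[OF G] one_cell_src[OF G'])
next
  fix i j show "lin (hcarrier (ent (G \<odot> F) i j)) (app2 (\<beta> \<star> \<alpha>) i j)"
    using lin_hcomp[of \<beta> \<alpha> i j] by (simp add: lin_def)
qed (simp_all add: two_cell_dom[OF \<beta>] two_cell_dom[OF \<alpha>] two_cell_cod[OF \<beta>] two_cell_cod[OF \<alpha>])

lemma lin_mono: "lin UNIV f \<Longrightarrow> lin S f"
  by (simp add: lin_def)

subsection \<open>The coherence isomorphisms on elementary tensors\<close>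

lemma dom2_lunit [simp]: "dom2 (lunit F) = id_one (tgt F) \<odot> F"
  and cod2_lunit [simp]: "cod2 (lunit F) = F"
  and dom2_lunit_inv [simp]: "dom2 (lunit_inv F) = F"
  and cod2_lunit_inv [simp]: "cod2 (lunit_inv F) = id_one (tgt F) \<odot> F"
  and app2_lunit_inv: "app2 (lunit_inv F) i j x = dinj i (elem hcomplex (ent F i j) 1 x)"
  and dom2_runit [simp]: "dom2 (runit F) = F \<odot> id_one (src F)"
  and cod2_runit [simp]: "cod2 (runit F) = F"
  and dom2_runit_inv [simp]: "dom2 (runit_inv F) = F"
  and cod2_runit_inv [simp]: "cod2 (runit_inv F) = F \<odot> id_one (src F)"
  and app2_runit_inv: "app2 (runit_inv F) i j x = dinj j (elem (ent F i j) hcomplex x 1)"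
  and dom2_assoc [simp]: "dom2 (assoc H' G F) = H' \<odot> (G \<odot> F)"
  and cod2_assoc [simp]: "cod2 (assoc H' G F) = (H' \<odot> G) \<odot> F"
  and dom2_assoc_inv [simp]: "dom2 (assoc_inv H' G F) = (H' \<odot> G) \<odot> F"
  and cod2_assoc_inv [simp]: "cod2 (assoc_inv H' G F) = H' \<odot> (G \<odot> F)"
  by (simp_all add: lunit_def lunit_inv_def runit_def runit_inv_def assoc_def assoc_inv_def)

lemma lin_lunit: "lin UNIV (app2 (lunit F) i j)"
  and lin_runit: "lin UNIV (app2 (runit F) i j)"
  and lin_assoc: "lin UNIV (app2 (assoc H' G F) i j)"
  and lin_assoc_inv: "lin UNIV (app2 (assoc_inv H' G F) i j)"
  unfolding lunit_def runit_def assoc_def assoc_inv_def twocell.simps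
  by (intro lin_sum_fun lin_lift_arg lin_proj)+

lemma bilin_scale:
  "hilbert_space H \<Longrightarrow> bilin hcomplex H (\<lambda>z x. z *\<^sub>C x)"
  "hilbert_space H \<Longrightarrow> bilin H hcomplex (\<lambda>x z. z *\<^sub>C x)"
  by (intro bilinI linI; simp add: scaleC_add_left scaleC_add_right scaleC_scaleC mult.commute)+

lemma lunit_dinj:
  assumes "one_cell n m F" "i < m" "j < n" "x \<in> hcarrier (ent F i j)"
  shows "app2 (lunit F) i j (dinj i (elem hcomplex (ent F i j) z x)) = z *\<^sub>C x"
  using assms by (simp add: lunit_def lift_elem bilin_scale one_cell_hilbert hilbert_space_hcomplex)

lemma lunit_dinj_other: "k \<noteq> i \<Longrightarrow> app2 (lunit F) i j (dinj k t) = 0"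
  by (simp add: lunit_def dinj_def)

lemma runit_dinj:
  assumes "one_cell n m F" "i < m" "j < n" "x \<in> hcarrier (ent F i j)"
  shows "app2 (runit F) i j (dinj j (elem (ent F i j) hcomplex x z)) = z *\<^sub>C x"
  using assms by (simp add: runit_def lift_elem bilin_scale one_cell_hilbert hilbert_space_hcomplex)

lemma runit_dinj_other: "k \<noteq> j \<Longrightarrow> app2 (runit F) i j (dinj k t) = 0"
  by (simp add: runit_def dinj_def)

lemma two_cell_runit:
  assumes F: "one_cell n m F"
  shows "two_cell (F \<odot> id_one n) F (runit F)"
proof (rule two_cellI[OF one_cell_comp[OF one_cell_id F] F])
  fix i j x assume "i < m" "j < n"
  then show "app2 (runit F) i j x \<in> hcarrier (ent F i j)"
    using F by (auto simp: runit_def intro!: lift_carrier hilbert_subspace carrier_scale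
        hilbert_space_hcomplex intro: one_cell_hilbert)
qed (use F in \<open>auto simp: one_cell_src intro: lin_mono[OF lin_runit]\<close>)

context
  fixes a b c d :: nat and F :: "'a::complex_vector onecell"
    and G :: "'b::complex_vector onecell" and H' :: "'c::complex_vector onecell"
  assumes F: "one_cell a b F" and G: "one_cell b c G" and H': "one_cell c d H'"
begin

lemma assoc_dinj:
  assumes ijkl: "i < d" "l < a" "j < c" "k < b"
    and h: "h \<in> hcarrier (ent H' i j)" and g: "g \<in> hcarrier (ent G j k)"
    and f: "f \<in> hcarrier (ent F k l)"
  shows "app2 (assoc H' G F) i l
      (dinj j (elem (ent H' i j) (ent (G \<odot> F) j l) h (dinj k (elem (ent G j k) (ent F k l) g f)))) =
    dinj k (elem (ent (H' \<odot> G) i k) (ent F k l) (dinj j (elem (ent H' i j) (ent G j k) h g)) f)"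
proof -
  let ?\<beta> = "\<lambda>k h g f. dinj k (elem (ent (H' \<odot> G) i k) (ent F k l)
    (dinj j (elem (ent H' i j) (ent G j k) h g)) f)"
  note hilb = one_cell_hilbert[OF F] one_cell_hilbert[OF G] one_cell_hilbert[OF H']
    one_cell_hilbert[OF one_cell_comp[OF G H']] one_cell_hilbert[OF one_cell_comp[OF F G]]
  have 1: "lin (hcarrier (ent H' i j)) (\<lambda>h. ?\<beta> k h g f)"
    if "g \<in> hcarrier (ent G j k)" "k < b" for k g f
    using that ijkl
    by (intro lin_dinj lin_elem_left lin_id comp_elem_carrier[OF G H'] hilb)
  have 2: "lin (hcarrier (ent F k l)) (\<lambda>f. ?\<beta> k h g f)" if "k < b" for k h g
    using that ijkl by (intro lin_dinj lin_elem_right lin_id hilb)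
  have 3: "lin (hcarrier (ent G j k)) (\<lambda>g. ?\<beta> k h g f)"
    if "h \<in> hcarrier (ent H' i j)" "k < b" for k h f
    using that ijkl
    by (intro lin_dinj lin_elem_left lin_elem_right lin_id comp_elem_carrier[OF G H'] hilb)
  have 4: "bilin (ent G j k) (ent F k l) (?\<beta> k h)" if "h \<in> hcarrier (ent H' i j)" "k < b" for k h
    using 2 3 that by (intro bilinI) auto
  have 5: "bilin (ent H' i j) (ent (G \<odot> F) j l)
      (\<lambda>h v. \<Sum>k<b. lift (ent G j k) (ent F k l) (?\<beta> k h) (v k))"
    using ijkl F G H' 1
    by (intro bilinI lin_sum_fun lin_lift_arg lin_proj lin_lift_fun)
      (auto intro: one_cell_hilbert)
  have 6: "dinj k (elem (ent G j k) (ent F k l) g f) \<in> hcarrier (ent (G \<odot> F) j l)"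
    using F G ijkl g f by (intro comp_elem_carrier)
  let ?u = "dinj j (elem (ent H' i j) (ent (G \<odot> F) j l) h (dinj k (elem (ent G j k) (ent F k l) g f)))"
  have "app2 (assoc H' G F) i l ?u = (\<Sum>j'<c. if j' = j then
      lift (ent H' i j) (ent (G \<odot> F) j l)
          (\<lambda>h v. \<Sum>k<b. lift (ent G j k) (ent F k l) (?\<beta> k h) (v k))
          (elem (ent H' i j) (ent (G \<odot> F) j l) h (dinj k (elem (ent G j k) (ent F k l) g f))) else 0)"
    using H' G unfolding assoc_def twocell.simps
    by (intro sum.cong) (auto simp: one_cell_src dinj_def)
  also have "\<dots> = (\<Sum>k'<b. lift (ent G j k') (ent F k' l) (?\<beta> k' h)
      (dinj k (elem (ent G j k) (ent F k l) g f) k'))"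
    using ijkl F G H' h 5 6
    by (simp add: lift_elem one_cell_hilbert one_cell_hilbert[OF one_cell_comp[OF F G]])
  also have "\<dots> = (\<Sum>k'<b. if k' = k then ?\<beta> k h g f else 0)"
    using ijkl F G h g f 4
    by (intro sum.cong) (auto simp: lift_elem one_cell_hilbert dinj_def)
  also have "\<dots> = ?\<beta> k h g f" using ijkl by simp
  finally show ?thesis .
qed

lemma assoc_inv_dinj:
  assumes ijkl: "i < d" "l < a" "j < c" "k < b"
    and h: "h \<in> hcarrier (ent H' i j)" and g: "g \<in> hcarrier (ent G j k)"
    and f: "f \<in> hcarrier (ent F k l)"
  shows "app2 (assoc_inv H' G F) i l
      (dinj k (elem (ent (H' \<odot> G) i k) (ent F k l) (dinj j (elem (ent H' i j) (ent G j k) h g)) f)) =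
    dinj j (elem (ent H' i j) (ent (G \<odot> F) j l) h (dinj k (elem (ent G j k) (ent F k l) g f)))"
proof -
  let ?\<beta> = "\<lambda>j f h g. dinj j (elem (ent H' i j) (ent (G \<odot> F) j l) h
    (dinj k (elem (ent G j k) (ent F k l) g f)))"
  note hilb = one_cell_hilbert[OF F] one_cell_hilbert[OF G] one_cell_hilbert[OF H']
    one_cell_hilbert[OF one_cell_comp[OF G H']] one_cell_hilbert[OF one_cell_comp[OF F G]]
  have 1: "lin (hcarrier (ent H' i j)) (\<lambda>h. ?\<beta> j f h g)" if "j < c" for j f g
    using that ijkl by (intro lin_dinj lin_elem_left lin_id hilb)
  have 2: "lin (hcarrier (ent F k l)) (\<lambda>f. ?\<beta> j f h g)"
    if "g \<in> hcarrier (ent G j k)" "j < c" for j h g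
    using that ijkl
    by (intro lin_dinj lin_elem_right lin_id comp_elem_carrier[OF F G] hilb)
  have 3: "lin (hcarrier (ent G j k)) (\<lambda>g. ?\<beta> j f h g)"
    if "f \<in> hcarrier (ent F k l)" "j < c" for j h f
    using that ijkl
    by (intro lin_dinj lin_elem_left lin_elem_right lin_id comp_elem_carrier[OF F G] hilb)
  have 4: "bilin (ent H' i j) (ent G j k) (?\<beta> j f)" if "f \<in> hcarrier (ent F k l)" "j < c" for j f
    using 1 3 that by (intro bilinI) auto
  have 5: "bilin (ent (H' \<odot> G) i k) (ent F k l)
      (\<lambda>v f. \<Sum>j<c. lift (ent H' i j) (ent G j k) (?\<beta> j f) (v j))"
    using ijkl F G H' 2
    by (intro bilinI lin_sum_fun lin_lift_arg lin_proj lin_lift_fun)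
      (auto intro: one_cell_hilbert)
  have 6: "dinj j (elem (ent H' i j) (ent G j k) h g) \<in> hcarrier (ent (H' \<odot> G) i k)"
    using G H' ijkl g h by (intro comp_elem_carrier)
  let ?u = "dinj k (elem (ent (H' \<odot> G) i k) (ent F k l) (dinj j (elem (ent H' i j) (ent G j k) h g)) f)"
  have "app2 (assoc_inv H' G F) i l ?u = (\<Sum>k'<b. if k' = k then
      lift (ent (H' \<odot> G) i k) (ent F k l)
          (\<lambda>v f. \<Sum>j<c. lift (ent H' i j) (ent G j k) (?\<beta> j f) (v j))
          (elem (ent (H' \<odot> G) i k) (ent F k l) (dinj j (elem (ent H' i j) (ent G j k) h g)) f) else 0)"
    using H' G unfolding assoc_inv_def twocell.simps
    by (intro sum.cong) (auto simp: one_cell_src dinj_def)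
  also have "\<dots> = (\<Sum>j'<c. lift (ent H' i j') (ent G j' k) (?\<beta> j' f)
      (dinj j (elem (ent H' i j) (ent G j k) h g) j'))"
    using ijkl F G H' f 5 6
    by (simp add: lift_elem one_cell_hilbert one_cell_hilbert[OF one_cell_comp[OF G H']])
  also have "\<dots> = (\<Sum>j'<c. if j' = j then ?\<beta> j f h g else 0)"
    using ijkl G H' h g f 4
    by (intro sum.cong) (auto simp: lift_elem one_cell_hilbert dinj_def)
  also have "\<dots> = ?\<beta> j f h g" using ijkl by simp
  finally show ?thesis .
qed

lemma two_cell_assoc_inv: "two_cell ((H' \<odot> G) \<odot> F) (H' \<odot> (G \<odot> F)) (assoc_inv H' G F)"
proof (rule two_cellI)
  show "one_cell a d ((H' \<odot> G) \<odot> F)"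
    by (rule one_cell_comp[OF F one_cell_comp[OF G H']])
  show c: "one_cell a d (H' \<odot> (G \<odot> F))"
    by (rule one_cell_comp[OF one_cell_comp[OF F G] H'])
  fix i l x assume il: "i < d" "l < a"
  show "app2 (assoc_inv H' G F) i l x \<in> hcarrier (ent (H' \<odot> (G \<odot> F)) i l)"
    unfolding assoc_inv_def twocell.simps one_cell_src[OF G] one_cell_src[OF H']
    using il one_cell_hilbert[OF c il]
    by (intro carrier_sum lift_carrier hilbert_subspace comp_elem_carrier[OF one_cell_comp[OF F G] H']
        comp_elem_carrier[OF F G])
      (auto intro: one_cell_hilbert[OF F] one_cell_hilbert[OF G] one_cell_hilbert[OF H']
        one_cell_hilbert[OF one_cell_comp[OF G H']])
qed (auto intro: lin_mono[OF lin_assoc_inv])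

end


section \<open>Witnesses in coordinates\<close>

text \<open>
  The typing of the data of a witness, without any equation between composites. Composites can be
  evaluated from this alone, which serves both to extract vectors from a witness and to construct
  a witness from vectors.
\<close>

locale witness_data =
  fixes n :: nat and W :: "('l::complex_vector, 'r::complex_vector) witness"
  assumes wl: "one_cell 1 n (wl W)" and wr: "one_cell n 1 (wr W)"
    and create: "two_cell (id_one 1) (wr W \<odot> wl W) (create W)"
    and copy: "two_cell (id_one n) (wl W \<odot> wr W) (copy W)"
begin

abbreviation L :: "nat \<Rightarrow> 'l hilb" where "L k \<equiv> ent (wl W) k 0"
abbreviation R :: "nat \<Rightarrow> 'r hilb" where "R k \<equiv> ent (wr W) 0 k"
abbreviation M :: "(nat \<Rightarrow> 'r \<Rightarrow> 'l \<Rightarrow> complex) hilb" where "M \<equiv> ent (wr W \<odot> wl W) 0 0"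
abbreviation P :: "nat \<Rightarrow> nat \<Rightarrow> (nat \<Rightarrow> 'l \<Rightarrow> 'r \<Rightarrow> complex) hilb"
  where "P i j \<equiv> ent (wl W \<odot> wr W) i j"

definition pairing :: "nat \<Rightarrow> 'l \<Rightarrow> 'r \<Rightarrow> complex" where
  "pairing k l r = app2 (compare W) k k (dinj 0 (elem (L k) (R k) l r))"

lemma rl: "one_cell 1 1 (wr W \<odot> wl W)"
  by (rule one_cell_comp[OF wl wr])

lemma lr: "one_cell n n (wl W \<odot> wr W)"
  by (rule one_cell_comp[OF wr wl])

lemma hilbert_L: "k < n \<Longrightarrow> hilbert_space (L k)"
  and hilbert_R: "k < n \<Longrightarrow> hilbert_space (R k)"
  and hilbert_M: "hilbert_space M"
  by (auto intro: one_cell_hilbert[OF wl] one_cell_hilbert[OF wr] one_cell_hilbert[OF rl])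

lemma M_dsum: "M = dsum n (\<lambda>k. tensor (R k) (L k))"
  by (simp add: ent_one_comp one_cell_src[OF wr])

lemma P_dsum: "P i j = dsum 1 (\<lambda>k. tensor (ent (wl W) i k) (ent (wr W) k j))"
  by (simp add: ent_one_comp one_cell_src[OF wl])

lemma hilbert_summands:
  "\<forall>k<n. hilbert_space (tensor (R k) (L k))"
  "i < n \<Longrightarrow> j < n \<Longrightarrow> \<forall>k<1. hilbert_space (tensor (ent (wl W) i k) (ent (wr W) k j))"
  by (auto intro!: hilbert_space_tensor hilbert_R hilbert_L)

lemma M_carrier: "k < n \<Longrightarrow> t \<in> hcarrier (tensor (R k) (L k)) \<Longrightarrow> dinj k t \<in> hcarrier M"
  unfolding M_dsum by (rule dinj_carrier[OF hilbert_summands(1)])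

lemma P_carrier:
  assumes "i < n" "j < n" "t \<in> hcarrier (tensor (L i) (R j))"
  shows "dinj 0 t \<in> hcarrier (P i j)"
  unfolding P_dsum by (rule dinj_carrier[OF hilbert_summands(2)]) (use assms in auto)

lemma M_elem: "k < n \<Longrightarrow> r \<in> hcarrier (R k) \<Longrightarrow> l \<in> hcarrier (L k) \<Longrightarrow>
    dinj k (elem (R k) (L k) r l) \<in> hcarrier M"
  by (intro M_carrier elem_carrier)

lemma P_elem: "i < n \<Longrightarrow> j < n \<Longrightarrow> l \<in> hcarrier (L i) \<Longrightarrow> r \<in> hcarrier (R j) \<Longrightarrow>
    dinj 0 (elem (L i) (R j) l r) \<in> hcarrier (P i j)"
  by (intro P_carrier elem_carrier)

lemma compare: "two_cell (wl W \<odot> wr W) (id_one n) (compare W)"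
  unfolding compare_def by (rule two_cell_dagger[OF copy one_cell_id lr])

lemma delete: "two_cell (wr W \<odot> wl W) (id_one 1) (delete W)"
  unfolding delete_def by (rule two_cell_dagger[OF create one_cell_id rl])

lemma create_one_carrier: "app2 (create W) 0 0 1 \<in> hcarrier M"
  by (rule two_cell_carrier[OF create one_cell_id]) auto

lemma copy_one_carrier: "k < n \<Longrightarrow> app2 (copy W) k k 1 \<in> hcarrier (P k k)"
  by (rule two_cell_carrier[OF copy one_cell_id]) auto

lemma compare_eq_inner:
  assumes "k < n" "v \<in> hcarrier (P k k)"
  shows "app2 (compare W) k k v = hinner (P k k) (app2 (copy W) k k 1) v"
  using inner_dagger[OF copy one_cell_id lr, of k k 1 v] assms by (simp add: compare_def)

lemma delete_eq_inner:
  assumes "v \<in> hcarrier M"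
  shows "app2 (delete W) 0 0 v = hinner M (app2 (create W) 0 0 1) v"
  using inner_dagger[OF create one_cell_id rl, of 0 0 1 v] assms by (simp add: delete_def)

text \<open>
  The multiplication composes matrix units: the inner factors \<open>l\<close> and \<open>r'\<close> are contracted by
  the pairing that compare induces, and products across different summands vanish.
\<close>

lemma mult_elem:
  assumes k: "k < n" "k' < n" and r: "r \<in> hcarrier (R k)" and l: "l \<in> hcarrier (L k)"
    and r': "r' \<in> hcarrier (R k')" and l': "l' \<in> hcarrier (L k')"
  shows "app2 (wmult W) 0 0
      (dinj 0 (elem M M (dinj k (elem (R k) (L k) r l)) (dinj k' (elem (R k') (L k') r' l')))) =
    (if k = k' then pairing k l r' *\<^sub>C dinj k (elem (R k) (L k) r l') else 0)"
proof -
  let ?m = "dinj k (elem (R k) (L k) r l)"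
  have m: "?m \<in> hcarrier M" by (rule M_elem[OF k(1) r l])
  have 1: "app2 (assoc (wr W \<odot> wl W) (wr W) (wl W)) 0 0
      (dinj 0 (elem M M ?m (dinj k' (elem (R k') (L k') r' l')))) =
    dinj k' (elem (ent ((wr W \<odot> wl W) \<odot> wr W) 0 k') (L k') (dinj 0 (elem M (R k') ?m r')) l')"
    by (rule assoc_dinj[OF wl wr rl]) (use k m r' l' in auto)
  have 2: "app2 (assoc_inv (wr W) (wl W) (wr W) \<star> id_two (wl W)) 0 0
      (dinj k' (elem (ent ((wr W \<odot> wl W) \<odot> wr W) 0 k') (L k') (dinj 0 (elem M (R k') ?m r')) l')) =
    dinj k' (elem (ent (wr W \<odot> (wl W \<odot> wr W)) 0 k') (L k')
      (dinj k (elem (R k) (P k k') r (dinj 0 (elem (L k) (R k') l r')))) l')"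
  proof -
    have "dinj 0 (elem M (R k') ?m r') \<in> hcarrier (ent ((wr W \<odot> wl W) \<odot> wr W) 0 k')"
      by (rule comp_elem_carrier[OF wr rl]) (use k m r' in auto)
    then have "app2 (assoc_inv (wr W) (wl W) (wr W) \<star> id_two (wl W)) 0 0
      (dinj k' (elem (ent ((wr W \<odot> wl W) \<odot> wr W) 0 k') (L k') (dinj 0 (elem M (R k') ?m r')) l')) =
      dinj k' (elem (ent (wr W \<odot> (wl W \<odot> wr W)) 0 k') (L k')
        (app2 (assoc_inv (wr W) (wl W) (wr W)) 0 k' (dinj 0 (elem M (R k') ?m r')))
        (app2 (id_two (wl W)) k' 0 l'))"
      by (intro hcomp_dinj[OF two_cell_assoc_inv[OF wr wl wr] one_cell_comp[OF wr rl]
            one_cell_comp[OF lr wr] two_cell_id wl wl]) (use k l' in auto)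
    also have "app2 (assoc_inv (wr W) (wl W) (wr W)) 0 k' (dinj 0 (elem M (R k') ?m r')) =
        dinj k (elem (R k) (P k k') r (dinj 0 (elem (L k) (R k') l r')))"
      by (rule assoc_inv_dinj[OF wr wl wr]) (use k r l r' in auto)
    finally show ?thesis by simp
  qed
  let ?p = "dinj 0 (elem (L k) (R k') l r')"
  have p: "?p \<in> hcarrier (P k k')" by (rule P_elem[OF k l r'])
  let ?c = "app2 (compare W) k k' ?p"
  have c: "?c \<in> hcarrier (ent (id_one n) k k')"
    by (rule two_cell_carrier[OF compare lr k p])
  note idc = one_cell_comp[OF one_cell_id wr]
  have 3: "app2 ((id_two (wr W) \<star> compare W) \<star> id_two (wl W)) 0 0
      (dinj k' (elem (ent (wr W \<odot> (wl W \<odot> wr W)) 0 k') (L k') (dinj k (elem (R k) (P k k') r ?p)) l')) =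
    dinj k' (elem (ent (wr W \<odot> id_one n) 0 k') (L k')
      (dinj k (elem (R k) (ent (id_one n) k k') r ?c)) l')"
  proof -
    have "dinj k (elem (R k) (P k k') r ?p) \<in> hcarrier (ent (wr W \<odot> (wl W \<odot> wr W)) 0 k')"
      by (rule comp_elem_carrier[OF lr wr]) (use k r p in auto)
    then have "app2 ((id_two (wr W) \<star> compare W) \<star> id_two (wl W)) 0 0
      (dinj k' (elem (ent (wr W \<odot> (wl W \<odot> wr W)) 0 k') (L k') (dinj k (elem (R k) (P k k') r ?p)) l')) =
      dinj k' (elem (ent (wr W \<odot> id_one n) 0 k') (L k')
        (app2 (id_two (wr W) \<star> compare W) 0 k' (dinj k (elem (R k) (P k k') r ?p)))
        (app2 (id_two (wl W)) k' 0 l'))"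
      by (intro hcomp_dinj[OF two_cell_hcomp[OF two_cell_id wr wr compare lr one_cell_id]
            one_cell_comp[OF lr wr] idc two_cell_id wl wl]) (use k l' in auto)
    also have "app2 (id_two (wr W) \<star> compare W) 0 k' (dinj k (elem (R k) (P k k') r ?p)) =
      dinj k (elem (R k) (ent (id_one n) k k') (app2 (id_two (wr W)) 0 k r) ?c)"
      by (rule hcomp_dinj[OF two_cell_id wr wr compare lr one_cell_id]) (use k r p in auto)
    finally show ?thesis by simp
  qed
  have 4: "app2 (runit (wr W) \<star> id_two (wl W)) 0 0
      (dinj k' (elem (ent (wr W \<odot> id_one n) 0 k') (L k')
        (dinj k (elem (R k) (ent (id_one n) k k') r ?c)) l')) =
      dinj k' (elem (R k') (L k')
        (app2 (runit (wr W)) 0 k' (dinj k (elem (R k) (ent (id_one n) k k') r ?c))) l')"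
  proof -
    have "dinj k (elem (R k) (ent (id_one n) k k') r ?c) \<in> hcarrier (ent (wr W \<odot> id_one n) 0 k')"
      by (rule comp_elem_carrier[OF one_cell_id wr]) (use k r c in auto)
    then have "app2 (runit (wr W) \<star> id_two (wl W)) 0 0
      (dinj k' (elem (ent (wr W \<odot> id_one n) 0 k') (L k')
        (dinj k (elem (R k) (ent (id_one n) k k') r ?c)) l')) =
      dinj k' (elem (R k') (L k')
        (app2 (runit (wr W)) 0 k' (dinj k (elem (R k) (ent (id_one n) k k') r ?c)))
        (app2 (id_two (wl W)) k' 0 l'))"
      by (intro hcomp_dinj[OF two_cell_runit[OF wr] idc wr two_cell_id wl wl]) (use k l' in auto)
    then show ?thesis by simp
  qed
  have "app2 (wmult W) 0 0
      (dinj 0 (elem M M ?m (dinj k' (elem (R k') (L k') r' l')))) =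
      dinj k' (elem (R k') (L k')
        (app2 (runit (wr W)) 0 k' (dinj k (elem (R k) (ent (id_one n) k k') r ?c))) l')"
    unfolding wmult_def app2_vcomp 1 2 3 4 ..
  also have "\<dots> = (if k = k' then pairing k l r' *\<^sub>C dinj k (elem (R k) (L k) r l') else 0)"
  proof (cases "k = k'")
    case True
    then have "app2 (runit (wr W)) 0 k' (dinj k (elem (R k) (ent (id_one n) k k') r ?c)) =
        pairing k l r' *\<^sub>C r"
      using runit_dinj[OF wr, of 0 k r ?c] k r by (simp add: pairing_def)
    with True show ?thesis
      using elem_scale_left[OF hilbert_R[OF k(1)] r, of "L k" "pairing k l r'" l']
        lin_scale[OF lin_dinj[OF lin_id], of "elem (R k) (L k) r l'" UNIV]
      by simp
  next
    case False
    then show ?thesis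
      using elem_zero_left[OF hilbert_R[OF k(2)], of "L k'" l'] by (simp add: runit_dinj_other)
  qed
  finally show ?thesis .
qed

text \<open>
  If create and copy are given by a single elementary tensor in each summand, a zigzag composite
  sends \<open>x\<close> to a scalar multiple of one of the two vectors of that tensor. All summands of create
  enter the composites with compare, but the final unitor annihilates all of them except one.
\<close>

context
  fixes \<rho> :: "nat \<Rightarrow> 'r" and \<eta> :: "nat \<Rightarrow> 'l"
  assumes \<rho>: "\<And>k. k < n \<Longrightarrow> \<rho> k \<in> hcarrier (R k)"
    and \<eta>: "\<And>k. k < n \<Longrightarrow> \<eta> k \<in> hcarrier (L k)"
begin

lemma zigzag_create_compare_left:
  assumes cr: "app2 (create W) 0 0 1 = (\<Sum>m<n. dinj m (elem (R m) (L m) (\<rho> m) (\<eta> m)))"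
    and k: "k < n" and x: "x \<in> hcarrier (L k)"
  shows "app2 (lunit (wl W) \<cdot> (compare W \<star> id_two (wl W)) \<cdot> assoc (wl W) (wr W) (wl W)
       \<cdot> (id_two (wl W) \<star> create W) \<cdot> runit_inv (wl W)) k 0 x = pairing k x (\<rho> k) *\<^sub>C \<eta> k"
proof -
  let ?e = "\<lambda>m. dinj m (elem (R m) (L m) (\<rho> m) (\<eta> m))"
  have e: "?e m \<in> hcarrier M" if "m < n" for m using that by (intro M_elem \<rho> \<eta>)
  have "app2 (id_two (wl W) \<star> create W) k 0 (dinj 0 (elem (L k) hcomplex x 1)) =
      dinj 0 (elem (L k) M x (\<Sum>m<n. ?e m))"
    using hcomp_dinj[OF two_cell_id wl wl create one_cell_id rl, of k 0 0 x 1] k x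
    by (simp add: cr)
  also have "\<dots> = (\<Sum>m<n. dinj 0 (elem (L k) M x (?e m)))"
    by (rule lin_sum[OF lin_dinj[OF lin_elem_right[OF hilbert_M lin_id]] hilbert_subspace[OF hilbert_M]])
      (use e in auto)
  finally have 1: "app2 (id_two (wl W) \<star> create W) k 0 (dinj 0 (elem (L k) hcomplex x 1)) =
      (\<Sum>m<n. dinj 0 (elem (L k) M x (?e m)))" .
  let ?p = "\<lambda>m. dinj 0 (elem (L k) (R m) x (\<rho> m))"
  have p: "?p m \<in> hcarrier (P k m)" if "m < n" for m using that k x by (intro P_elem \<rho>)
  have 2: "app2 (assoc (wl W) (wr W) (wl W)) k 0 (\<Sum>m<n. dinj 0 (elem (L k) M x (?e m))) =
      (\<Sum>m<n. dinj m (elem (P k m) (L m) (?p m) (\<eta> m)))"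
    unfolding lin_sum[OF lin_assoc cvec.subspace_UNIV UNIV_I]
    by (intro sum.cong assoc_dinj[OF wl wr wl]) (use k x \<rho> \<eta> in auto)
  have 3: "app2 (compare W \<star> id_two (wl W)) k 0 (\<Sum>m<n. dinj m (elem (P k m) (L m) (?p m) (\<eta> m))) =
      (\<Sum>m<n. dinj m (elem (ent (id_one n) k m) (L m) (app2 (compare W) k m (?p m))
        (app2 (id_two (wl W)) m 0 (\<eta> m))))"
    unfolding lin_sum[OF lin_hcomp cvec.subspace_UNIV UNIV_I]
    by (intro sum.cong hcomp_dinj[OF compare lr one_cell_id two_cell_id wl wl])
      (use k p \<eta> in auto)
  have 4: "app2 (lunit (wl W)) k 0
      (\<Sum>m<n. dinj m (elem (ent (id_one n) k m) (L m) (app2 (compare W) k m (?p m))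
        (app2 (id_two (wl W)) m 0 (\<eta> m)))) = (\<Sum>m<n. if m = k then pairing k x (\<rho> k) *\<^sub>C \<eta> k else 0)"
    unfolding lin_sum[OF lin_lunit cvec.subspace_UNIV UNIV_I]
    by (intro sum.cong)
      (use k \<eta> in \<open>auto simp: lunit_dinj[OF wl] lunit_dinj_other pairing_def\<close>)
  show ?thesis
    unfolding app2_vcomp app2_runit_inv 1 2 3 4 using k by simp
qed

lemma zigzag_create_compare_right:
  assumes cr: "app2 (create W) 0 0 1 = (\<Sum>m<n. dinj m (elem (R m) (L m) (\<rho> m) (\<eta> m)))"
    and k: "k < n" and x: "x \<in> hcarrier (R k)"
  shows "app2 (runit (wr W) \<cdot> (id_two (wr W) \<star> compare W) \<cdot> assoc_inv (wr W) (wl W) (wr W)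
       \<cdot> (create W \<star> id_two (wr W)) \<cdot> lunit_inv (wr W)) 0 k x = pairing k (\<eta> k) x *\<^sub>C \<rho> k"
proof -
  let ?e = "\<lambda>m. dinj m (elem (R m) (L m) (\<rho> m) (\<eta> m))"
  have e: "?e m \<in> hcarrier M" if "m < n" for m using that by (intro M_elem \<rho> \<eta>)
  have "app2 (create W \<star> id_two (wr W)) 0 k (dinj 0 (elem hcomplex (R k) 1 x)) =
      dinj 0 (elem M (R k) (\<Sum>m<n. ?e m) x)"
    using hcomp_dinj[OF create one_cell_id rl two_cell_id wr wr, of 0 k 0 1 x] k x
    by (simp add: cr)
  also have "\<dots> = (\<Sum>m<n. dinj 0 (elem M (R k) (?e m) x))"
    by (rule lin_sum[OF lin_dinj[OF lin_elem_left[OF hilbert_M lin_id]] hilbert_subspace[OF hilbert_M]])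
      (use e in auto)
  finally have 1: "app2 (create W \<star> id_two (wr W)) 0 k (dinj 0 (elem hcomplex (R k) 1 x)) =
      (\<Sum>m<n. dinj 0 (elem M (R k) (?e m) x))" .
  let ?p = "\<lambda>m. dinj 0 (elem (L m) (R k) (\<eta> m) x)"
  have p: "?p m \<in> hcarrier (P m k)" if "m < n" for m using that k x by (intro P_elem \<eta>)
  have 2: "app2 (assoc_inv (wr W) (wl W) (wr W)) 0 k (\<Sum>m<n. dinj 0 (elem M (R k) (?e m) x)) =
      (\<Sum>m<n. dinj m (elem (R m) (P m k) (\<rho> m) (?p m)))"
    unfolding lin_sum[OF lin_assoc_inv cvec.subspace_UNIV UNIV_I]
    by (intro sum.cong assoc_inv_dinj[OF wr wl wr]) (use k x \<rho> \<eta> in auto)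
  have 3: "app2 (id_two (wr W) \<star> compare W) 0 k (\<Sum>m<n. dinj m (elem (R m) (P m k) (\<rho> m) (?p m))) =
      (\<Sum>m<n. dinj m (elem (R m) (ent (id_one n) m k) (app2 (id_two (wr W)) 0 m (\<rho> m))
        (app2 (compare W) m k (?p m))))"
    unfolding lin_sum[OF lin_hcomp cvec.subspace_UNIV UNIV_I]
    by (intro sum.cong hcomp_dinj[OF two_cell_id wr wr compare lr one_cell_id])
      (use k p \<rho> in auto)
  have 4: "app2 (runit (wr W)) 0 k
      (\<Sum>m<n. dinj m (elem (R m) (ent (id_one n) m k) (app2 (id_two (wr W)) 0 m (\<rho> m))
        (app2 (compare W) m k (?p m)))) = (\<Sum>m<n. if m = k then pairing k (\<eta> k) x *\<^sub>C \<rho> k else 0)"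
    unfolding lin_sum[OF lin_runit cvec.subspace_UNIV UNIV_I]
    by (intro sum.cong)
      (use k \<rho> in \<open>auto simp: runit_dinj[OF wr] runit_dinj_other pairing_def\<close>)
  show ?thesis
    unfolding app2_vcomp app2_lunit_inv 1 2 3 4 using k by simp
qed

lemma zigzag_copy_delete_right:
  assumes cp: "app2 (copy W) k k 1 = dinj 0 (elem (L k) (R k) (\<eta> k) (\<rho> k))"
    and k: "k < n" and x: "x \<in> hcarrier (R k)"
  shows "app2 (lunit (wr W) \<cdot> (delete W \<star> id_two (wr W)) \<cdot> assoc (wr W) (wl W) (wr W)
       \<cdot> (id_two (wr W) \<star> copy W) \<cdot> runit_inv (wr W)) 0 k x =
    app2 (delete W) 0 0 (dinj k (elem (R k) (L k) x (\<eta> k))) *\<^sub>C \<rho> k"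
proof -
  have 1: "app2 (id_two (wr W) \<star> copy W) 0 k (dinj k (elem (R k) hcomplex x 1)) =
      dinj k (elem (R k) (P k k) x (dinj 0 (elem (L k) (R k) (\<eta> k) (\<rho> k))))"
    using hcomp_dinj[OF two_cell_id wr wr copy one_cell_id lr, of 0 k k x 1] k x
    by (simp add: cp)
  let ?m = "dinj k (elem (R k) (L k) x (\<eta> k))"
  have m: "?m \<in> hcarrier M" by (rule M_elem[OF k x \<eta>[OF k]])
  have 2: "app2 (assoc (wr W) (wl W) (wr W)) 0 k
      (dinj k (elem (R k) (P k k) x (dinj 0 (elem (L k) (R k) (\<eta> k) (\<rho> k))))) =
    dinj 0 (elem M (R k) ?m (\<rho> k))"
    by (rule assoc_dinj[OF wr wl wr]) (use k x \<rho> \<eta> in auto)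
  have 3: "app2 (delete W \<star> id_two (wr W)) 0 k (dinj 0 (elem M (R k) ?m (\<rho> k))) =
      dinj 0 (elem hcomplex (R k) (app2 (delete W) 0 0 ?m) (\<rho> k))"
    using hcomp_dinj[OF delete rl one_cell_id two_cell_id wr wr, of 0 k 0 ?m "\<rho> k"] k m \<rho> by simp
  show ?thesis
    unfolding app2_vcomp app2_runit_inv 1 2 3
    by (rule lunit_dinj[OF wr]) (use k \<rho> in auto)
qed

lemma zigzag_copy_delete_left:
  assumes cp: "app2 (copy W) k k 1 = dinj 0 (elem (L k) (R k) (\<eta> k) (\<rho> k))"
    and k: "k < n" and x: "x \<in> hcarrier (L k)"
  shows "app2 (runit (wl W) \<cdot> (id_two (wl W) \<star> delete W) \<cdot> assoc_inv (wl W) (wr W) (wl W)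
       \<cdot> (copy W \<star> id_two (wl W)) \<cdot> lunit_inv (wl W)) k 0 x =
    app2 (delete W) 0 0 (dinj k (elem (R k) (L k) (\<rho> k) x)) *\<^sub>C \<eta> k"
proof -
  have 1: "app2 (copy W \<star> id_two (wl W)) k 0 (dinj k (elem hcomplex (L k) 1 x)) =
      dinj k (elem (P k k) (L k) (dinj 0 (elem (L k) (R k) (\<eta> k) (\<rho> k))) x)"
    using hcomp_dinj[OF copy one_cell_id lr two_cell_id wl wl, of k 0 k 1 x] k x
    by (simp add: cp)
  let ?m = "dinj k (elem (R k) (L k) (\<rho> k) x)"
  have m: "?m \<in> hcarrier M" by (rule M_elem[OF k \<rho>[OF k] x])
  have 2: "app2 (assoc_inv (wl W) (wr W) (wl W)) k 0
      (dinj k (elem (P k k) (L k) (dinj 0 (elem (L k) (R k) (\<eta> k) (\<rho> k))) x)) =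
    dinj 0 (elem (L k) M (\<eta> k) ?m)"
    by (rule assoc_inv_dinj[OF wl wr wl]) (use k x \<rho> \<eta> in auto)
  have 3: "app2 (id_two (wl W) \<star> delete W) k 0 (dinj 0 (elem (L k) M (\<eta> k) ?m)) =
      dinj 0 (elem (L k) hcomplex (\<eta> k) (app2 (delete W) 0 0 ?m))"
    using hcomp_dinj[OF two_cell_id wl wl delete rl one_cell_id, of k 0 0 "\<eta> k" ?m] k m \<eta> by simp
  show ?thesis
    unfolding app2_vcomp app2_lunit_inv 1 2 3
    by (rule runit_dinj[OF wl]) (use k \<eta> in auto)
qed

end

end


subsection \<open>Lines\<close>

text \<open>A line is handled through a unit vector \<open>e\<close> spanning it, as the orthonormal basis \<open>{e}\<close>.\<close>

lemma line_iff: "orthonormal_basis H {e} \<longleftrightarrow> cvec.span {e} = hcarrier H \<and> hinner H e e = 1"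
  by (simp add: orthonormal_basis_def)

lemma line_carrier: "orthonormal_basis H {e} \<Longrightarrow> e \<in> hcarrier H"
  using cvec.span_base[of e "{e}"] by (simp add: line_iff)

lemma line_inner: "orthonormal_basis H {e} \<Longrightarrow> hinner H e e = 1"
  by (simp add: line_iff)

lemma line_expansion:
  "hilbert_space H \<Longrightarrow> orthonormal_basis H {e} \<Longrightarrow> x \<in> hcarrier H \<Longrightarrow> hinner H e x *\<^sub>C e = x"
  using orthonormal_expansion[of H "{e}" x] by simp

lemma line_exists:
  assumes H: "hilbert_space H" and x: "x \<in> hcarrier H" "x \<noteq> 0"
    and multiple: "\<And>y. y \<in> hcarrier H \<Longrightarrow> \<exists>a. y = a *\<^sub>C x"
  shows "\<exists>e. orthonormal_basis H {e}"
proof -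
  obtain a where a: "a \<noteq> 0" "hinner H (a *\<^sub>C x) (a *\<^sub>C x) = 1"
    by (rule inner_self_normalize[OF H x])
  have "hcarrier H \<subseteq> range (\<lambda>c. c *\<^sub>C a *\<^sub>C x)"
  proof
    fix y assume "y \<in> hcarrier H"
    then obtain b where "y = b *\<^sub>C x" using multiple by blast
    then have "y = (b / a) *\<^sub>C a *\<^sub>C x" using a by (simp add: scaleC_scaleC)
    then show "y \<in> range (\<lambda>c. c *\<^sub>C a *\<^sub>C x)" by blast
  qed
  moreover have "range (\<lambda>c. c *\<^sub>C a *\<^sub>C x) \<subseteq> hcarrier H"
    using carrier_scale[OF H carrier_scale[OF H x(1)]] by blast
  ultimately have "cvec.span {a *\<^sub>C x} = hcarrier H"
    unfolding cvec.span_singleton by blast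
  with a show ?thesis unfolding line_iff by blast
qed

lemma line_tensor:
  assumes H: "hilbert_space H" and K: "hilbert_space K"
    and e: "orthonormal_basis H {e}" and f: "orthonormal_basis K {f}"
  shows "orthonormal_basis (tensor H K) {elem H K e f}"
proof -
  have "hcarrier (tensor H K) = cvec.span {elem H K a b | a b. a \<in> {e} \<and> b \<in> {f}}"
    by (rule tensor_span[OF H K]) (use e f in \<open>simp_all add: line_iff\<close>)
  then have "cvec.span {elem H K e f} = hcarrier (tensor H K)" by simp
  then show ?thesis
    using assms by (simp add: line_iff inner_elem_elem[OF H K] line_carrier line_inner)
qed

lemma line_hcomplex: "orthonormal_basis hcomplex {1}"
  by (simp add: line_iff cvec.span_singleton)

lemma elem_eq_zero:
  assumes "hilbert_space H" "hilbert_space K" "h \<in> hcarrier H" "k \<in> hcarrier K" "elem H K h k = 0"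
  shows "h = 0 \<or> k = 0"
proof -
  have "elem H K h k h k = 0" using assms(5) by simp
  then have "hinner H h h * hinner K k k = 0" using assms by (simp add: elem_def)
  then have "hinner H h h = 0 \<or> hinner K k k = 0" by simp
  then show ?thesis
    using inner_self_eq_zero[OF assms(1,3)] inner_self_eq_zero[OF assms(2,4)] by blast
qed


subsection \<open>The normal form of a witness\<close>

lemma UN_less_one: "(\<Union>k<1::nat. A k) = A 0"
  by (simp add: lessThan_Suc)

lemma swap_elem:
  assumes X: "one_cell 1 1 X" and Y: "one_cell 1 1 Y"
    and x: "x \<in> hcarrier (ent X 0 0)" and y: "y \<in> hcarrier (ent Y 0 0)"
  shows "app2 (swap_scalars X Y) i j (dinj 0 (elem (ent X 0 0) (ent Y 0 0) x y)) =
    dinj 0 (elem (ent Y 0 0) (ent X 0 0) y x)"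
proof -
  have X': "hilbert_space (ent X 0 0)" and Y': "hilbert_space (ent Y 0 0)"
    using one_cell_hilbert[OF X, of 0 0] one_cell_hilbert[OF Y, of 0 0] by simp_all
  have "bilin (ent X 0 0) (ent Y 0 0) (\<lambda>x y. elem (ent Y 0 0) (ent X 0 0) y x)"
    by (intro bilinI lin_elem_left[OF Y' lin_id] lin_elem_right[OF X' lin_id])
  then show ?thesis
    by (simp add: swap_scalars_def lift_elem[OF X' Y' _ x y])
qed

lemma lin_swap: "lin UNIV (app2 (swap_scalars X Y) i j)"
  unfolding swap_scalars_def twocell.simps by (intro lin_dinj lin_lift_arg lin_proj)

lemma lin_wmult: "lin UNIV (app2 (wmult W) i j)"
proof -
  have "lin UNIV (\<lambda>x. app2 (runit (wr W) \<star> id_two (wl W)) i j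
    (app2 ((id_two (wr W) \<star> compare W) \<star> id_two (wl W)) i j
      (app2 (assoc_inv (wr W) (wl W) (wr W) \<star> id_two (wl W)) i j
        (app2 (assoc (wr W \<odot> wl W) (wr W) (wl W)) i j x))))"
    by (intro lin_compose[OF lin_hcomp] lin_assoc UNIV_I)
  then show ?thesis by (simp add: wmult_def vcomp_def)
qed

text \<open>
  A witness turns out to be a choice of a unit vector in every entry of its two 1-cells, these
  entries being lines; create and copy are the sums of the elementary tensors of these vectors.
\<close>

locale witness_basis = witness_data n W
  for n and W :: "('l::complex_vector, 'r::complex_vector) witness" +
  fixes r :: "nat \<Rightarrow> 'r" and l :: "nat \<Rightarrow> 'l"
  assumes r: "k < n \<Longrightarrow> orthonormal_basis (ent (wr W) 0 k) {r k}"
    and l: "k < n \<Longrightarrow> orthonormal_basis (ent (wl W) k 0) {l k}"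
    and create_one: "app2 (create W) 0 0 1 =
      (\<Sum>m<n. dinj m (elem (ent (wr W) 0 m) (ent (wl W) m 0) (r m) (l m)))"
    and copy_one: "k < n \<Longrightarrow>
      app2 (copy W) k k 1 = dinj 0 (elem (ent (wl W) k 0) (ent (wr W) 0 k) (l k) (r k))"
begin

lemma r_carrier: "k < n \<Longrightarrow> r k \<in> hcarrier (R k)"
  and l_carrier: "k < n \<Longrightarrow> l k \<in> hcarrier (L k)"
  using r l line_carrier by blast+

lemma pairing_eq:
  assumes k: "k < n" and x: "x \<in> hcarrier (L k)" and y: "y \<in> hcarrier (R k)"
  shows "pairing k x y = hinner (L k) (l k) x * hinner (R k) (r k) y"
proof -
  have "pairing k x y = hinner (P k k) (dinj 0 (elem (L k) (R k) (l k) (r k)))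
      (dinj 0 (elem (L k) (R k) x y))"
    unfolding pairing_def compare_eq_inner[OF k P_elem[OF k k x y]] copy_one[OF k] ..
  also have "\<dots> = hinner (tensor (L k) (R k)) (elem (L k) (R k) (l k) (r k)) (elem (L k) (R k) x y)"
    unfolding P_dsum using P_elem[OF k k x y] hilbert_summands(2)[OF k k]
    by (subst inner_dinj) (auto simp: P_dsum)
  also have "\<dots> = hinner (L k) (l k) x * hinner (R k) (r k) y"
    by (intro inner_elem_elem hilbert_L hilbert_R k l_carrier r_carrier x y)
  finally show ?thesis .
qed

lemma delete_elem:
  assumes k: "k < n" and x: "x \<in> hcarrier (R k)" and y: "y \<in> hcarrier (L k)"
  shows "app2 (delete W) 0 0 (dinj k (elem (R k) (L k) x y)) =
    hinner (R k) (r k) x * hinner (L k) (l k) y"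
proof -
  have "app2 (delete W) 0 0 (dinj k (elem (R k) (L k) x y)) =
      hinner M (app2 (create W) 0 0 1) (dinj k (elem (R k) (L k) x y))"
    by (rule delete_eq_inner[OF M_elem[OF k x y]])
  also have "\<dots> = hinner (tensor (R k) (L k)) (app2 (create W) 0 0 1 k) (elem (R k) (L k) x y)"
    unfolding M_dsum
    by (rule inner_dinj_right[OF hilbert_summands(1) k]) (use create_one_carrier M_dsum in simp)
  also have "app2 (create W) 0 0 1 k = elem (R k) (L k) (r k) (l k)"
    unfolding create_one by (rule sum_dinj_apply[OF k])
  also have "hinner (tensor (R k) (L k)) \<dots> (elem (R k) (L k) x y) =
      hinner (R k) (r k) x * hinner (L k) (l k) y"
    by (intro inner_elem_elem hilbert_L hilbert_R k l_carrier r_carrier x y)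
  finally show ?thesis .
qed

lemma M_span: "hcarrier M = cvec.span {dinj k (elem (R k) (L k) (r k) (l k)) | k. k < n}"
proof -
  have "hcarrier (tensor (R k) (L k)) = cvec.span {elem (R k) (L k) (r k) (l k)}" if "k < n" for k
    using line_tensor[OF hilbert_R hilbert_L r l] that by (simp add: line_iff)
  then have "hcarrier M = cvec.span (\<Union>k<n. dinj k ` {elem (R k) (L k) (r k) (l k)})"
    unfolding M_dsum by (rule dsum_span[OF hilbert_summands(1)])
  moreover have "(\<Union>k<n. dinj k ` {elem (R k) (L k) (r k) (l k)}) =
      {dinj k (elem (R k) (L k) (r k) (l k)) | k. k < n}" by blast
  ultimately show ?thesis by simp
qed

text \<open>
  Both sides are linear, and the source is spanned by tensors of two generators of \<open>M\<close>. These
  multiply to zero in either order if they lie in different summands; each summand has only one.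
\<close>

lemma wmult_commutative: "wmult W \<cdot> swap_scalars (wr W \<odot> wl W) (wr W \<odot> wl W) \<approx> wmult W"
proof (rule cell_eqI)
  show "one_cell 1 1 ((wr W \<odot> wl W) \<odot> (wr W \<odot> wl W))" by (rule one_cell_comp[OF rl rl])
  let ?S = "swap_scalars (wr W \<odot> wl W) (wr W \<odot> wl W)"
  let ?B = "{dinj k (elem (R k) (L k) (r k) (l k)) | k. k < n}"
  let ?T = "{elem M M a b | a b. a \<in> ?B \<and> b \<in> ?B}"
  have "hcarrier (ent ((wr W \<odot> wl W) \<odot> (wr W \<odot> wl W)) 0 0) =
      hcarrier (dsum 1 (\<lambda>k. tensor (ent (wr W \<odot> wl W) 0 k) (ent (wr W \<odot> wl W) k 0)))"
    unfolding ent_one_comp[of "wr W \<odot> wl W" "wr W \<odot> wl W"] one_cell_src[OF rl] ..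
  also have "\<dots> = cvec.span (\<Union>k<1. dinj k ` ?T)"
  proof (rule dsum_span)
    fix k :: nat assume "k < 1"
    then have "k = 0" by simp
    show "hcarrier (tensor (ent (wr W \<odot> wl W) 0 k) (ent (wr W \<odot> wl W) k 0)) = cvec.span ?T"
      unfolding \<open>k = 0\<close> by (rule tensor_span[OF hilbert_M hilbert_M M_span M_span])
  qed (simp add: hilbert_space_tensor hilbert_M)
  also have "\<dots> = cvec.span (dinj 0 ` ?T)"
    by (rule arg_cong[where f=cvec.span]) (rule UN_less_one)
  finally have sp: "hcarrier (ent ((wr W \<odot> wl W) \<odot> (wr W \<odot> wl W)) 0 0) = cvec.span (dinj 0 ` ?T)" .
  fix i j :: nat and x assume "i < 1" "j < 1"
    and x: "x \<in> hcarrier (ent ((wr W \<odot> wl W) \<odot> (wr W \<odot> wl W)) i j)"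
  then have ij: "i = 0" "j = 0" by auto
  have "app2 (wmult W) 0 0 (app2 ?S 0 0 x) = app2 (wmult W) 0 0 x"
  proof (rule lin_eq_on_span[where f="\<lambda>x. app2 (wmult W) 0 0 (app2 ?S 0 0 x)" and
        g="app2 (wmult W) 0 0"])
    show "lin (cvec.span (dinj 0 ` ?T)) (\<lambda>x. app2 (wmult W) 0 0 (app2 ?S 0 0 x))"
      by (rule lin_mono[OF lin_compose[OF lin_wmult lin_swap UNIV_I]])
    show "lin (cvec.span (dinj 0 ` ?T)) (app2 (wmult W) 0 0)"
      by (rule lin_mono[OF lin_wmult])
    show "x \<in> cvec.span (dinj 0 ` ?T)" using x unfolding ij sp .
  next
    fix x assume "x \<in> dinj 0 ` ?T"
    then obtain k k' where k: "k < n" "k' < n" and x: "x = dinj 0 (elem M M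
        (dinj k (elem (R k) (L k) (r k) (l k))) (dinj k' (elem (R k') (L k') (r k') (l k'))))"
      by blast
    have "app2 ?S 0 0 x = dinj 0 (elem M M
        (dinj k' (elem (R k') (L k') (r k') (l k'))) (dinj k (elem (R k) (L k) (r k) (l k))))"
      unfolding x using k by (intro swap_elem[OF rl rl] M_elem r_carrier l_carrier)
    then show "app2 (wmult W) 0 0 (app2 ?S 0 0 x) = app2 (wmult W) 0 0 x"
      unfolding x using k by (simp add: mult_elem r_carrier l_carrier)
  qed
  then show "app2 (wmult W \<cdot> ?S) i j x = app2 (wmult W) i j x" by (simp add: ij)
qed (simp_all add: wmult_def swap_scalars_def)

text \<open>Each zigzag equation reduces to the expansion of a vector of a line in its unit vector.\<close>

theorem is_witness: "is_witness n W"
  unfolding is_witness_def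
proof (intro conjI)
  show "one_cell 1 n (wl W)" "one_cell n 1 (wr W)" by (rule wl wr)+
  show "two_cell (id_one 1) (wr W \<odot> wl W) (create W)"
    "two_cell (id_one n) (wl W \<odot> wr W) (copy W)" by (rule create copy)+
  show "wmult W \<cdot> swap_scalars (wr W \<odot> wl W) (wr W \<odot> wl W) \<approx> wmult W"
    by (rule wmult_commutative)
  note zz = r_carrier l_carrier
  show "lunit (wl W) \<cdot> (compare W \<star> id_two (wl W)) \<cdot> assoc (wl W) (wr W) (wl W)
       \<cdot> (id_two (wl W) \<star> create W) \<cdot> runit_inv (wl W) \<approx> id_two (wl W)" (is "?z \<approx> _")
  proof (rule cell_eqI[OF _ _ _ wl])
    fix i j x assume "i < n" "j < (1::nat)" and x: "x \<in> hcarrier (ent (wl W) i j)"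
    then have ij: "j = 0" "i < n" by auto
    have "app2 ?z i 0 x = pairing i x (r i) *\<^sub>C l i"
      by (rule zigzag_create_compare_left[OF zz create_one]) (use ij x in auto)
    also have "\<dots> = x"
      using ij x by (simp add: pairing_eq r_carrier line_inner[OF r] line_expansion[OF hilbert_L l])
    finally show "app2 ?z i j x = app2 (id_two (wl W)) i j x" by (simp add: ij)
  qed simp_all
  show "runit (wr W) \<cdot> (id_two (wr W) \<star> compare W) \<cdot> assoc_inv (wr W) (wl W) (wr W)
       \<cdot> (create W \<star> id_two (wr W)) \<cdot> lunit_inv (wr W) \<approx> id_two (wr W)" (is "?z \<approx> _")
  proof (rule cell_eqI[OF _ _ _ wr])
    fix i j x assume "i < (1::nat)" "j < n" and x: "x \<in> hcarrier (ent (wr W) i j)"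
    then have ij: "i = 0" "j < n" by auto
    have "app2 ?z 0 j x = pairing j (l j) x *\<^sub>C r j"
      by (rule zigzag_create_compare_right[OF zz create_one]) (use ij x in auto)
    also have "\<dots> = x"
      using ij x by (simp add: pairing_eq l_carrier line_inner[OF l] line_expansion[OF hilbert_R r])
    finally show "app2 ?z i j x = app2 (id_two (wr W)) i j x" by (simp add: ij)
  qed simp_all
  show "lunit (wr W) \<cdot> (delete W \<star> id_two (wr W)) \<cdot> assoc (wr W) (wl W) (wr W)
       \<cdot> (id_two (wr W) \<star> copy W) \<cdot> runit_inv (wr W) \<approx> id_two (wr W)" (is "?z \<approx> _")
  proof (rule cell_eqI[OF _ _ _ wr])
    fix i j x assume "i < (1::nat)" "j < n" and x: "x \<in> hcarrier (ent (wr W) i j)"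
    then have ij: "i = 0" "j < n" by auto
    have "app2 ?z 0 j x = app2 (delete W) 0 0 (dinj j (elem (R j) (L j) x (l j))) *\<^sub>C r j"
      by (rule zigzag_copy_delete_right[OF zz copy_one]) (use ij x in auto)
    also have "\<dots> = x"
      using ij x by (simp add: delete_elem l_carrier line_inner[OF l] line_expansion[OF hilbert_R r])
    finally show "app2 ?z i j x = app2 (id_two (wr W)) i j x" by (simp add: ij)
  qed simp_all
  show "runit (wl W) \<cdot> (id_two (wl W) \<star> delete W) \<cdot> assoc_inv (wl W) (wr W) (wl W)
       \<cdot> (copy W \<star> id_two (wl W)) \<cdot> lunit_inv (wl W) \<approx> id_two (wl W)" (is "?z \<approx> _")
  proof (rule cell_eqI[OF _ _ _ wl])
    fix i j x assume "i < n" "j < (1::nat)" and x: "x \<in> hcarrier (ent (wl W) i j)"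
    then have ij: "j = 0" "i < n" by auto
    have "app2 ?z i 0 x = app2 (delete W) 0 0 (dinj i (elem (R i) (L i) (r i) x)) *\<^sub>C l i"
      by (rule zigzag_copy_delete_left[OF zz copy_one]) (use ij x in auto)
    also have "\<dots> = x"
      using ij x by (simp add: delete_elem r_carrier line_inner[OF r] line_expansion[OF hilbert_L l])
    finally show "app2 ?z i j x = app2 (id_two (wl W)) i j x" by (simp add: ij)
  qed simp_all
  show "compare W \<cdot> copy W \<approx> id_two (id_one n)"
  proof (rule cell_eqI[OF _ _ _ one_cell_id])
    fix i j x assume ij: "i < n" "j < n" and x: "x \<in> hcarrier (ent (id_one n) i j)"
    have lc: "lin (hcarrier (ent (id_one n) i j)) (app2 (compare W \<cdot> copy W) i j)"
      unfolding app2_vcomp[abs_def]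
      by (rule lin_compose[OF two_cell_lin[OF compare lr ij] two_cell_lin[OF copy one_cell_id ij]])
        (rule two_cell_carrier[OF copy one_cell_id ij])
    show "app2 (compare W \<cdot> copy W) i j x = app2 (id_two (id_one n)) i j x"
    proof (cases "i = j")
      case True
      have "app2 (compare W \<cdot> copy W) i i x = x *\<^sub>C app2 (compare W \<cdot> copy W) i i 1"
        using lin_scale[OF lc, of 1 x] True by simp
      also have "app2 (compare W \<cdot> copy W) i i 1 = 1"
        using ij pairing_eq[OF ij(1) l_carrier r_carrier]
        by (simp add: copy_one line_inner[OF l] line_inner[OF r] flip: pairing_def)
      finally show ?thesis using True by simp
    next
      case False
      then have "x = 0" using x by simp
      then show ?thesis
        using lin_zero[OF lc hilbert_subspace[OF one_cell_hilbert[OF one_cell_id ij]]] by simp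
    qed
  qed (simp_all add: two_cell_dom[OF copy] two_cell_cod[OF compare])
qed

end

text \<open>
  The decisive point is commutativity. Applied to \<open>r \<otimes> l\<close> and \<open>r' \<otimes> l'\<close> in the same summand
  it reads \<open>pairing l r' (r \<otimes> l') = pairing l' r (r' \<otimes> l)\<close>; if one fixes a pair with nonzero
  pairing, which exists because compare is a left inverse of copy, then every \<open>r\<close> and every \<open>l'\<close>
  is a multiple of a fixed vector. This is the argument that a matrix algebra is commutative only
  for matrices of size one.
\<close>

lemma (in witness_data) lines_of_witness:
  assumes W: "is_witness n W" and k: "k < n"
  shows "\<exists>r l. orthonormal_basis (R k) {r} \<and> orthonormal_basis (L k) {l}"
proof -
  note LR = hilbert_L[OF k] hilbert_R[OF k]
  have comm: "wmult W \<cdot> swap_scalars (wr W \<odot> wl W) (wr W \<odot> wl W) \<approx> wmult W"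
    and special: "compare W \<cdot> copy W \<approx> id_two (id_one n)"
    using W by (auto simp: is_witness_def)
  have exchange: "pairing k l r' *\<^sub>C elem (R k) (L k) r l' = pairing k l' r *\<^sub>C elem (R k) (L k) r' l"
    if r: "r \<in> hcarrier (R k)" "r' \<in> hcarrier (R k)" and l: "l \<in> hcarrier (L k)" "l' \<in> hcarrier (L k)"
    for r r' l l'
  proof -
    let ?a = "dinj k (elem (R k) (L k) r l)" and ?b = "dinj k (elem (R k) (L k) r' l')"
    have ab: "?a \<in> hcarrier M" "?b \<in> hcarrier M" by (intro M_elem k r l)+
    have "dinj 0 (elem M M ?a ?b) \<in> hcarrier (ent ((wr W \<odot> wl W) \<odot> (wr W \<odot> wl W)) 0 0)"
      by (rule comp_elem_carrier[OF rl rl]) (use ab in auto)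
    then have "app2 (wmult W \<cdot> swap_scalars (wr W \<odot> wl W) (wr W \<odot> wl W)) 0 0 (dinj 0 (elem M M ?a ?b)) =
        app2 (wmult W) 0 0 (dinj 0 (elem M M ?a ?b))"
      by (intro cell_eqD[OF comm _ one_cell_comp[OF rl rl]]) (simp_all add: swap_scalars_def)
    then have "app2 (wmult W) 0 0 (dinj 0 (elem M M ?b ?a)) = app2 (wmult W) 0 0 (dinj 0 (elem M M ?a ?b))"
      by (simp add: swap_elem[OF rl rl ab])
    then have "(pairing k l' r *\<^sub>C dinj k (elem (R k) (L k) r' l)) k =
        (pairing k l r' *\<^sub>C dinj k (elem (R k) (L k) r l')) k"
      using k r l by (simp add: mult_elem)
    then show ?thesis by simp
  qed
  have lin_pairing: "lin (hcarrier (tensor (L k) (R k))) (\<lambda>t. app2 (compare W) k k (dinj 0 t))"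
    by (rule lin_compose[OF two_cell_lin[OF compare lr k k] lin_dinj[OF lin_id]])
      (intro P_carrier k)
  have "\<exists>l\<in>hcarrier (L k). \<exists>r\<in>hcarrier (R k). pairing k l r \<noteq> 0"
  proof (rule ccontr)
    assume "\<not> ?thesis"
    then have zero: "pairing k l r = 0" if "l \<in> hcarrier (L k)" "r \<in> hcarrier (R k)" for l r
      using that by blast
    let ?v = "app2 (copy W) k k 1"
    have v: "?v \<in> hcarrier (dsum 1 (\<lambda>j. tensor (ent (wl W) k j) (ent (wr W) j k)))"
      using copy_one_carrier[OF k] by (simp add: P_dsum)
    then have v0: "?v 0 \<in> hcarrier (tensor (L k) (R k))" by (simp add: dsum_carrier)
    have vd: "?v = dinj 0 (?v 0)" using dsum_sum_dinj[OF v] by simp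
    have "app2 (compare W) k k (dinj 0 (?v 0)) = 0"
    proof (rule lin_eq_on_span[where f="\<lambda>t. app2 (compare W) k k (dinj 0 t)" and g="\<lambda>_. 0"])
      show "?v 0 \<in> cvec.span {elem (L k) (R k) h k' | h k'. h \<in> hcarrier (L k) \<and> k' \<in> hcarrier (R k)}"
        using v0 by (simp add: tensor_def)
      show "lin (cvec.span {elem (L k) (R k) h k' | h k'. h \<in> hcarrier (L k) \<and> k' \<in> hcarrier (R k)})
          (\<lambda>t. app2 (compare W) k k (dinj 0 t))"
        using lin_pairing by (simp add: tensor_def)
    qed (use zero in \<open>auto simp: pairing_def lin_const_zero\<close>)
    then have "app2 (compare W \<cdot> copy W) k k 1 = 0" using vd by simp
    moreover have "app2 (compare W \<cdot> copy W) k k 1 = app2 (id_two (id_one n)) k k 1"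
      by (rule cell_eqD[OF special _ one_cell_id k k]) (simp_all add: two_cell_dom[OF copy])
    ultimately show False by simp
  qed
  then obtain l0 r0 where l0: "l0 \<in> hcarrier (L k)" and r0: "r0 \<in> hcarrier (R k)"
    and p: "pairing k l0 r0 \<noteq> 0" by blast
  have p0: "app2 (compare W) k k (dinj 0 0) = 0"
    using lin_zero[OF lin_pairing subspace_tensor] .
  have "l0 \<noteq> 0" using p p0 elem_zero_left[OF LR(1), of "R k" r0] by (auto simp: pairing_def)
  have "r0 \<noteq> 0" using p p0 elem_zero_right[OF LR(2), of "L k" l0] by (auto simp: pairing_def)
  have L: "\<exists>a. l' = a *\<^sub>C l0" if l': "l' \<in> hcarrier (L k)" for l'
  proof -
    let ?p = "pairing k l0 r0" and ?q = "pairing k l' r0"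
    have "elem (R k) (L k) r0 (?p *\<^sub>C l' - ?q *\<^sub>C l0) = 0"
      using exchange[OF r0 r0 l0 l'] l' l0 LR
      by (simp add: lin_diff[OF lin_elem_right[OF LR(1) lin_id] hilbert_subspace[OF LR(1)]]
          carrier_scale elem_scale_right)
    then have "?p *\<^sub>C l' = ?q *\<^sub>C l0"
      using elem_eq_zero[OF LR(2,1) r0, of "?p *\<^sub>C l' - ?q *\<^sub>C l0"] l' l0 \<open>r0 \<noteq> 0\<close> LR
      by (simp add: carrier_diff carrier_scale)
    then have "(1 / ?p) *\<^sub>C ?p *\<^sub>C l' = (1 / ?p) *\<^sub>C ?q *\<^sub>C l0" by simp
    then show ?thesis using p by (auto simp: scaleC_scaleC scaleC_one)
  qed
  have R: "\<exists>a. r' = a *\<^sub>C r0" if r': "r' \<in> hcarrier (R k)" for r'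
  proof -
    let ?p = "pairing k l0 r0" and ?q = "pairing k l0 r'"
    have "elem (R k) (L k) (?p *\<^sub>C r' - ?q *\<^sub>C r0) l0 = 0"
      using exchange[OF r' r0 l0 l0] r' r0 LR
      by (simp add: lin_diff[OF lin_elem_left[OF LR(2) lin_id] hilbert_subspace[OF LR(2)]]
          carrier_scale elem_scale_left)
    then have "?p *\<^sub>C r' = ?q *\<^sub>C r0"
      using elem_eq_zero[OF LR(2,1) _ l0, of "?p *\<^sub>C r' - ?q *\<^sub>C r0"] r' r0 \<open>l0 \<noteq> 0\<close> LR
      by (simp add: carrier_diff carrier_scale)
    then have "(1 / ?p) *\<^sub>C ?p *\<^sub>C r' = (1 / ?p) *\<^sub>C ?q *\<^sub>C r0" by simp
    then show ?thesis using p by (auto simp: scaleC_scaleC scaleC_one)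
  qed
  show ?thesis
    using line_exists[OF LR(2) r0 \<open>r0 \<noteq> 0\<close> R] line_exists[OF LR(1) l0 \<open>l0 \<noteq> 0\<close> L] by blast
qed


lemma line_scale:
  assumes H: "hilbert_space H" and e: "orthonormal_basis H {e}" and c: "c * cnj c = 1"
  shows "orthonormal_basis H {c *\<^sub>C e}"
proof -
  have c0: "c \<noteq> 0" using c by auto
  have "range (\<lambda>a. a *\<^sub>C c *\<^sub>C e) = range (\<lambda>a. a *\<^sub>C e)"
  proof (intro equalityI subsetI)
    fix x assume "x \<in> range (\<lambda>a. a *\<^sub>C e)"
    then obtain a where "x = a *\<^sub>C e" by blast
    then have "x = (a / c) *\<^sub>C c *\<^sub>C e" using c0 by (simp add: scaleC_scaleC)
    then show "x \<in> range (\<lambda>a. a *\<^sub>C c *\<^sub>C e)" by blast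
  qed (auto simp: scaleC_scaleC)
  then have "cvec.span {c *\<^sub>C e} = hcarrier H"
    using e by (simp add: line_iff cvec.span_singleton)
  moreover have "hinner H (c *\<^sub>C e) (c *\<^sub>C e) = 1"
    using H line_carrier[OF e] line_inner[OF e] c
    by (simp add: inner_scale_left inner_scale_right carrier_scale mult.commute)
  ultimately show ?thesis by (simp add: line_iff)
qed

text \<open>
  Once the entries are lines, create and copy are determined by a scalar \<open>\<gamma>\<close> and \<open>\<delta>\<close> in each
  summand. That compare inverts copy says \<open>\<delta> \<delta>\<^sup>* = 1\<close>, and the first zigzag equation says
  \<open>\<gamma> \<delta>\<^sup>* = 1\<close>. Hence \<open>\<gamma> = \<delta>\<close> is a phase, which may be absorbed into one of the unit vectors.
\<close>

theorem witness_basis_exists: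
  fixes W :: "('l::complex_vector, 'r::complex_vector) witness"
  assumes W: "is_witness n W"
  shows "\<exists>r l. witness_basis n W r l"
proof -
  interpret witness_data n W
    using W by unfold_locales (simp_all add: is_witness_def)
  have "\<forall>k. \<exists>p. k < n \<longrightarrow> orthonormal_basis (R k) {fst p} \<and> orthonormal_basis (L k) {snd p}"
    using lines_of_witness[OF W] by (metis fst_conv snd_conv)
  then obtain p where p: "\<And>k. k < n \<Longrightarrow>
      orthonormal_basis (R k) {fst (p k)} \<and> orthonormal_basis (L k) {snd (p k)}"
    by metis
  define r l where "r = (\<lambda>k. fst (p k))" and "l = (\<lambda>k. snd (p k))"
  have r: "orthonormal_basis (R k) {r k}" and l: "orthonormal_basis (L k) {l k}" if "k < n" for k
    using p[OF that] by (simp_all add: r_def l_def)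
  note rc = line_carrier[OF r] and lc = line_carrier[OF l]
  define \<gamma> where "\<gamma> k = hinner (tensor (R k) (L k)) (elem (R k) (L k) (r k) (l k))
    (app2 (create W) 0 0 1 k)" for k
  define \<delta> where "\<delta> k = hinner (tensor (L k) (R k)) (elem (L k) (R k) (l k) (r k))
    (app2 (copy W) k k 1 0)" for k
  define \<rho> where "\<rho> k = \<gamma> k *\<^sub>C r k" for k
  have \<rho>c: "\<rho> k \<in> hcarrier (R k)" if "k < n" for k
    unfolding \<rho>_def by (rule carrier_scale[OF hilbert_R[OF that] rc[OF that]])
  have "app2 (create W) 0 0 1 k = elem (R k) (L k) (\<rho> k) (l k)" if k: "k < n" for k
  proof -
    have "app2 (create W) 0 0 1 k \<in> hcarrier (tensor (R k) (L k))"
      using create_one_carrier k by (simp add: M_dsum dsum_carrier)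
    from line_expansion[OF hilbert_space_tensor[OF hilbert_R hilbert_L] line_tensor[OF hilbert_R hilbert_L r l] this]
    show ?thesis
      using k by (simp add: \<rho>_def \<gamma>_def elem_scale_left[OF hilbert_R rc])
  qed
  moreover have "app2 (create W) 0 0 1 = (\<Sum>m<n. dinj m (app2 (create W) 0 0 1 m))"
    using create_one_carrier unfolding M_dsum by (simp only: dsum_sum_dinj)
  ultimately have create1: "app2 (create W) 0 0 1 = (\<Sum>m<n. dinj m (elem (R m) (L m) (\<rho> m) (l m)))"
    by simp
  have copy1: "app2 (copy W) k k 1 = dinj 0 (\<delta> k *\<^sub>C elem (L k) (R k) (l k) (r k))" if k: "k < n" for k
  proof -
    have v: "app2 (copy W) k k 1 \<in> hcarrier (dsum 1 (\<lambda>j. tensor (ent (wl W) k j) (ent (wr W) j k)))"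
      using copy_one_carrier[OF k] by (simp add: P_dsum)
    then have v0: "app2 (copy W) k k 1 0 \<in> hcarrier (tensor (L k) (R k))" by (simp add: dsum_carrier)
    have "app2 (copy W) k k 1 = dinj 0 (app2 (copy W) k k 1 0)" using dsum_sum_dinj[OF v] by simp
    also have "app2 (copy W) k k 1 0 = \<delta> k *\<^sub>C elem (L k) (R k) (l k) (r k)"
      unfolding \<delta>_def
      using line_expansion[OF hilbert_space_tensor[OF hilbert_L hilbert_R]
          line_tensor[OF hilbert_L hilbert_R l r] v0] k by simp
    finally show ?thesis .
  qed
  have inner_copy: "hinner (P k k) (app2 (copy W) k k 1) (dinj 0 (c *\<^sub>C elem (L k) (R k) (l k) (r k))) =
      cnj (\<delta> k) * c" if k: "k < n" for k c
  proof -
    let ?e = "elem (L k) (R k) (l k) (r k)"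
    have T: "hilbert_space (tensor (L k) (R k))"
      by (intro hilbert_space_tensor hilbert_L hilbert_R k)
    have e: "?e \<in> hcarrier (tensor (L k) (R k))" "hinner (tensor (L k) (R k)) ?e ?e = 1"
      using line_tensor[OF hilbert_L hilbert_R l r] k by (auto intro: line_carrier line_inner)
    have "dinj 0 (c *\<^sub>C ?e) \<in> hcarrier (P k k)"
      by (intro P_carrier k carrier_scale[OF T] e)
    then show ?thesis
      unfolding copy1[OF k] P_dsum
      by (subst inner_dinj[OF hilbert_summands(2)[OF k k]])
        (simp_all add: inner_scale_left[OF T] inner_scale_right[OF T] carrier_scale[OF T] e)
  qed
  have phases: "\<delta> k * cnj (\<delta> k) = 1 \<and> \<gamma> k = \<delta> k" if k: "k < n" for k
  proof -
    have "compare W \<cdot> copy W \<approx> id_two (id_one n)" using W by (simp add: is_witness_def)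
    then have "app2 (compare W \<cdot> copy W) k k 1 = app2 (id_two (id_one n)) k k 1"
      by (rule cell_eqD[OF _ _ one_cell_id k k]) (simp_all add: two_cell_dom[OF copy])
    then have "cnj (\<delta> k) * \<delta> k = 1"
      using compare_eq_inner[OF k copy_one_carrier[OF k]] inner_copy[OF k, of "\<delta> k"]
      by (simp add: copy1[OF k])
    moreover have "\<gamma> k * cnj (\<delta> k) = 1"
    proof -
      have "lunit (wl W) \<cdot> (compare W \<star> id_two (wl W)) \<cdot> assoc (wl W) (wr W) (wl W)
        \<cdot> (id_two (wl W) \<star> create W) \<cdot> runit_inv (wl W) \<approx> id_two (wl W)" (is "?z \<approx> _")
        using W by (simp add: is_witness_def)
      then have "app2 ?z k 0 (l k) = app2 (id_two (wl W)) k 0 (l k)"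
        by (rule cell_eqD[OF _ _ wl k]) (use lc[OF k] in simp_all)
      then have "pairing k (l k) (\<rho> k) *\<^sub>C l k = l k"
        using zigzag_create_compare_left[OF \<rho>c lc create1 k lc[OF k]] by simp
      moreover have "elem (L k) (R k) (l k) (\<rho> k) = \<gamma> k *\<^sub>C elem (L k) (R k) (l k) (r k)"
        unfolding \<rho>_def by (rule elem_scale_right[OF hilbert_R[OF k] rc[OF k]])
      then have "pairing k (l k) (\<rho> k) = cnj (\<delta> k) * \<gamma> k"
        unfolding pairing_def compare_eq_inner[OF k P_elem[OF k k lc[OF k] \<rho>c[OF k]]]
        by (simp add: inner_copy[OF k])
      ultimately have "(cnj (\<delta> k) * \<gamma> k) *\<^sub>C l k = 1 *\<^sub>C l k" by (simp add: scaleC_one)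
      moreover have "l k \<noteq> 0"
        using line_inner[OF l[OF k]] inner_zero_right[OF hilbert_L[OF k] carrier_zero[OF hilbert_L[OF k]]]
        by auto
      ultimately have "cnj (\<delta> k) * \<gamma> k = 1"
        unfolding cvec.scale_cancel_right by simp
      then show ?thesis by (simp add: mult.commute)
    qed
    ultimately show ?thesis
      by (metis mult.commute mult_cancel_right zero_neq_one mult_zero_right)
  qed
  have "witness_basis n W \<rho> l"
  proof unfold_locales
    fix k assume k: "k < n"
    show "orthonormal_basis (ent (wr W) 0 k) {\<rho> k}"
      unfolding \<rho>_def using phases[OF k] by (intro line_scale hilbert_R r k) auto
    show "orthonormal_basis (ent (wl W) k 0) {l k}" by (rule l[OF k])
    show "app2 (copy W) k k 1 = dinj 0 (elem (ent (wl W) k 0) (ent (wr W) 0 k) (l k) (\<rho> k))"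
      using phases[OF k] elem_scale_right[OF hilbert_R[OF k] rc[OF k], of "L k" "l k" "\<delta> k"]
      by (simp add: copy1[OF k] \<rho>_def)
  qed (rule create1)
  then show ?thesis by blast
qed

text \<open>
  The formula for copy may be used in all entries, since off the diagonal it is only applied to 0.
\<close>

definition canonical_witness :: "nat \<Rightarrow> (complex, complex) witness" where
  "canonical_witness n =
     (let L = \<lparr>tgt = n, src = 1, ent = (\<lambda>_ _. hcomplex)\<rparr>;
          R = \<lparr>tgt = 1, src = n, ent = (\<lambda>_ _. hcomplex)\<rparr>
      in \<lparr>wl = L, wr = R,
           create = \<lparr>dom2 = id_one 1, cod2 = R \<odot> L,
             app2 = (\<lambda>_ _ z. \<Sum>k<n. dinj k (elem hcomplex hcomplex z 1))\<rparr>,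
           copy = \<lparr>dom2 = id_one n, cod2 = L \<odot> R,
             app2 = (\<lambda>_ _ z. dinj 0 (elem hcomplex hcomplex z 1))\<rparr>\<rparr>)"

theorem canonical_witness: "is_witness n (canonical_witness n)"
proof -
  let ?W = "canonical_witness n"
  have ent: "ent (wl ?W) i j = hcomplex" "ent (wr ?W) i j = hcomplex" for i j
    by (simp_all add: canonical_witness_def Let_def)
  have L: "one_cell 1 n (wl ?W)" and R: "one_cell n 1 (wr ?W)"
    by (simp_all add: one_cell_def canonical_witness_def Let_def hilbert_space_hcomplex)
  have C: "hilbert_space (tensor hcomplex hcomplex)"
    by (intro hilbert_space_tensor hilbert_space_hcomplex)
  have lin_z: "lin S (\<lambda>z. elem hcomplex hcomplex z 1)" for S
    by (intro lin_elem_left lin_id hilbert_space_hcomplex) simp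
  interpret witness_basis n ?W "\<lambda>_. 1" "\<lambda>_. 1"
  proof
    show "two_cell (id_one 1) (wr ?W \<odot> wl ?W) (create ?W)"
    proof (rule two_cellI[OF one_cell_id one_cell_comp[OF L R]])
      fix i j :: nat and x assume "i < 1" "j < 1"
      then show "app2 (create ?W) i j x \<in> hcarrier (ent (wr ?W \<odot> wl ?W) i j)"
        unfolding ent_one_comp ent one_cell_src[OF R]
        by (auto simp: canonical_witness_def Let_def C intro!: carrier_sum hilbert_space_dsum dinj_carrier
            elem_carrier)
      show "lin (hcarrier (ent (id_one 1) i j)) (app2 (create ?W) i j)"
        unfolding canonical_witness_def Let_def witness.simps twocell.simps
        by (intro lin_sum_fun lin_dinj lin_z)
    qed (simp_all add: canonical_witness_def Let_def)
    show "two_cell (id_one n) (wl ?W \<odot> wr ?W) (copy ?W)"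
    proof (rule two_cellI[OF one_cell_id one_cell_comp[OF R L]])
      fix i j :: nat and x assume "i < n" "j < n"
      then show "app2 (copy ?W) i j x \<in> hcarrier (ent (wl ?W \<odot> wr ?W) i j)"
        unfolding ent_one_comp ent one_cell_src[OF L]
        by (auto simp: canonical_witness_def Let_def C intro!: dinj_carrier elem_carrier)
      show "lin (hcarrier (ent (id_one n) i j)) (app2 (copy ?W) i j)"
        unfolding canonical_witness_def Let_def witness.simps twocell.simps
        by (intro lin_dinj lin_z)
    qed (simp_all add: canonical_witness_def Let_def)
  qed (use L R in \<open>simp_all add: ent line_hcomplex\<close>, simp_all add: canonical_witness_def Let_def)
  show ?thesis by (rule is_witness)
qed


section \<open>Tensoring with a line\<close>

text \<open>
  Tensoring with a line does not change a space. The inverse of \<open>y \<mapsto> e \<otimes> y\<close> is given by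
  contraction with the unit vector \<open>e\<close>.
\<close>

definition contract ::
    "'a::complex_vector hilb \<Rightarrow> 'b::complex_vector hilb \<Rightarrow> 'a \<Rightarrow> ('a \<Rightarrow> 'b \<Rightarrow> complex) \<Rightarrow> 'b" where
  "contract H K e t = lift H K (\<lambda>x y. hinner H e x *\<^sub>C y) t"

lemma lin_contract: "lin UNIV (contract H K e)"
  unfolding contract_def[abs_def] by (intro lin_lift_arg lin_id)

context
  fixes H :: "'a::complex_vector hilb" and K :: "'b::complex_vector hilb" and e :: 'a
  assumes H: "hilbert_space H" and K: "hilbert_space K" and e: "orthonormal_basis H {e}"
begin

lemma contract_elem:
  assumes x: "x \<in> hcarrier H" and y: "y \<in> hcarrier K"
  shows "contract H K e (elem H K x y) = hinner H e x *\<^sub>C y"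
proof -
  have "bilin H K (\<lambda>x y. hinner H e x *\<^sub>C y)"
    by (intro bilinI lin_scale_left lin_inner[OF H line_carrier[OF e]] lin_scale_right lin_id)
  then show ?thesis unfolding contract_def by (rule lift_elem[OF H K _ x y])
qed

lemma contract_carrier: "contract H K e t \<in> hcarrier K"
  unfolding contract_def by (intro lift_carrier H K hilbert_subspace carrier_scale)

lemma contract_unit_elem: "y \<in> hcarrier K \<Longrightarrow> contract H K e (elem H K e y) = y"
  using contract_elem[OF line_carrier[OF e]] line_inner[OF e] by (simp add: scaleC_one)

lemma elem_contract:
  assumes t: "t \<in> hcarrier (tensor H K)"
  shows "elem H K e (contract H K e t) = t"
proof (rule lin_eq_on_span[where f="\<lambda>t. elem H K e (contract H K e t)" and g="\<lambda>t. t"])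
  let ?A = "{elem H K h k | h k. h \<in> hcarrier H \<and> k \<in> hcarrier K}"
  show "t \<in> cvec.span ?A" using t by (simp add: tensor_def)
  show "lin (cvec.span ?A) (\<lambda>t. elem H K e (contract H K e t))"
    by (rule lin_elem_right[OF K lin_mono[OF lin_contract]]) (rule contract_carrier)
  show "lin (cvec.span ?A) (\<lambda>t. t)" by (rule lin_id)
  fix s assume "s \<in> ?A"
  then obtain x y where s: "s = elem H K x y" and xy: "x \<in> hcarrier H" "y \<in> hcarrier K" by blast
  have "elem H K e (contract H K e s) = hinner H e x *\<^sub>C elem H K e y"
    unfolding s contract_elem[OF xy] by (rule elem_scale_right[OF K xy(2)])
  also have "\<dots> = elem H K (hinner H e x *\<^sub>C e) y"
    by (rule elem_scale_left[OF H line_carrier[OF e], symmetric])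
  also have "\<dots> = s" unfolding s by (simp add: line_expansion[OF H e xy(1)])
  finally show "elem H K e (contract H K e s) = s" .
qed

lemma inner_unit_elem:
  "x \<in> hcarrier K \<Longrightarrow> y \<in> hcarrier K \<Longrightarrow>
    hinner (tensor H K) (elem H K e x) (elem H K e y) = hinner K x y"
  using inner_elem_elem[OF H K line_carrier[OF e] _ line_carrier[OF e]] line_inner[OF e] by simp

end

lemma unitary_map_line:
  assumes H: "hilbert_space H" and e: "orthonormal_basis H {e}"
    and K: "hilbert_space K" and f: "orthonormal_basis K {f}"
  shows "unitary_map H K (\<lambda>x. hinner H e x *\<^sub>C f)"
  unfolding unitary_map_def linear_map_lin
proof (intro conjI ballI subsetI)
  note fc = line_carrier[OF f] and ec = line_carrier[OF e]
  fix x assume x: "x \<in> hcarrier H"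
  show "hinner H e x *\<^sub>C f \<in> hcarrier K" by (rule carrier_scale[OF K fc])
  fix y assume y: "y \<in> hcarrier H"
  have "hinner K (hinner H e x *\<^sub>C f) (hinner H e y *\<^sub>C f) = hinner H x e * hinner H e y"
    using x ec fc line_inner[OF f]
    by (simp add: inner_scale_left[OF K] inner_scale_right[OF K] carrier_scale[OF K] inner_sym[OF H])
  also have "\<dots> = hinner H x (hinner H e y *\<^sub>C e)"
    by (simp add: inner_scale_right[OF H x ec])
  finally show "hinner K (hinner H e x *\<^sub>C f) (hinner H e y *\<^sub>C f) = hinner H x y"
    by (simp add: line_expansion[OF H e y])
next
  show "lin (hcarrier H) (\<lambda>x. hinner H e x *\<^sub>C f)"
    by (intro lin_scale_left lin_inner[OF H line_carrier[OF e]])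
next
  fix y assume y: "y \<in> hcarrier K"
  have "y = hinner H e (hinner K f y *\<^sub>C e) *\<^sub>C f"
    using line_expansion[OF K f y] line_inner[OF e]
    by (simp add: inner_scale_right[OF H line_carrier[OF e] line_carrier[OF e]])
  then show "y \<in> (\<lambda>x. hinner H e x *\<^sub>C f) ` hcarrier H"
    by (rule image_eqI) (rule carrier_scale[OF H line_carrier[OF e]])
qed

lemma unitary_map_image_line:
  assumes H: "hilbert_space H" and e: "orthonormal_basis H {e}" and f: "unitary_map H K f"
  shows "orthonormal_basis K {f e}"
proof -
  note ec = line_carrier[OF e]
  have "hcarrier K = range (\<lambda>a. a *\<^sub>C f e)"
  proof (intro equalityI subsetI)
    fix y assume "y \<in> hcarrier K"
    then obtain x where x: "x \<in> hcarrier H" "y = f x" using f by (auto simp: unitary_map_def)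
    have "f x = f (hinner H e x *\<^sub>C e)" by (simp add: line_expansion[OF H e x(1)])
    also have "\<dots> = hinner H e x *\<^sub>C f e" by (rule lin_scale[OF unitary_map_lin[OF f] ec])
    finally show "y \<in> range (\<lambda>a. a *\<^sub>C f e)" using x by blast
  next
    fix y assume "y \<in> range (\<lambda>a. a *\<^sub>C f e)"
    then obtain a where "y = f (a *\<^sub>C e)" by (auto simp: lin_scale[OF unitary_map_lin[OF f] ec])
    then show "y \<in> hcarrier K" by (simp add: unitary_map_carrier[OF f] carrier_scale[OF H ec])
  qed
  then show ?thesis
    using line_inner[OF e] by (simp add: line_iff cvec.span_singleton unitary_map_inner[OF f ec ec])
qed


section \<open>Measurements and orthogonal decompositions\<close>

locale measurement = witness_basis n W r l
  for n and W :: "('l::complex_vector, 'r::complex_vector) witness" and r l +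
  fixes H :: "'h::complex_vector hilb" and F :: "'f::complex_vector onecell"
    and \<mu> :: "('h, nat \<Rightarrow> 'r \<Rightarrow> 'f \<Rightarrow> complex) twocell"
  assumes proj_measurement: "proj_measurement H n W F \<mu>"
begin

abbreviation S :: "nat \<Rightarrow> ('r \<Rightarrow> 'f \<Rightarrow> complex) hilb" where "S k \<equiv> tensor (R k) (ent F k 0)"
abbreviation T :: "(nat \<Rightarrow> 'r \<Rightarrow> 'f \<Rightarrow> complex) hilb" where "T \<equiv> ent (wr W \<odot> F) 0 0"
abbreviation u :: "'h \<Rightarrow> nat \<Rightarrow> 'r \<Rightarrow> 'f \<Rightarrow> complex" where "u \<equiv> app2 \<mu> 0 0"
abbreviation v :: "(nat \<Rightarrow> 'r \<Rightarrow> 'f \<Rightarrow> complex) \<Rightarrow> 'h" where "v \<equiv> app2 (dagger \<mu>) 0 0"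

lemma hilbert_H: "hilbert_space H"
  and F: "one_cell 1 n F"
  and \<mu>: "two_cell (scalar H) (wr W \<odot> F) \<mu>"
  and unitary: "unitary_cell \<mu>"
  using proj_measurement by (auto simp: proj_measurement_def)

lemma hilbert_F: "k < n \<Longrightarrow> hilbert_space (ent F k 0)"
  by (rule one_cell_hilbert[OF F]) auto

lemma hilbert_S: "\<forall>k<n. hilbert_space (S k)"
  by (auto intro!: hilbert_space_tensor hilbert_R hilbert_F)

lemma rF: "one_cell 1 1 (wr W \<odot> F)"
  by (rule one_cell_comp[OF F wr])

lemma T_dsum: "T = dsum n S"
  by (simp add: ent_one_comp one_cell_src[OF wr])

lemma dinj_T: "k < n \<Longrightarrow> t \<in> hcarrier (S k) \<Longrightarrow> dinj k t \<in> hcarrier T"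
  unfolding T_dsum by (rule dinj_carrier[OF hilbert_S])

lemma S_elem: "k < n \<Longrightarrow> y \<in> hcarrier (ent F k 0) \<Longrightarrow> elem (R k) (ent F k 0) (r k) y \<in> hcarrier (S k)"
  by (intro elem_carrier r_carrier)

lemma u_carrier: "x \<in> hcarrier H \<Longrightarrow> u x \<in> hcarrier T"
  using two_cell_carrier[OF \<mu> one_cell_scalar[OF hilbert_H], of 0 0 x] by simp

lemma v_carrier: "t \<in> hcarrier T \<Longrightarrow> v t \<in> hcarrier H"
  using two_cell_carrier[OF two_cell_dagger[OF \<mu> one_cell_scalar[OF hilbert_H] rF] rF, of 0 0 t]
  by simp

lemma lin_u: "lin (hcarrier H) u"
  using two_cell_lin[OF \<mu> one_cell_scalar[OF hilbert_H], of 0 0] by simp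

lemma lin_v: "lin (hcarrier T) v"
  using two_cell_lin[OF two_cell_dagger[OF \<mu> one_cell_scalar[OF hilbert_H] rF] rF, of 0 0]
  by simp

lemma v_u: "x \<in> hcarrier H \<Longrightarrow> v (u x) = x"
  using unitary_cell_dagger(1)[OF \<mu> one_cell_scalar[OF hilbert_H] rF unitary, of 0 0 x] by simp

lemma u_v: "t \<in> hcarrier T \<Longrightarrow> u (v t) = t"
  using unitary_cell_dagger(2)[OF \<mu> one_cell_scalar[OF hilbert_H] rF unitary, of 0 0 t] by simp

lemma inner_v: "s \<in> hcarrier T \<Longrightarrow> t \<in> hcarrier T \<Longrightarrow> hinner H (v s) (v t) = hinner T s t"
  using inner_dagger[OF \<mu> one_cell_scalar[OF hilbert_H] rF, of 0 0 "v s" t]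
  by (simp add: v_carrier u_v)

lemma inner_u: "x \<in> hcarrier H \<Longrightarrow> y \<in> hcarrier H \<Longrightarrow> hinner T (u x) (u y) = hinner H x y"
  using inner_v[OF u_carrier u_carrier, of x y] by (simp add: v_u)

lemma outcome_space: "outcome_space W F \<mu> k = (\<lambda>t. v (dinj k t)) ` hcarrier (S k)"
  by (simp add: outcome_space_def)

lemma outcome_space_subset: "k < n \<Longrightarrow> outcome_space W F \<mu> k \<subseteq> hcarrier H"
  unfolding outcome_space using v_carrier[OF dinj_T] by blast

text \<open>
  Since \<open>R k\<close> is a line, the elements of the \<open>k\<close>-th summand are the tensors \<open>r k \<otimes> y\<close>; in this
  way the outcome space becomes a copy of the entry of \<open>F\<close>.
\<close>

lemma mem_outcome_space:
  assumes k: "k < n"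
  shows "x \<in> outcome_space W F \<mu> k \<longleftrightarrow>
    (\<exists>y\<in>hcarrier (ent F k 0). x = v (dinj k (elem (R k) (ent F k 0) (r k) y)))"
proof
  assume "x \<in> outcome_space W F \<mu> k"
  then obtain t where t: "t \<in> hcarrier (S k)" "x = v (dinj k t)" by (auto simp: outcome_space)
  let ?y = "contract (R k) (ent F k 0) (r k) t"
  have "x = v (dinj k (elem (R k) (ent F k 0) (r k) ?y))"
    unfolding t(2) elem_contract[OF hilbert_R[OF k] hilbert_F[OF k] r[OF k] t(1)] ..
  moreover have "?y \<in> hcarrier (ent F k 0)"
    by (rule contract_carrier[OF hilbert_R[OF k] hilbert_F[OF k] r[OF k]])
  ultimately show "\<exists>y\<in>hcarrier (ent F k 0). x = v (dinj k (elem (R k) (ent F k 0) (r k) y))"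
    by blast
next
  assume "\<exists>y\<in>hcarrier (ent F k 0). x = v (dinj k (elem (R k) (ent F k 0) (r k) y))"
  then show "x \<in> outcome_space W F \<mu> k"
    unfolding outcome_space using S_elem[OF k] by blast
qed

text \<open>
  The summands of the target are orthogonal and span it, and the adjoint of a unitary is an
  isometry onto its target.
\<close>

theorem outcome_spaces_decompose: "orthogonal_decomposition H n (outcome_space W F \<mu>)"
  unfolding orthogonal_decomposition_def
proof (intro conjI allI impI ballI)
  fix k assume k: "k < n"
  show "outcome_space W F \<mu> k \<subseteq> hcarrier H" by (rule outcome_space_subset[OF k])
  have "lin (hcarrier (S k)) (\<lambda>t. v (dinj k t))"
    by (rule lin_compose[OF lin_v lin_dinj[OF lin_id]]) (rule dinj_T[OF k])
  then show "cvec.subspace (outcome_space W F \<mu> k)"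
    unfolding outcome_space by (rule subspace_lin_image) (rule subspace_tensor)
next
  fix k l x y assume kl: "k < n" "l < n" "k \<noteq> l"
    and "x \<in> outcome_space W F \<mu> k" "y \<in> outcome_space W F \<mu> l"
  then obtain s t where st: "s \<in> hcarrier (S k)" "t \<in> hcarrier (S l)"
    and xy: "x = v (dinj k s)" "y = v (dinj l t)" by (auto simp: outcome_space)
  have "hinner H x y = hinner (dsum n S) (dinj k s) (dinj l t)"
    unfolding xy inner_v[OF dinj_T[OF kl(1) st(1)] dinj_T[OF kl(2) st(2)]] T_dsum ..
  also have "\<dots> = hinner (S k) s (dinj l t k)"
    by (rule inner_dinj[OF hilbert_S kl(1) dinj_carrier[OF hilbert_S kl(2) st(2)]])
  also have "dinj l t k = 0" using kl by (simp add: dinj_def)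
  also have "hinner (S k) s 0 = 0"
    by (rule inner_zero_right[OF _ st(1)]) (use hilbert_S kl in blast)
  finally show "hinner H x y = 0" .
next
  show "hcarrier H = {\<Sum>k<n. x k | x. \<forall>k<n. x k \<in> outcome_space W F \<mu> k}"
  proof (intro equalityI subsetI)
    fix x assume x: "x \<in> hcarrier H"
    have S: "u x k \<in> hcarrier (S k)" if "k < n" for k
      using u_carrier[OF x] that by (simp add: T_dsum dsum_carrier)
    have "x = v (\<Sum>k<n. dinj k (u x k))"
      using v_u[OF x] u_carrier[OF x] unfolding T_dsum by (simp add: dsum_sum_dinj)
    also have "\<dots> = (\<Sum>k<n. v (dinj k (u x k)))"
      by (rule lin_sum[OF lin_v hilbert_subspace[OF one_cell_hilbert[OF rF]]])
        (auto intro: dinj_T S)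
    finally have "x = (\<Sum>k<n. v (dinj k (u x k)))" .
    moreover have "\<forall>k<n. v (dinj k (u x k)) \<in> outcome_space W F \<mu> k"
      using S unfolding outcome_space by blast
    ultimately show "x \<in> {\<Sum>k<n. x k | x. \<forall>k<n. x k \<in> outcome_space W F \<mu> k}"
      by (intro CollectI exI[of _ "\<lambda>k. v (dinj k (u x k))"] conjI)
  next
    fix x assume "x \<in> {\<Sum>k<n. x k | x. \<forall>k<n. x k \<in> outcome_space W F \<mu> k}"
    then obtain y where y: "x = (\<Sum>k<n. y k)" "\<forall>k<n. y k \<in> outcome_space W F \<mu> k"
      by (elim CollectE exE conjE)
    have "y k \<in> hcarrier H" if "k < n" for k
      using outcome_space_subset[OF that] y(2) that by blast
    then show "x \<in> hcarrier H" unfolding y(1) by (intro carrier_sum hilbert_H) auto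
  qed
qed

end


subsection \<open>The measurement of a decomposition\<close>

text \<open>
  Because tensoring with the line \<open>R k\<close> changes nothing, the given subspaces themselves can serve
  as the entries of the 1-cell.
\<close>

locale decomposition = witness_basis n W r l
  for n and W :: "('l::complex_vector, 'r::complex_vector) witness" and r l +
  fixes H :: "'h::complex_vector hilb" and V :: "nat \<Rightarrow> 'h set"
  assumes H: "hilbert_space H" and V: "orthogonal_decomposition H n V"
begin

definition VH :: "nat \<Rightarrow> 'h hilb" where "VH k = \<lparr>hcarrier = V k, hinner = hinner H\<rparr>"

definition F :: "'h onecell" where "F = \<lparr>tgt = n, src = 1, ent = (\<lambda>k _. VH k)\<rparr>"

text \<open>
  The orthogonal projection to \<open>V k\<close>. Written in coordinates it is visibly linear, and that it
  picks the \<open>k\<close>-th component follows from orthogonality.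
\<close>

definition proj :: "nat \<Rightarrow> 'h \<Rightarrow> 'h" where
  "proj k x = (\<Sum>b\<in>onb (VH k). hinner H b x *\<^sub>C b)"

definition \<mu> :: "('h, nat \<Rightarrow> 'r \<Rightarrow> 'h \<Rightarrow> complex) twocell" where
  "\<mu> = \<lparr>dom2 = scalar H, cod2 = wr W \<odot> F,
     app2 = (\<lambda>_ _ x. \<Sum>k<n. dinj k (elem (R k) (VH k) (r k) (proj k x)))\<rparr>"

abbreviation S :: "nat \<Rightarrow> ('r \<Rightarrow> 'h \<Rightarrow> complex) hilb" where "S k \<equiv> tensor (R k) (VH k)"

lemma V_subset: "k < n \<Longrightarrow> V k \<subseteq> hcarrier H"
  and V_subspace: "k < n \<Longrightarrow> cvec.subspace (V k)"
  and V_orthogonal: "k < n \<Longrightarrow> j < n \<Longrightarrow> k \<noteq> j \<Longrightarrow> x \<in> V k \<Longrightarrow> y \<in> V j \<Longrightarrow> hinner H x y = 0"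
  using V unfolding orthogonal_decomposition_def by blast+

lemma H_sum: "hcarrier H = {\<Sum>k<n. x k | x. \<forall>k<n. x k \<in> V k}"
  by (rule V[unfolded orthogonal_decomposition_def, THEN conjunct2, THEN conjunct2])

lemma carrier_VH [simp]: "hcarrier (VH k) = V k"
  and inner_VH [simp]: "hinner (VH k) = hinner H"
  by (simp_all add: VH_def)

lemma ent_F [simp]: "ent F k j = VH k"
  by (simp add: F_def)

lemma hilbert_VH: "k < n \<Longrightarrow> hilbert_space (VH k)"
  unfolding VH_def by (rule hilbert_subspace_hilbert[OF H V_subset V_subspace])

lemma one_cell_F: "one_cell 1 n F"
  by (simp add: one_cell_def F_def hilbert_VH)

lemma hilbert_S: "\<forall>k<n. hilbert_space (S k)"
  by (auto intro!: hilbert_space_tensor hilbert_R hilbert_VH)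

lemma T_dsum: "ent (wr W \<odot> F) 0 0 = dsum n S"
  by (simp add: ent_one_comp one_cell_src[OF wr])

lemma proj_mem: "k < n \<Longrightarrow> proj k x \<in> V k"
proof -
  assume k: "k < n"
  note K = hilbert_VH[OF k]
  have "proj k x \<in> hcarrier (VH k)"
    unfolding proj_def by (intro carrier_sum[OF K] carrier_scale[OF K] onb_carrier[OF K])
  then show ?thesis by simp
qed

lemma onb_VH: "k < n \<Longrightarrow> b \<in> onb (VH k) \<Longrightarrow> b \<in> V k"
  using onb_carrier[OF hilbert_VH] by simp

lemma lin_proj_map: "k < n \<Longrightarrow> lin (hcarrier H) (proj k)"
  unfolding proj_def[abs_def]
  by (intro lin_sum_fun lin_scale_left lin_inner H subsetD[OF V_subset] onb_VH)

lemma proj_same: "k < n \<Longrightarrow> x \<in> V k \<Longrightarrow> proj k x = x"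
  unfolding proj_def using onb_expansion[OF hilbert_VH, of k x] by simp

lemma proj_other:
  assumes "k < n" "j < n" "j \<noteq> k" "x \<in> V j"
  shows "proj k x = 0"
  unfolding proj_def
  by (rule sum.neutral) (use assms onb_VH V_orthogonal in \<open>auto\<close>)

lemma proj_sum:
  assumes k: "k < n" and x: "\<forall>j<n. x j \<in> V j"
  shows "proj k (\<Sum>j<n. x j) = x k"
proof -
  have "proj k (\<Sum>j<n. x j) = (\<Sum>j<n. proj k (x j))"
    by (rule lin_sum[OF lin_proj_map[OF k] hilbert_subspace[OF H] subsetD[OF V_subset]])
      (use x in auto)
  also have "\<dots> = (\<Sum>j<n. if j = k then x k else 0)"
    by (intro sum.cong) (use k x in \<open>auto simp: proj_same proj_other\<close>)
  also have "\<dots> = x k" using k by simp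
  finally show ?thesis .
qed

lemma sum_proj:
  assumes "x \<in> hcarrier H"
  shows "(\<Sum>k<n. proj k x) = x"
proof -
  obtain y where y: "x = (\<Sum>k<n. y k)" "\<forall>k<n. y k \<in> V k"
    using assms unfolding H_sum by (elim CollectE exE conjE)
  show ?thesis unfolding y(1) by (intro sum.cong refl proj_sum[OF _ y(2)]) simp
qed

lemma inner_proj:
  assumes x: "x \<in> hcarrier H" and y: "y \<in> hcarrier H"
  shows "(\<Sum>k<n. hinner H (proj k x) (proj k y)) = hinner H x y"
proof -
  have P: "proj k z \<in> hcarrier H" if "k < n" for k z
    using proj_mem[OF that] V_subset[OF that] by blast
  have "hinner H x y = hinner H x (\<Sum>k<n. proj k y)" by (simp add: sum_proj[OF y])
  also have "\<dots> = (\<Sum>k<n. hinner H x (proj k y))"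
    by (rule inner_sum_right[OF H x]) (use P in simp)
  also have "\<dots> = (\<Sum>k<n. hinner H (proj k x) (proj k y))"
  proof (intro sum.cong refl)
    fix k assume "k \<in> {..<n}"
    then have k: "k < n" by simp
    have "hinner H x (proj k y) = hinner H (\<Sum>j<n. proj j x) (proj k y)" by (simp add: sum_proj[OF x])
    also have "\<dots> = (\<Sum>j<n. hinner H (proj j x) (proj k y))"
      by (rule inner_sum_left[OF H P[OF k]]) (use P in simp)
    also have "\<dots> = (\<Sum>j<n. if j = k then hinner H (proj k x) (proj k y) else 0)"
      by (intro sum.cong) (use k V_orthogonal proj_mem in auto)
    also have "\<dots> = hinner H (proj k x) (proj k y)" using k by simp
    finally show "hinner H x (proj k y) = hinner H (proj k x) (proj k y)" .
  qed
  finally show ?thesis by simp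
qed

lemma \<mu>_apply: "app2 \<mu> i j x = (\<Sum>k<n. dinj k (elem (R k) (VH k) (r k) (proj k x)))"
  by (simp add: \<mu>_def)

lemma \<mu>_component: "k < n \<Longrightarrow> app2 \<mu> i j x k = elem (R k) (VH k) (r k) (proj k x)"
  unfolding \<mu>_apply by (rule sum_dinj_apply)

lemma \<mu>_carrier: "app2 \<mu> i j x \<in> hcarrier (dsum n S)"
  unfolding \<mu>_apply
  by (intro carrier_sum hilbert_space_dsum hilbert_S dinj_carrier elem_carrier)
    (auto simp: r_carrier proj_mem)

lemma \<mu>_eqI:
  assumes t: "t \<in> hcarrier (dsum n S)" and y: "\<And>k. k < n \<Longrightarrow> t k = elem (R k) (VH k) (r k) (proj k x)"
  shows "app2 \<mu> i j x = t"
proof -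
  have "app2 \<mu> i j x = (\<Sum>k<n. dinj k (t k))"
    unfolding \<mu>_apply by (intro sum.cong) (simp_all add: y)
  then show ?thesis by (simp only: dsum_sum_dinj[OF t])
qed

lemma unitary_\<mu>: "unitary_map H (dsum n S) (app2 \<mu> 0 0)"
  unfolding unitary_map_def linear_map_lin
proof (intro conjI ballI subsetI)
  show "app2 \<mu> 0 0 x \<in> hcarrier (dsum n S)" for x by (rule \<mu>_carrier)
  show "lin (hcarrier H) (app2 \<mu> 0 0)"
    unfolding \<mu>_def twocell.simps
    by (intro lin_sum_fun lin_dinj lin_elem_right hilbert_VH lin_proj_map)
      (simp_all add: proj_mem)
  fix x y assume xy: "x \<in> hcarrier H" "y \<in> hcarrier H"
  have "hinner (dsum n S) (app2 \<mu> 0 0 x) (app2 \<mu> 0 0 y) = (\<Sum>k<n. hinner H (proj k x) (proj k y))"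
    unfolding inner_dsum
    by (intro sum.cong) (simp_all add: \<mu>_component inner_unit_elem[OF hilbert_R hilbert_VH r] proj_mem)
  then show "hinner (dsum n S) (app2 \<mu> 0 0 x) (app2 \<mu> 0 0 y) = hinner H x y"
    by (simp add: inner_proj[OF xy])
next
  fix t assume t: "t \<in> hcarrier (dsum n S)"
  define y where "y k = contract (R k) (VH k) (r k) (t k)" for k
  have y: "\<forall>k<n. y k \<in> V k"
    using contract_carrier[OF hilbert_R hilbert_VH r] by (simp add: y_def)
  have "app2 \<mu> 0 0 (\<Sum>k<n. y k) = t"
  proof (rule \<mu>_eqI[OF t])
    fix k assume k: "k < n"
    then have "t k \<in> hcarrier (S k)" using t by (simp add: dsum_carrier)
    then show "t k = elem (R k) (VH k) (r k) (proj k (\<Sum>k<n. y k))"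
      unfolding proj_sum[OF k y] unfolding y_def
      by (rule elem_contract[OF hilbert_R[OF k] hilbert_VH[OF k] r[OF k], symmetric])
  qed
  moreover have "(\<Sum>k<n. y k) \<in> hcarrier H"
    unfolding H_sum by (intro CollectI exI[of _ y] conjI refl y)
  ultimately show "t \<in> app2 \<mu> 0 0 ` hcarrier H" by blast
qed

theorem measurement: "proj_measurement H n W F \<mu>"
proof -
  have rF: "one_cell 1 1 (wr W \<odot> F)" by (rule one_cell_comp[OF one_cell_F wr])
  have two: "two_cell (scalar H) (wr W \<odot> F) \<mu>"
    by (rule two_cellI[OF one_cell_scalar[OF H] rF])
      (use unitary_\<mu> in \<open>auto simp: T_dsum unitary_map_lin \<mu>_carrier\<close>, simp_all add: \<mu>_def)
  moreover have "unitary_cell \<mu>"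
    unfolding unitary_cell_iff[OF two one_cell_scalar[OF H] rF] using unitary_\<mu> by (simp add: T_dsum)
  ultimately show ?thesis
    unfolding proj_measurement_def by (intro conjI H is_witness one_cell_F)
qed

text \<open>On \<open>V k\<close> the unitary is \<open>y \<mapsto> r k \<otimes> y\<close>, because all other projections vanish there.\<close>

theorem outcome_space_eq:
  assumes k: "k < n"
  shows "outcome_space W F \<mu> k = V k"
proof -
  interpret m: measurement n W r l H F \<mu>
    by unfold_locales (rule measurement)
  have v: "m.v (dinj k (elem (R k) (VH k) (r k) y)) = y" if y: "y \<in> V k" for y
  proof -
    have yH: "y \<in> hcarrier H" using V_subset[OF k] y by blast
    have e: "elem (R k) (VH k) (r k) y \<in> hcarrier (S k)"
      using k y by (intro elem_carrier) (simp_all add: r_carrier)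
    have "app2 \<mu> 0 0 y = dinj k (elem (R k) (VH k) (r k) y)"
    proof (rule \<mu>_eqI[OF dinj_carrier[OF hilbert_S k e]])
      fix j assume j: "j < n"
      show "dinj k (elem (R k) (VH k) (r k) y) j = elem (R j) (VH j) (r j) (proj j y)"
        using k j y by (cases "j = k")
          (auto simp: proj_same proj_other dinj_def elem_zero_right[OF hilbert_VH])
    qed
    then show ?thesis using m.v_u[OF yH] by simp
  qed
  show ?thesis
    by (rule set_eqI, subst m.mem_outcome_space[OF k]) (use v in auto)
qed

end


subsection \<open>Equivalence of measurements\<close>

locale measurement_pair =
  A: measurement n W r l H F \<mu> + B: measurement n W' r' l' H F' \<mu>'
  for n and W :: "('l::complex_vector, 'r::complex_vector) witness" and r l
    and H :: "'h::complex_vector hilb" and F :: "'f::complex_vector onecell" and \<mu>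
    and W' :: "('k::complex_vector, 's::complex_vector) witness" and r' l'
    and F' :: "'g::complex_vector onecell" and \<mu>'
begin

text \<open>
  The horizontal composite of the two isomorphisms respects the summands and is onto on each,
  and it intertwines the two measurements.
\<close>

lemma equiv_imp_outcome_eq:
  assumes "measurement_equiv W F \<mu> W' F' \<mu>'" and k: "k < n"
  shows "outcome_space W F \<mu> k = outcome_space W' F' \<mu>' k"
proof -
  obtain \<theta> \<alpha> where \<theta>: "two_cell (wr W) (wr W') \<theta>" "unitary_cell \<theta>"
    and \<alpha>: "two_cell F F' \<alpha>" "unitary_cell \<alpha>" and eq: "(\<theta> \<star> \<alpha>) \<cdot> \<mu> \<approx> \<mu>'"
    using assms(1) unfolding measurement_equiv_def witness_iso_def by blast
  let ?\<theta> = "app2 \<theta> 0 k" and ?\<alpha> = "app2 \<alpha> k 0"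
  have U\<theta>: "unitary_map (A.R k) (B.R k) ?\<theta>"
    using \<theta> k unitary_cell_iff[OF \<theta>(1) A.wr B.wr] by auto
  have U\<alpha>: "unitary_map (ent F k 0) (ent F' k 0) ?\<alpha>"
    using \<alpha> k unitary_cell_iff[OF \<alpha>(1) A.F B.F] by auto
  note e = unitary_map_image_line[OF A.hilbert_R[OF k] A.r[OF k] U\<theta>]
  have v: "A.v (dinj k (elem (A.R k) (ent F k 0) (r k) y)) =
      B.v (dinj k (elem (B.R k) (ent F' k 0) (?\<theta> (r k)) (?\<alpha> y)))"
    if y: "y \<in> hcarrier (ent F k 0)" for y
  proof -
    let ?t = "dinj k (elem (A.R k) (ent F k 0) (r k) y)"
    have t: "?t \<in> hcarrier A.T" by (rule A.dinj_T[OF k A.S_elem[OF k y]])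
    have w: "A.v ?t \<in> hcarrier H" by (rule A.v_carrier[OF t])
    have "app2 ((\<theta> \<star> \<alpha>) \<cdot> \<mu>) 0 0 (A.v ?t) = B.u (A.v ?t)"
      by (rule cell_eqD[OF eq _ one_cell_scalar[OF A.hilbert_H]])
        (simp_all add: two_cell_dom[OF A.\<mu>] w)
    then have "B.u (A.v ?t) = app2 (\<theta> \<star> \<alpha>) 0 0 ?t"
      by (simp add: A.u_v[OF t])
    also have "\<dots> = dinj k (elem (B.R k) (ent F' k 0) (?\<theta> (r k)) (?\<alpha> y))"
      by (rule hcomp_dinj[OF \<theta>(1) A.wr B.wr \<alpha>(1) A.F B.F]) (use k y A.r_carrier in auto)
    finally show ?thesis using B.v_u[OF w] by simp
  qed
  show ?thesis
  proof (intro equalityI subsetI)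
    fix x assume "x \<in> outcome_space W F \<mu> k"
    then obtain y where y: "y \<in> hcarrier (ent F k 0)" "x = A.v (dinj k (elem (A.R k) (ent F k 0) (r k) y))"
      unfolding A.mem_outcome_space[OF k] by blast
    have "elem (B.R k) (ent F' k 0) (?\<theta> (r k)) (?\<alpha> y) \<in> hcarrier (B.S k)"
      by (intro elem_carrier line_carrier[OF e] unitary_map_carrier[OF U\<alpha>] y)
    then show "x \<in> outcome_space W' F' \<mu>' k"
      unfolding y(2) v[OF y(1)] B.outcome_space by blast
  next
    fix x assume "x \<in> outcome_space W' F' \<mu>' k"
    then obtain t where t: "t \<in> hcarrier (B.S k)" "x = B.v (dinj k t)"
      unfolding B.outcome_space by blast
    let ?z = "contract (B.R k) (ent F' k 0) (?\<theta> (r k)) t"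
    have "?z \<in> hcarrier (ent F' k 0)"
      by (rule contract_carrier[OF B.hilbert_R[OF k] B.hilbert_F[OF k] e])
    then obtain y where y: "y \<in> hcarrier (ent F k 0)" "?z = ?\<alpha> y"
      using U\<alpha> unfolding unitary_map_def by blast
    have "t = elem (B.R k) (ent F' k 0) (?\<theta> (r k)) (?\<alpha> y)"
      unfolding y(2)[symmetric]
      by (rule elem_contract[OF B.hilbert_R[OF k] B.hilbert_F[OF k] e t(1), symmetric])
    then have "x = A.v (dinj k (elem (A.R k) (ent F k 0) (r k) y))"
      using t(2) v[OF y(1)] by simp
    then show "x \<in> outcome_space W F \<mu> k"
      unfolding A.mem_outcome_space[OF k] using y(1) by blast
  qed
qed

text \<open>Any two witnesses are isomorphic: match their distinguished unit vectors.\<close>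

definition \<theta>R :: "('r, 's) twocell" where
  "\<theta>R = \<lparr>dom2 = wr W, cod2 = wr W', app2 = (\<lambda>i k x. hinner (A.R k) (r k) x *\<^sub>C r' k)\<rparr>"

definition \<theta>L :: "('l, 'k) twocell" where
  "\<theta>L = \<lparr>dom2 = wl W, cod2 = wl W', app2 = (\<lambda>k j x. hinner (A.L k) (l k) x *\<^sub>C l' k)\<rparr>"

lemma unitary_\<theta>R_map: "k < n \<Longrightarrow> unitary_map (A.R k) (B.R k) (app2 \<theta>R 0 k)"
  unfolding \<theta>R_def twocell.simps
  by (rule unitary_map_line[OF A.hilbert_R A.r B.hilbert_R B.r])

lemma unitary_\<theta>L_map: "k < n \<Longrightarrow> unitary_map (A.L k) (B.L k) (app2 \<theta>L k 0)"
  unfolding \<theta>L_def twocell.simps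
  by (rule unitary_map_line[OF A.hilbert_L A.l B.hilbert_L B.l])

lemma two_cell_\<theta>R: "two_cell (wr W) (wr W') \<theta>R"
  by (rule two_cellI[OF A.wr B.wr])
    (auto simp: unitary_map_carrier[OF unitary_\<theta>R_map] unitary_map_lin[OF unitary_\<theta>R_map],
     simp_all add: \<theta>R_def)

lemma two_cell_\<theta>L: "two_cell (wl W) (wl W') \<theta>L"
  by (rule two_cellI[OF A.wl B.wl])
    (auto simp: unitary_map_carrier[OF unitary_\<theta>L_map] unitary_map_lin[OF unitary_\<theta>L_map],
     simp_all add: \<theta>L_def)

lemma \<theta>R_r: "k < n \<Longrightarrow> app2 \<theta>R 0 k (r k) = r' k"
  and \<theta>L_l: "k < n \<Longrightarrow> app2 \<theta>L k 0 (l k) = l' k"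
  by (simp_all add: \<theta>R_def \<theta>L_def line_inner[OF A.r] line_inner[OF A.l] scaleC_one)

lemma witness_iso: "witness_iso W W' \<theta>L \<theta>R"
  unfolding witness_iso_def
proof (intro conjI)
  show "two_cell (wl W) (wl W') \<theta>L" "two_cell (wr W) (wr W') \<theta>R"
    by (rule two_cell_\<theta>L two_cell_\<theta>R)+
  show "unitary_cell \<theta>L"
    unfolding unitary_cell_iff[OF two_cell_\<theta>L A.wl B.wl] using unitary_\<theta>L_map by simp
  show "unitary_cell \<theta>R"
    unfolding unitary_cell_iff[OF two_cell_\<theta>R A.wr B.wr] using unitary_\<theta>R_map by simp
  show "(\<theta>R \<star> \<theta>L) \<cdot> create W \<approx> create W'"
  proof (rule cell_eqI[OF _ _ _ one_cell_id])
    fix i j :: nat and z :: complex assume "i < 1" "j < 1"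
    then have ij: "i = 0" "j = 0" by auto
    have 1: "app2 (\<theta>R \<star> \<theta>L) 0 0 (app2 (create W) 0 0 1) = app2 (create W') 0 0 1"
      unfolding A.create_one B.create_one lin_sum[OF lin_hcomp cvec.subspace_UNIV UNIV_I]
    proof (intro sum.cong refl)
      fix m assume "m \<in> {..<n}"
      then have m: "m < n" by simp
      have "app2 (\<theta>R \<star> \<theta>L) 0 0 (dinj m (elem (A.R m) (A.L m) (r m) (l m))) =
          dinj m (elem (B.R m) (B.L m) (app2 \<theta>R 0 m (r m)) (app2 \<theta>L m 0 (l m)))"
        by (rule hcomp_dinj[OF two_cell_\<theta>R A.wr B.wr two_cell_\<theta>L A.wl B.wl])
          (use m A.r_carrier A.l_carrier in auto)
      then show "app2 (\<theta>R \<star> \<theta>L) 0 0 (dinj m (elem (A.R m) (A.L m) (r m) (l m))) =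
          dinj m (elem (B.R m) (B.L m) (r' m) (l' m))"
        by (simp add: \<theta>R_r[OF m] \<theta>L_l[OF m])
    qed
    have "app2 (create W) 0 0 z = z *\<^sub>C app2 (create W) 0 0 1"
      using lin_scale[OF two_cell_lin[OF A.create one_cell_id], of 0 0 1 z] by simp
    then have "app2 (\<theta>R \<star> \<theta>L) 0 0 (app2 (create W) 0 0 z) = z *\<^sub>C app2 (create W') 0 0 1"
      by (simp add: lin_scale[OF lin_hcomp UNIV_I] 1)
    also have "\<dots> = app2 (create W') 0 0 z"
      using lin_scale[OF two_cell_lin[OF B.create one_cell_id], of 0 0 1 z] by simp
    finally show "app2 ((\<theta>R \<star> \<theta>L) \<cdot> create W) i j z = app2 (create W') i j z"
      by (simp add: ij)
  qed (simp_all add: two_cell_dom[OF A.create] two_cell_dom[OF B.create] two_cell_cod[OF B.create]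
      two_cell_cod[OF two_cell_\<theta>R] two_cell_cod[OF two_cell_\<theta>L])
  show "(\<theta>L \<star> \<theta>R) \<cdot> copy W \<approx> copy W'"
  proof (rule cell_eqI[OF _ _ _ one_cell_id])
    fix i j z assume ij: "i < n" "j < n" and z: "z \<in> hcarrier (ent (id_one n) i j)"
    show "app2 ((\<theta>L \<star> \<theta>R) \<cdot> copy W) i j z = app2 (copy W') i j z"
    proof (cases "i = j")
      case True
      have "app2 (\<theta>L \<star> \<theta>R) i i (dinj 0 (elem (A.L i) (A.R i) (l i) (r i))) =
          dinj 0 (elem (B.L i) (B.R i) (app2 \<theta>L i 0 (l i)) (app2 \<theta>R 0 i (r i)))"
        by (rule hcomp_dinj[OF two_cell_\<theta>L A.wl B.wl two_cell_\<theta>R A.wr B.wr])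
          (use ij A.r_carrier A.l_carrier in auto)
      then have 1: "app2 (\<theta>L \<star> \<theta>R) i i (app2 (copy W) i i 1) = app2 (copy W') i i 1"
        by (simp add: A.copy_one[OF ij(1)] B.copy_one[OF ij(1)] \<theta>R_r[OF ij(1)] \<theta>L_l[OF ij(1)])
      have "app2 (copy W) i i z = z *\<^sub>C app2 (copy W) i i 1"
        using lin_scale[OF two_cell_lin[OF A.copy one_cell_id ij(1,1)], of 1 z] by simp
      then have "app2 (\<theta>L \<star> \<theta>R) i i (app2 (copy W) i i z) = z *\<^sub>C app2 (copy W') i i 1"
        by (simp add: lin_scale[OF lin_hcomp UNIV_I] 1)
      also have "\<dots> = app2 (copy W') i i z"
        using lin_scale[OF two_cell_lin[OF B.copy one_cell_id ij(1,1)], of 1 z] by simp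
      finally show ?thesis using True by simp
    next
      case False
      then have z0: "z = 0" using z by simp
      note S = hilbert_subspace[OF one_cell_hilbert[OF one_cell_id ij]]
      show ?thesis
        unfolding z0 app2_vcomp lin_zero[OF two_cell_lin[OF A.copy one_cell_id ij] S]
          lin_zero[OF two_cell_lin[OF B.copy one_cell_id ij] S]
        by (rule lin_zero[OF lin_hcomp cvec.subspace_UNIV])
    qed
  qed (simp_all add: two_cell_dom[OF A.copy] two_cell_dom[OF B.copy] two_cell_cod[OF B.copy]
      two_cell_cod[OF two_cell_\<theta>R] two_cell_cod[OF two_cell_\<theta>L])
qed

text \<open>
  Both \<open>F\<close> and \<open>F'\<close> have the outcome spaces as entries, up to the unitaries
  \<open>y \<mapsto> \<mu>\<^sup>\<dagger> (r \<otimes> y)\<close>; the comparison map goes through the common outcome space.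
\<close>

definition \<alpha> :: "('f, 'g) twocell" where
  "\<alpha> = \<lparr>dom2 = F, cod2 = F', app2 = (\<lambda>k j y.
     contract (B.R k) (ent F' k 0) (r' k)
       (B.u (A.v (dinj k (elem (A.R k) (ent F k 0) (r k) y))) k))\<rparr>"

context
  assumes same: "\<And>k. k < n \<Longrightarrow> outcome_space W F \<mu> k = outcome_space W' F' \<mu>' k"
begin

abbreviation "ve k y \<equiv> A.v (dinj k (elem (A.R k) (ent F k 0) (r k) y))"

lemma ve_carrier: "k < n \<Longrightarrow> y \<in> hcarrier (ent F k 0) \<Longrightarrow> ve k y \<in> hcarrier H"
  by (intro A.v_carrier A.dinj_T A.S_elem)

lemma \<alpha>_carrier: "k < n \<Longrightarrow> app2 \<alpha> k j y \<in> hcarrier (ent F' k 0)"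
  unfolding \<alpha>_def twocell.simps by (rule contract_carrier[OF B.hilbert_R B.hilbert_F B.r])

text \<open>
  The contraction in \<open>\<alpha>\<close> loses no information: \<open>ve k y\<close> lies in the common outcome space, so its
  image under \<open>\<mu>'\<close> is concentrated in the \<open>k\<close>-th summand.
\<close>

lemma u_ve:
  assumes k: "k < n" and y: "y \<in> hcarrier (ent F k 0)"
  shows "B.u (ve k y) = dinj k (elem (B.R k) (ent F' k 0) (r' k) (app2 \<alpha> k j y))"
proof -
  have "ve k y \<in> outcome_space W' F' \<mu>' k"
    unfolding same[OF k, symmetric] A.mem_outcome_space[OF k] using y by blast
  then obtain t where t: "t \<in> hcarrier (B.S k)" "ve k y = B.v (dinj k t)"
    unfolding B.outcome_space by blast
  have u: "B.u (ve k y) = dinj k t" unfolding t(2) by (rule B.u_v[OF B.dinj_T[OF k t(1)]])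
  then have "app2 \<alpha> k j y = contract (B.R k) (ent F' k 0) (r' k) t" by (simp add: \<alpha>_def)
  then have "elem (B.R k) (ent F' k 0) (r' k) (app2 \<alpha> k j y) = t"
    using elem_contract[OF B.hilbert_R[OF k] B.hilbert_F[OF k] B.r[OF k] t(1)] by simp
  then show ?thesis using u by simp
qed

lemma unitary_\<alpha>_map:
  assumes k: "k < n"
  shows "unitary_map (ent F k 0) (ent F' k 0) (app2 \<alpha> k 0)"
  unfolding unitary_map_def linear_map_lin
proof (intro conjI ballI subsetI)
  note AF = A.hilbert_R[OF k] A.hilbert_F[OF k] A.r[OF k]
    and BF = B.hilbert_R[OF k] B.hilbert_F[OF k] B.r[OF k]
  show "app2 \<alpha> k 0 x \<in> hcarrier (ent F' k 0)" for x by (rule \<alpha>_carrier[OF k])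
  have "lin (hcarrier (ent F k 0)) (\<lambda>y. ve k y)"
    by (rule lin_compose[OF A.lin_v lin_dinj[OF lin_elem_right[OF AF(2) lin_id]]])
      (use A.dinj_T[OF k A.S_elem[OF k]] in auto)
  then have "lin (hcarrier (ent F k 0)) (\<lambda>y. B.u (ve k y))"
    by (rule lin_compose[OF B.lin_u]) (rule ve_carrier[OF k])
  then have "lin (hcarrier (ent F k 0)) (\<lambda>y. B.u (ve k y) k)"
    by (rule lin_compose[OF lin_proj[where S=UNIV]]) simp
  then show "lin (hcarrier (ent F k 0)) (app2 \<alpha> k 0)"
    unfolding \<alpha>_def twocell.simps by (rule lin_compose[OF lin_contract]) simp
  fix x y assume xy: "x \<in> hcarrier (ent F k 0)" "y \<in> hcarrier (ent F k 0)"
  let ?e = "\<lambda>y. elem (A.R k) (ent F k 0) (r k) y"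
    and ?e' = "\<lambda>y. elem (B.R k) (ent F' k 0) (r' k) y"
  have dd: "hinner (dsum n A.S) (dinj k s) (dinj k t) = hinner (A.S k) s t" if "t \<in> hcarrier (A.S k)" for s t
    using inner_dinj[OF A.hilbert_S k dinj_carrier[OF A.hilbert_S k that]] by simp
  have dd': "hinner (dsum n B.S) (dinj k s) (dinj k t) = hinner (B.S k) s t" if "t \<in> hcarrier (B.S k)" for s t
    using inner_dinj[OF B.hilbert_S k dinj_carrier[OF B.hilbert_S k that]] by simp
  have "hinner (ent F' k 0) (app2 \<alpha> k 0 x) (app2 \<alpha> k 0 y) =
      hinner (B.S k) (?e' (app2 \<alpha> k 0 x)) (?e' (app2 \<alpha> k 0 y))"
    by (rule inner_unit_elem[OF BF \<alpha>_carrier[OF k] \<alpha>_carrier[OF k], symmetric])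
  also have "\<dots> = hinner B.T (B.u (ve k x)) (B.u (ve k y))"
    unfolding u_ve[OF k xy(1), of 0] u_ve[OF k xy(2), of 0] B.T_dsum
    by (rule dd'[symmetric]) (rule B.S_elem[OF k \<alpha>_carrier[OF k]])
  also have "\<dots> = hinner H (ve k x) (ve k y)"
    by (rule B.inner_u[OF ve_carrier[OF k xy(1)] ve_carrier[OF k xy(2)]])
  also have "\<dots> = hinner A.T (dinj k (?e x)) (dinj k (?e y))"
    by (intro A.inner_v A.dinj_T A.S_elem k xy)
  also have "\<dots> = hinner (A.S k) (?e x) (?e y)"
    unfolding A.T_dsum by (rule dd[OF A.S_elem[OF k xy(2)]])
  also have "\<dots> = hinner (ent F k 0) x y"
    by (rule inner_unit_elem[OF AF xy])
  finally show "hinner (ent F' k 0) (app2 \<alpha> k 0 x) (app2 \<alpha> k 0 y) = hinner (ent F k 0) x y" .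
next
  fix z assume z: "z \<in> hcarrier (ent F' k 0)"
  let ?e' = "\<lambda>y. elem (B.R k) (ent F' k 0) (r' k) y"
  have "B.v (dinj k (?e' z)) \<in> outcome_space W F \<mu> k"
    unfolding same[OF k] B.mem_outcome_space[OF k] using z by blast
  then obtain y where y: "y \<in> hcarrier (ent F k 0)" "B.v (dinj k (?e' z)) = ve k y"
    unfolding A.mem_outcome_space[OF k] by blast
  have "dinj k (?e' z) = B.u (ve k y)"
    unfolding y(2)[symmetric] by (rule B.u_v[OF B.dinj_T[OF k B.S_elem[OF k z]], symmetric])
  then have "dinj k (?e' z) k = dinj k (?e' (app2 \<alpha> k 0 y)) k"
    unfolding u_ve[OF k y(1), of 0] by simp
  then have "contract (B.R k) (ent F' k 0) (r' k) (?e' z) =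
      contract (B.R k) (ent F' k 0) (r' k) (?e' (app2 \<alpha> k 0 y))" by simp
  then have "z = app2 \<alpha> k 0 y"
    using contract_unit_elem[OF B.hilbert_R[OF k] B.hilbert_F[OF k] B.r[OF k]] z \<alpha>_carrier[OF k]
    by simp
  then show "z \<in> app2 \<alpha> k 0 ` hcarrier (ent F k 0)" using y(1) by blast
qed

lemma two_cell_\<alpha>: "two_cell F F' \<alpha>"
  by (rule two_cellI[OF A.F B.F])
    (auto simp: unitary_map_carrier[OF unitary_\<alpha>_map] unitary_map_lin[OF unitary_\<alpha>_map],
     simp_all add: \<alpha>_def)

lemma outcome_eq_imp_equiv: "measurement_equiv W F \<mu> W' F' \<mu>'"
proof -
  have "unitary_cell \<alpha>"
    unfolding unitary_cell_iff[OF two_cell_\<alpha> A.F B.F] using unitary_\<alpha>_map by simp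
  moreover have "(\<theta>R \<star> \<alpha>) \<cdot> \<mu> \<approx> \<mu>'"
  proof (rule cell_eqI[OF _ _ _ one_cell_scalar[OF A.hilbert_H]])
    fix i j :: nat and x assume "i < 1" "j < 1" and "x \<in> hcarrier (ent (scalar H) i j)"
    then have ij: "i = 0" "j = 0" and x: "x \<in> hcarrier H" by auto
    define y where "y k = contract (A.R k) (ent F k 0) (r k) (A.u x k)" for k
    have yc: "y k \<in> hcarrier (ent F k 0)" if "k < n" for k
      unfolding y_def by (rule contract_carrier[OF A.hilbert_R[OF that] A.hilbert_F[OF that] A.r[OF that]])
    let ?e = "\<lambda>k. dinj k (elem (A.R k) (ent F k 0) (r k) (y k))"
    have T: "A.u x \<in> hcarrier (dsum n A.S)" using A.u_carrier[OF x] by (simp add: A.T_dsum)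
    have "A.u x = (\<Sum>k<n. dinj k (A.u x k))" by (rule dsum_sum_dinj[OF T, symmetric])
    also have "\<dots> = (\<Sum>k<n. ?e k)"
    proof (intro sum.cong refl)
      fix k assume "k \<in> {..<n}"
      then have k: "k < n" by simp
      then have "A.u x k \<in> hcarrier (A.S k)" using T by (simp add: dsum_carrier)
      then show "dinj k (A.u x k) = ?e k"
        unfolding y_def by (simp add: elem_contract[OF A.hilbert_R[OF k] A.hilbert_F[OF k] A.r[OF k]])
    qed
    finally have ux: "A.u x = (\<Sum>k<n. ?e k)" .
    have "app2 (\<theta>R \<star> \<alpha>) 0 0 (A.u x) = (\<Sum>k<n. app2 (\<theta>R \<star> \<alpha>) 0 0 (?e k))"
      unfolding ux by (rule lin_sum[OF lin_hcomp cvec.subspace_UNIV UNIV_I])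
    also have "\<dots> = (\<Sum>k<n. B.u (A.v (?e k)))"
    proof (intro sum.cong refl)
      fix k assume "k \<in> {..<n}"
      then have k: "k < n" by simp
      have "app2 (\<theta>R \<star> \<alpha>) 0 0 (?e k) =
          dinj k (elem (B.R k) (ent F' k 0) (app2 \<theta>R 0 k (r k)) (app2 \<alpha> k 0 (y k)))"
        by (rule hcomp_dinj[OF two_cell_\<theta>R A.wr B.wr two_cell_\<alpha> A.F B.F])
          (use k yc A.r_carrier in auto)
      then show "app2 (\<theta>R \<star> \<alpha>) 0 0 (?e k) = B.u (A.v (?e k))"
        unfolding \<theta>R_r[OF k] u_ve[OF k yc[OF k], of 0] .
    qed
    also have "\<dots> = B.u (\<Sum>k<n. A.v (?e k))"
      by (rule lin_sum[OF B.lin_u hilbert_subspace[OF A.hilbert_H], symmetric])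
        (use ve_carrier yc in auto)
    also have "(\<Sum>k<n. A.v (?e k)) = A.v (\<Sum>k<n. ?e k)"
      by (rule lin_sum[OF A.lin_v hilbert_subspace[OF one_cell_hilbert[OF A.rF]], symmetric])
        (use A.dinj_T A.S_elem yc in auto)
    also have "\<dots> = x" unfolding ux[symmetric] by (rule A.v_u[OF x])
    finally show "app2 ((\<theta>R \<star> \<alpha>) \<cdot> \<mu>) i j x = app2 \<mu>' i j x" by (simp add: ij)
  qed (simp_all add: two_cell_dom[OF A.\<mu>] two_cell_dom[OF B.\<mu>] two_cell_cod[OF B.\<mu>]
      two_cell_cod[OF two_cell_\<theta>R] two_cell_cod[OF two_cell_\<alpha>])
  ultimately show ?thesis
    unfolding measurement_equiv_def using witness_iso two_cell_\<alpha> by blast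
qed

end

end

lemma measurement_locale:
  assumes "proj_measurement H n W F \<mu>"
  obtains r l where "measurement n W r l H F \<mu>"
proof -
  obtain r l where "witness_basis n W r l"
    using assms witness_basis_exists unfolding proj_measurement_def by blast
  then have "measurement n W r l H F \<mu>"
    using assms by (simp add: measurement_def measurement_axioms_def)
  then show ?thesis by (rule that)
qed

theorem theorem3p5:
  fixes H :: "'h::complex_vector hilb" and n :: nat
  assumes "hilbert_space H"
  shows
    "(\<exists>W :: (complex, complex) witness. is_witness n W) \<and>
     (\<forall>(W :: ('l::complex_vector, 'r::complex_vector) witness) (F :: 'f::complex_vector onecell) \<mu>.
        proj_measurement H n W F \<mu> \<longrightarrow> orthogonal_decomposition H n (outcome_space W F \<mu>)) \<and>
     (\<forall>(W :: ('l, 'r) witness) V.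
        is_witness n W \<and> orthogonal_decomposition H n V \<longrightarrow>
        (\<exists>(F :: 'h onecell) \<mu>.
           proj_measurement H n W F \<mu> \<and> (\<forall>k<n. outcome_space W F \<mu> k = V k))) \<and>
     (\<forall>(W :: ('l, 'r) witness) (F :: 'f onecell) \<mu>
        (W' :: ('k::complex_vector, 's::complex_vector) witness) (F' :: 'g::complex_vector onecell) \<mu>'.
        proj_measurement H n W F \<mu> \<and> proj_measurement H n W' F' \<mu>' \<longrightarrow>
        (measurement_equiv W F \<mu> W' F' \<mu>' \<longleftrightarrow>
         (\<forall>k<n. outcome_space W F \<mu> k = outcome_space W' F' \<mu>' k)))"
proof (intro conjI allI impI)
  show "\<exists>W :: (complex, complex) witness. is_witness n W"
    using canonical_witness by blast
next
  fix W :: "('l, 'r) witness" and F :: "'f onecell" and \<mu>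
  assume "proj_measurement H n W F \<mu>"
  then obtain r l where "measurement n W r l H F \<mu>" by (rule measurement_locale)
  then show "orthogonal_decomposition H n (outcome_space W F \<mu>)"
    by (rule measurement.outcome_spaces_decompose)
next
  fix W :: "('l, 'r) witness" and V
  assume *: "is_witness n W \<and> orthogonal_decomposition H n V"
  then obtain r l where "witness_basis n W r l" using witness_basis_exists by blast
  then interpret decomposition n W r l H V
    using * assms by (simp add: decomposition_def decomposition_axioms_def)
  show "\<exists>(F :: 'h onecell) \<mu>. proj_measurement H n W F \<mu> \<and> (\<forall>k<n. outcome_space W F \<mu> k = V k)"
    using measurement outcome_space_eq by blast
next
  fix W :: "('l, 'r) witness" and F :: "'f onecell" and \<mu>
    and W' :: "('k, 's) witness" and F' :: "'g onecell" and \<mu>'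
  assume "proj_measurement H n W F \<mu> \<and> proj_measurement H n W' F' \<mu>'"
  then obtain r l r' l' where "measurement n W r l H F \<mu>" "measurement n W' r' l' H F' \<mu>'"
    using measurement_locale by metis
  then interpret measurement_pair n W r l H F \<mu> W' r' l' F' \<mu>'
    by (simp add: measurement_pair_def)
  show "measurement_equiv W F \<mu> W' F' \<mu>' \<longleftrightarrow>
      (\<forall>k<n. outcome_space W F \<mu> k = outcome_space W' F' \<mu>' k)"
    using equiv_imp_outcome_eq outcome_eq_imp_equiv by blast
qed

end
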